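(* (a) Every regular abelian $(n,r,c)$-DRACKN is a roux graph for a roux with parameters $$c_g=\begin{cases} n-c(r-1)-2 & \text{if } g=\mathrm{id};\\ c&\text{otherwise.}\end{cases}\qquad( * )$$ (b) Given a finite abelian group $\Gamma$, then $B\in\mathbb{C}[\Gamma]^{n\times n}$ satisfies (R1)--(R3) if and only if $\lceil B\rfloor$ is the adjacency matrix of a (not necessarily regular) abelian cover of the complete graph. (c) Given a roux with parameters $\{c_g\}_{g\in\Gamma}$, its roux graph has diameter $3$ if and only if $c_g\neq0$ for every $g\in\Gamma$, in which case the graph is a regular antipodal cover of the complete graph. (d) The roux graph of any roux with parameters $( * )$ and $c\neq0$ is a regular abelian $(n,r,c)$-DRACKN.
   Context: For a finite abelian group $\Gamma$ (identified with its image in the group ring $\mathbb{C}[\Gamma]$) and $B\in\mathbb{C}[\Gamma]^{n\times n}$, consider the conditions: (R1) $B_{ii}=0$ for every $i$; (R2) $B_{ij}\in\Gamma$ for $i\neq j$; (R3) $B_{ji}=(B_{ij})^{-1}$ for $i\ne j$; (R4) the matrices $\{gI\}_{g\in\Gamma}$ and $\{gB\}_{g\in\Gamma}$ span an algebra. $B$ is a roux for $\Gamma$ if it satisfies (R1)--(R4). Its roux parameters are the numbers $\{c_g\}_{g\in\Gamma}$ with $B^2=(n-1)I+\sum_{g\in\Gamma}c_g\,gB$ (they exist and are nonnegative integers summing to $n-2$). $\lceil B\rfloor$ is the matrix indexed by $[n]\times\Gamma$, where $[n]=\{1,\dots,n\}$, obtained by applying the Cayley representation of $\Gamma$ (extended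 linearly to $\mathbb{C}[\Gamma]$) to each entry of $B$; for $x\in\Gamma$ the $(g,h)$ entry of the image of $x$ is $1$ if $xh=g$ and $0$ otherwise. The roux graph of a roux $B$ is the graph with vertex set $[n]\times\Gamma$ and adjacency matrix $\lceil B\rfloor$; it is a cover of the complete graph whose fibres are the sets $\{i\}\times\Gamma$. Graphs are simple. A graph is distance-regular if for every ordered pair of vertices $(u,v)$ the number of vertices simultaneously at distance $i$ from $u$ and distance $j$ from $v$ is determined by $i$, $j$ and the distance between $u$ and $v$. A connected graph is antipodal if its vertices can be partitioned into fibres such that the distance between two distinct vertices is the diameter if and only if they belong to the same fibre. A cover of the complete graph is a graph with a partition of its vertices into independent sets (fibres) such that the induced subgraph on the union of any two distinct fibres is a perfect matching; it is an antipodal cover if the graph is antipodal with antipodal fibres equal to the covering fibres. A DRACKN is a distance-regular antipodal cover of the complete graph; it is an $(n,r,c)$-DRACKN if it has $rn$ vertices, its fibres have size $r$, and every pair of vertices at distance $2$ has $c$ common neighbors. Given a cover with fibres of size $r$, write its adjacency matrix $A$ in $r\times r$ blocks $A_{ij}$ (zero on the diagonal, permutation matrices off the diagonal), and normalize it to $DAD^{-1}$, where $D$ is block diagonal with first block the identity and $j$th block $A_{1j}$ for $j>1$. Let $\Pi\le S_r$ be the group generated by the permutations represented by the off-diagonal blocks of the normalized matrix (well defined up to conjugation in $S_r$). The cover is regular if $\Pi$ acts regularly on $[r]$, and abelian if $\Pi$ is abelian.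
   Formalization: (c) asks c_g≠0 only for g≠id (the hexagon, over Z_2 with n=3, has diameter 3 but c_id=0); (c) and (d) assume |Γ|≥2 and n≥2, since for trivial Γ the roux graph is K_n, of diameter 1 and not antipodal with singleton fibres, and for n=1 the parameters are undefined. *)

theory Defs
  imports Complex_Main "HOL-Library.Extended_Nat" "HOL-Library.Disjoint_Sets"
    "HOL-Algebra.Ring" "HOL-Algebra.Generated_Groups" "HOL-Algebra.Sym_Groups"
begin

section \<open>The group algebra and matrices over it\<close>

text \<open>An element of the complex group algebra of a finite group is its coefficient function,
  extended by zero off the carrier.\<close>

definition group_algebra :: "('g, 'm) monoid_scheme \<Rightarrow> ('g \<Rightarrow> complex) ring" where
  "group_algebra \<Gamma> =
     \<lparr>carrier = {x. \<forall>g. g \<notin> carrier \<Gamma> \<longrightarrow> x g = 0},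
      monoid.mult = (\<lambda>x y g. if g \<in> carrier \<Gamma>
                      then \<Sum>h\<in>carrier \<Gamma>. x h * y (inv\<^bsub>\<Gamma>\<^esub> h \<otimes>\<^bsub>\<Gamma>\<^esub> g) else 0),
      one = (\<lambda>g. of_bool (g = \<one>\<^bsub>\<Gamma>\<^esub>)),
      zero = (\<lambda>g. 0),
      add = (\<lambda>x y g. x g + y g)\<rparr>"

lemma group_algebra_cring:
  fixes \<Gamma> :: "('g, 'm) monoid_scheme"
  assumes "comm_group \<Gamma>" and fin: "finite (carrier \<Gamma>)"
  shows "cring (group_algebra \<Gamma>)"
proof -
  interpret comm_group \<Gamma> by fact
  let ?G = "carrier \<Gamma>"
  have shift: "(\<Sum>h\<in>?G. f (inv\<^bsub>\<Gamma>\<^esub> h \<otimes>\<^bsub>\<Gamma>\<^esub> g)) = (\<Sum>h\<in>?G. f h)" if "g \<in> ?G" for f :: "'g \<Rightarrow> complex" and g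
    by (rule sum.reindex_bij_witness[where j = "\<lambda>h. inv\<^bsub>\<Gamma>\<^esub> h \<otimes>\<^bsub>\<Gamma>\<^esub> g" and i = "\<lambda>k. g \<otimes>\<^bsub>\<Gamma>\<^esub> inv\<^bsub>\<Gamma>\<^esub> k"])
       (use that in \<open>auto simp: m_assoc inv_mult_group m_comm m_lcomm\<close>)
  have comm: "(\<Sum>h\<in>?G. x h * y (inv\<^bsub>\<Gamma>\<^esub> h \<otimes>\<^bsub>\<Gamma>\<^esub> g)) = (\<Sum>h\<in>?G. y h * x (inv\<^bsub>\<Gamma>\<^esub> h \<otimes>\<^bsub>\<Gamma>\<^esub> g))"
    if "g \<in> ?G" for x y :: "'g \<Rightarrow> complex" and g
  proof -
    have "(\<Sum>h\<in>?G. y h * x (inv\<^bsub>\<Gamma>\<^esub> h \<otimes>\<^bsub>\<Gamma>\<^esub> g))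
        = (\<Sum>h\<in>?G. y (inv\<^bsub>\<Gamma>\<^esub> h \<otimes>\<^bsub>\<Gamma>\<^esub> g) * x (inv\<^bsub>\<Gamma>\<^esub> (inv\<^bsub>\<Gamma>\<^esub> h \<otimes>\<^bsub>\<Gamma>\<^esub> g) \<otimes>\<^bsub>\<Gamma>\<^esub> g))"
      using shift[OF that, of "\<lambda>h. y h * x (inv\<^bsub>\<Gamma>\<^esub> h \<otimes>\<^bsub>\<Gamma>\<^esub> g)"] by simp
    also have "\<dots> = (\<Sum>h\<in>?G. x h * y (inv\<^bsub>\<Gamma>\<^esub> h \<otimes>\<^bsub>\<Gamma>\<^esub> g))"
      by (rule sum.cong) (use that in \<open>auto simp: inv_mult_group m_assoc m_comm m_lcomm\<close>)
    finally show ?thesis by simp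
  qed
  have assoc: "(\<Sum>h\<in>?G. (\<Sum>k\<in>?G. x k * y (inv\<^bsub>\<Gamma>\<^esub> k \<otimes>\<^bsub>\<Gamma>\<^esub> h)) * z (inv\<^bsub>\<Gamma>\<^esub> h \<otimes>\<^bsub>\<Gamma>\<^esub> g))
     = (\<Sum>k\<in>?G. x k * (\<Sum>h\<in>?G. y h * z (inv\<^bsub>\<Gamma>\<^esub> h \<otimes>\<^bsub>\<Gamma>\<^esub> (inv\<^bsub>\<Gamma>\<^esub> k \<otimes>\<^bsub>\<Gamma>\<^esub> g))))"
    if g: "g \<in> ?G" for x y z :: "'g \<Rightarrow> complex" and g
  proof -
    have "(\<Sum>h\<in>?G. (\<Sum>k\<in>?G. x k * y (inv\<^bsub>\<Gamma>\<^esub> k \<otimes>\<^bsub>\<Gamma>\<^esub> h)) * z (inv\<^bsub>\<Gamma>\<^esub> h \<otimes>\<^bsub>\<Gamma>\<^esub> g))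
       = (\<Sum>k\<in>?G. \<Sum>h\<in>?G. x k * y (inv\<^bsub>\<Gamma>\<^esub> k \<otimes>\<^bsub>\<Gamma>\<^esub> h) * z (inv\<^bsub>\<Gamma>\<^esub> h \<otimes>\<^bsub>\<Gamma>\<^esub> g))"
      by (simp add: sum_distrib_right) (rule sum.swap)
    also have "\<dots> = (\<Sum>k\<in>?G. x k * (\<Sum>h\<in>?G. y (inv\<^bsub>\<Gamma>\<^esub> k \<otimes>\<^bsub>\<Gamma>\<^esub> h) * z (inv\<^bsub>\<Gamma>\<^esub> h \<otimes>\<^bsub>\<Gamma>\<^esub> g)))"
      by (simp add: sum_distrib_left mult.assoc)
    also have "\<dots> = (\<Sum>k\<in>?G. x k * (\<Sum>h\<in>?G. y h * z (inv\<^bsub>\<Gamma>\<^esub> h \<otimes>\<^bsub>\<Gamma>\<^esub> (inv\<^bsub>\<Gamma>\<^esub> k \<otimes>\<^bsub>\<Gamma>\<^esub> g))))"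
    proof (rule sum.cong[OF refl], rule arg_cong2[where f = "(*)", OF refl])
      fix k assume k: "k \<in> ?G"
      have canc: "k \<otimes>\<^bsub>\<Gamma>\<^esub> (inv\<^bsub>\<Gamma>\<^esub> k \<otimes>\<^bsub>\<Gamma>\<^esub> a) = a"
        "inv\<^bsub>\<Gamma>\<^esub> k \<otimes>\<^bsub>\<Gamma>\<^esub> (k \<otimes>\<^bsub>\<Gamma>\<^esub> a) = a" if "a \<in> ?G" for a
        using k that by (simp_all flip: m_assoc)
      show "(\<Sum>h\<in>?G. y (inv\<^bsub>\<Gamma>\<^esub> k \<otimes>\<^bsub>\<Gamma>\<^esub> h) * z (inv\<^bsub>\<Gamma>\<^esub> h \<otimes>\<^bsub>\<Gamma>\<^esub> g))
          = (\<Sum>h\<in>?G. y h * z (inv\<^bsub>\<Gamma>\<^esub> h \<otimes>\<^bsub>\<Gamma>\<^esub> (inv\<^bsub>\<Gamma>\<^esub> k \<otimes>\<^bsub>\<Gamma>\<^esub> g)))"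
        by (rule sum.reindex_bij_witness[where j = "\<lambda>h. inv\<^bsub>\<Gamma>\<^esub> k \<otimes>\<^bsub>\<Gamma>\<^esub> h" and i = "\<lambda>h. k \<otimes>\<^bsub>\<Gamma>\<^esub> h"])
           (use k g in \<open>auto simp: m_assoc inv_mult_group canc\<close>)
    qed
    finally show ?thesis .
  qed
  have one: "(\<Sum>h\<in>?G. of_bool (h = \<one>\<^bsub>\<Gamma>\<^esub>) * x (inv\<^bsub>\<Gamma>\<^esub> h \<otimes>\<^bsub>\<Gamma>\<^esub> g)) = x g" if "g \<in> ?G" for x :: "'g \<Rightarrow> complex" and g
  proof -
    have "(\<Sum>h\<in>?G. of_bool (h = \<one>\<^bsub>\<Gamma>\<^esub>) * x (inv\<^bsub>\<Gamma>\<^esub> h \<otimes>\<^bsub>\<Gamma>\<^esub> g))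
       = (\<Sum>h\<in>?G. if h = \<one>\<^bsub>\<Gamma>\<^esub> then x g else 0)"
      by (rule sum.cong) (use that in auto)
    then show ?thesis using fin by (simp add: sum.delta)
  qed
  show ?thesis
  proof (rule cringI)
    show "abelian_group (group_algebra \<Gamma>)"
    proof (rule abelian_groupI)
      fix x assume "x \<in> carrier (group_algebra \<Gamma>)"
      then show "\<exists>y\<in>carrier (group_algebra \<Gamma>). y \<oplus>\<^bsub>group_algebra \<Gamma>\<^esub> x = \<zero>\<^bsub>group_algebra \<Gamma>\<^esub>"
        by (intro bexI[where x = "\<lambda>g. - x g"]) (auto simp: group_algebra_def)
    qed (auto simp: group_algebra_def fun_eq_iff)
    show "comm_monoid (group_algebra \<Gamma>)"
      by (rule comm_monoidI)
        (auto simp: group_algebra_def fun_eq_iff assoc one comm cong: sum.cong)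
  qed (auto simp: group_algebra_def fun_eq_iff algebra_simps sum.distrib)
qed

definition ga_of :: "'g \<Rightarrow> 'g \<Rightarrow> complex" where
  "ga_of g = (\<lambda>h. of_bool (h = g))"

text \<open>An \<open>n \<times> n\<close> matrix has indices \<open>1..n\<close> and is extended by zero, so that equality of
  matrices is equality of functions.\<close>

type_synonym 'g ga_mat = "nat \<Rightarrow> nat \<Rightarrow> 'g \<Rightarrow> complex"

definition ga_mats :: "('g, 'm) monoid_scheme \<Rightarrow> nat \<Rightarrow> 'g ga_mat set" where
  "ga_mats \<Gamma> n =
     {M. \<forall>i j. if i \<in> {1..n} \<and> j \<in> {1..n} then M i j \<in> carrier (group_algebra \<Gamma>)
               else M i j = \<zero>\<^bsub>group_algebra \<Gamma>\<^esub>}"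

definition ga_mat_one :: "('g, 'm) monoid_scheme \<Rightarrow> nat \<Rightarrow> 'g ga_mat" where
  "ga_mat_one \<Gamma> n = (\<lambda>i j. if i = j \<and> i \<in> {1..n} then \<one>\<^bsub>group_algebra \<Gamma>\<^esub>
                            else \<zero>\<^bsub>group_algebra \<Gamma>\<^esub>)"

definition ga_mat_mult ::
    "('g, 'm) monoid_scheme \<Rightarrow> nat \<Rightarrow> 'g ga_mat \<Rightarrow> 'g ga_mat \<Rightarrow> 'g ga_mat" where
  "ga_mat_mult \<Gamma> n M N = (\<lambda>i j g. \<Sum>k\<in>{1..n}. (M i k \<otimes>\<^bsub>group_algebra \<Gamma>\<^esub> N k j) g)"

definition ga_mat_scale :: "('g, 'm) monoid_scheme \<Rightarrow> 'g \<Rightarrow> 'g ga_mat \<Rightarrow> 'g ga_mat" where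
  "ga_mat_scale \<Gamma> g M = (\<lambda>i j. ga_of g \<otimes>\<^bsub>group_algebra \<Gamma>\<^esub> M i j)"

section \<open>Roux\<close>

definition roux_R1 :: "('g, 'm) monoid_scheme \<Rightarrow> nat \<Rightarrow> 'g ga_mat \<Rightarrow> bool" where
  "roux_R1 \<Gamma> n B \<longleftrightarrow> (\<forall>i\<in>{1..n}. B i i = \<zero>\<^bsub>group_algebra \<Gamma>\<^esub>)"

definition roux_R2 :: "('g, 'm) monoid_scheme \<Rightarrow> nat \<Rightarrow> 'g ga_mat \<Rightarrow> bool" where
  "roux_R2 \<Gamma> n B \<longleftrightarrow>
     (\<forall>i\<in>{1..n}. \<forall>j\<in>{1..n}. i \<noteq> j \<longrightarrow> B i j \<in> ga_of ` carrier \<Gamma>)"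

definition roux_R3 :: "('g, 'm) monoid_scheme \<Rightarrow> nat \<Rightarrow> 'g ga_mat \<Rightarrow> bool" where
  "roux_R3 \<Gamma> n B \<longleftrightarrow>
     (\<forall>i\<in>{1..n}. \<forall>j\<in>{1..n}. i \<noteq> j \<longrightarrow> B j i = inv\<^bsub>group_algebra \<Gamma>\<^esub> (B i j))"

definition roux_span :: "('g, 'm) monoid_scheme \<Rightarrow> nat \<Rightarrow> 'g ga_mat \<Rightarrow> 'g ga_mat set" where
  "roux_span \<Gamma> n B =
     {(\<lambda>i j x. (\<Sum>g\<in>carrier \<Gamma>. a g * ga_mat_scale \<Gamma> g (ga_mat_one \<Gamma> n) i j x)
             + (\<Sum>g\<in>carrier \<Gamma>. b g * ga_mat_scale \<Gamma> g B i j x)) | a b. True}"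

text \<open>A linear span is an algebra iff it is closed under multiplication; the identity matrix
  always belongs to this one.\<close>

definition roux_R4 :: "('g, 'm) monoid_scheme \<Rightarrow> nat \<Rightarrow> 'g ga_mat \<Rightarrow> bool" where
  "roux_R4 \<Gamma> n B \<longleftrightarrow>
     (\<forall>M\<in>roux_span \<Gamma> n B. \<forall>N\<in>roux_span \<Gamma> n B. ga_mat_mult \<Gamma> n M N \<in> roux_span \<Gamma> n B)"

definition roux :: "('g, 'm) monoid_scheme \<Rightarrow> nat \<Rightarrow> 'g ga_mat \<Rightarrow> bool" where
  "roux \<Gamma> n B \<longleftrightarrow> B \<in> ga_mats \<Gamma> n \<and>
     roux_R1 \<Gamma> n B \<and> roux_R2 \<Gamma> n B \<and> roux_R3 \<Gamma> n B \<and> roux_R4 \<Gamma> n B"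

text \<open>The equation determines \<open>c\<close> on the carrier only if \<open>n \<ge> 2\<close>; for \<open>n \<le> 1\<close> every \<open>c\<close>
  satisfies it. The coefficient at the identity is the number of common neighbours of adjacent
  vertices of the roux graph. It may vanish for a graph of diameter 3: for the group of order 2,
  the \<open>3 \<times> 3\<close> matrix whose off-diagonal entries are the non-identity element yields the
  hexagon. For the trivial group the roux graph is the complete graph.\<close>

definition roux_params ::
    "('g, 'm) monoid_scheme \<Rightarrow> nat \<Rightarrow> 'g ga_mat \<Rightarrow> ('g \<Rightarrow> complex) \<Rightarrow> bool" where
  "roux_params \<Gamma> n B c \<longleftrightarrow>
     ga_mat_mult \<Gamma> n B B =
       (\<lambda>i j x. (of_nat n - 1) * ga_mat_one \<Gamma> n i j x
              + (\<Sum>g\<in>carrier \<Gamma>. c g * ga_mat_scale \<Gamma> g B i j x))"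

definition drackn_params ::
    "('g, 'm) monoid_scheme \<Rightarrow> nat \<Rightarrow> nat \<Rightarrow> nat \<Rightarrow> 'g \<Rightarrow> complex" where
  "drackn_params \<Gamma> n r c =
     (\<lambda>g. if g = \<one>\<^bsub>\<Gamma>\<^esub> then of_nat n - of_nat c * (of_nat r - 1) - 2 else of_nat c)"

section \<open>Graphs\<close>

definition simple_graph :: "'v set \<Rightarrow> ('v \<times> 'v) set \<Rightarrow> bool" where
  "simple_graph V E \<longleftrightarrow> finite V \<and> E \<subseteq> V \<times> V \<and> sym E \<and> irrefl E"

definition is_adjacency_matrix ::
    "'v set \<Rightarrow> ('v \<times> 'v) set \<Rightarrow> ('v \<Rightarrow> 'v \<Rightarrow> complex) \<Rightarrow> bool" where
  "is_adjacency_matrix V E M \<longleftrightarrow> (\<forall>u\<in>V. \<forall>v\<in>V. M u v = of_bool ((u, v) \<in> E))"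

text \<open>The infimum of the empty set is \<open>\<infinity>\<close>, the distance between different components.\<close>

definition gdist :: "('v \<times> 'v) set \<Rightarrow> 'v \<Rightarrow> 'v \<Rightarrow> enat" where
  "gdist E u v = Inf (enat ` {k. (u, v) \<in> E ^^ k})"

definition gdiameter :: "'v set \<Rightarrow> ('v \<times> 'v) set \<Rightarrow> enat" where
  "gdiameter V E = Sup {gdist E u v | u v. u \<in> V \<and> v \<in> V}"

definition connected_graph :: "'v set \<Rightarrow> ('v \<times> 'v) set \<Rightarrow> bool" where
  "connected_graph V E \<longleftrightarrow> V \<noteq> {} \<and> (\<forall>u\<in>V. \<forall>v\<in>V. gdist E u v \<noteq> \<infinity>)"

definition distance_regular :: "'v set \<Rightarrow> ('v \<times> 'v) set \<Rightarrow> bool" where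
  "distance_regular V E \<longleftrightarrow>
     (\<exists>p :: enat \<Rightarrow> enat \<Rightarrow> enat \<Rightarrow> nat. \<forall>u\<in>V. \<forall>v\<in>V. \<forall>i j.
        card {w \<in> V. gdist E u w = i \<and> gdist E v w = j} = p i j (gdist E u v))"

definition antipodal_with :: "'v set \<Rightarrow> ('v \<times> 'v) set \<Rightarrow> 'v set set \<Rightarrow> bool" where
  "antipodal_with V E \<F> \<longleftrightarrow> connected_graph V E \<and> partition_on V \<F> \<and>
     (\<forall>u\<in>V. \<forall>v\<in>V. u \<noteq> v \<longrightarrow>
        (gdist E u v = gdiameter V E \<longleftrightarrow> (\<exists>F\<in>\<F>. u \<in> F \<and> v \<in> F)))"

section \<open>Covers of complete graphs\<close>

text \<open>A cover of the complete graph on \<open>n\<close> vertices with fibres of size \<open>r\<close>. The subgraph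
  induced on a set \<open>U\<close> is a perfect matching iff each vertex of \<open>U\<close> has exactly one neighbour
  in \<open>U\<close>.\<close>

definition complete_cover ::
    "nat \<Rightarrow> nat \<Rightarrow> 'v set \<Rightarrow> ('v \<times> 'v) set \<Rightarrow> 'v set set \<Rightarrow> bool" where
  "complete_cover n r V E \<F> \<longleftrightarrow> simple_graph V E \<and> partition_on V \<F> \<and>
     card \<F> = n \<and> (\<forall>F\<in>\<F>. card F = r) \<and>
     (\<forall>F\<in>\<F>. \<forall>u\<in>F. \<forall>v\<in>F. (u, v) \<notin> E) \<and>
     (\<forall>F\<in>\<F>. \<forall>F'\<in>\<F>. F \<noteq> F' \<longrightarrow>
        (\<forall>u\<in>F \<union> F'. \<exists>!v. v \<in> F \<union> F' \<and> (u, v) \<in> E))"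

definition antipodal_cover ::
    "nat \<Rightarrow> nat \<Rightarrow> 'v set \<Rightarrow> ('v \<times> 'v) set \<Rightarrow> 'v set set \<Rightarrow> bool" where
  "antipodal_cover n r V E \<F> \<longleftrightarrow> complete_cover n r V E \<F> \<and> antipodal_with V E \<F>"

definition drackn ::
    "nat \<Rightarrow> nat \<Rightarrow> nat \<Rightarrow> 'v set \<Rightarrow> ('v \<times> 'v) set \<Rightarrow> 'v set set \<Rightarrow> bool" where
  "drackn n r c V E \<F> \<longleftrightarrow> antipodal_cover n r V E \<F> \<and> distance_regular V E \<and>
     (\<forall>u\<in>V. \<forall>v\<in>V. gdist E u v = 2 \<longrightarrow>
        card {w \<in> V. (u, w) \<in> E \<and> (v, w) \<in> E} = c)"

text \<open>To write the adjacency matrix in blocks one has to enumerate the fibres by \<open>1..n\<close> and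
  each fibre by \<open>1..r\<close>; \<open>l i a\<close> is the \<open>a\<close>-th vertex of the \<open>i\<close>-th fibre.\<close>

definition cover_labelling ::
    "nat \<Rightarrow> nat \<Rightarrow> 'v set set \<Rightarrow> (nat \<Rightarrow> nat \<Rightarrow> 'v) \<Rightarrow> bool" where
  "cover_labelling n r \<F> l \<longleftrightarrow>
     bij_betw (\<lambda>i. l i ` {1..r}) {1..n} \<F> \<and> (\<forall>i\<in>{1..n}. inj_on (l i) {1..r})"

text \<open>The permutation \<open>\<sigma>\<close> represented by the block \<open>A\<^sub>i\<^sub>j\<close> (\<open>i \<noteq> j\<close>): the entry of \<open>A\<^sub>i\<^sub>j\<close> at
  \<open>(a, b)\<close> is 1 iff \<open>\<sigma> b = a\<close>. Products and inverses of permutation matrices then correspond to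
  products and inverses in the symmetric group.\<close>

definition block_perm ::
    "nat \<Rightarrow> ('v \<times> 'v) set \<Rightarrow> (nat \<Rightarrow> nat \<Rightarrow> 'v) \<Rightarrow> nat \<Rightarrow> nat \<Rightarrow> nat \<Rightarrow> nat" where
  "block_perm r E l i j =
     (\<lambda>b. if b \<in> {1..r} then THE a. a \<in> {1..r} \<and> (l i a, l j b) \<in> E else b)"

definition diag_perm ::
    "nat \<Rightarrow> ('v \<times> 'v) set \<Rightarrow> (nat \<Rightarrow> nat \<Rightarrow> 'v) \<Rightarrow> nat \<Rightarrow> nat \<Rightarrow> nat" where
  "diag_perm r E l j = (if j = 1 then \<one>\<^bsub>sym_group r\<^esub> else block_perm r E l 1 j)"

text \<open>The \<open>(i, j)\<close> block of the normalized matrix \<open>D A D\<^sup>-\<^sup>1\<close>.\<close>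

definition normalized_perm ::
    "nat \<Rightarrow> ('v \<times> 'v) set \<Rightarrow> (nat \<Rightarrow> nat \<Rightarrow> 'v) \<Rightarrow> nat \<Rightarrow> nat \<Rightarrow> nat \<Rightarrow> nat" where
  "normalized_perm r E l i j =
     diag_perm r E l i \<otimes>\<^bsub>sym_group r\<^esub> block_perm r E l i j
       \<otimes>\<^bsub>sym_group r\<^esub> inv\<^bsub>sym_group r\<^esub> (diag_perm r E l j)"

definition cover_group ::
    "nat \<Rightarrow> nat \<Rightarrow> ('v \<times> 'v) set \<Rightarrow> (nat \<Rightarrow> nat \<Rightarrow> 'v) \<Rightarrow> (nat \<Rightarrow> nat) set" where
  "cover_group n r E l =
     generate (sym_group r)
       {normalized_perm r E l i j | i j. i \<in> {1..n} \<and> j \<in> {1..n} \<and> i \<noteq> j}"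

text \<open>The group is independent of the labelling up to conjugation in the symmetric group, and a
  cover has a labelling, so the universal quantifiers below could as well be existential.\<close>

definition regular_cover ::
    "nat \<Rightarrow> nat \<Rightarrow> 'v set \<Rightarrow> ('v \<times> 'v) set \<Rightarrow> 'v set set \<Rightarrow> bool" where
  "regular_cover n r V E \<F> \<longleftrightarrow> complete_cover n r V E \<F> \<and>
     (\<forall>l. cover_labelling n r \<F> l \<longrightarrow>
        (\<forall>a\<in>{1..r}. \<forall>b\<in>{1..r}. \<exists>!p. p \<in> cover_group n r E l \<and> p a = b))"

definition abelian_cover ::
    "nat \<Rightarrow> nat \<Rightarrow> 'v set \<Rightarrow> ('v \<times> 'v) set \<Rightarrow> 'v set set \<Rightarrow> bool" where
  "abelian_cover n r V E \<F> \<longleftrightarrow> complete_cover n r V E \<F> \<and>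
     (\<forall>l. cover_labelling n r \<F> l \<longrightarrow>
        comm_group (sym_group r \<lparr>carrier := cover_group n r E l\<rparr>))"

definition cover_iso ::
    "'v set \<Rightarrow> ('v \<times> 'v) set \<Rightarrow> 'v set set \<Rightarrow>
     'w set \<Rightarrow> ('w \<times> 'w) set \<Rightarrow> 'w set set \<Rightarrow> bool" where
  "cover_iso V E \<F> V' E' \<F>' \<longleftrightarrow>
     (\<exists>\<phi>. bij_betw \<phi> V V' \<and>
        (\<forall>u\<in>V. \<forall>v\<in>V. (u, v) \<in> E \<longleftrightarrow> (\<phi> u, \<phi> v) \<in> E') \<and>
        (\<lambda>F. \<phi> ` F) ` \<F> = \<F>')"

section \<open>Roux graphs\<close>

definition cayley :: "('g, 'm) monoid_scheme \<Rightarrow> ('g \<Rightarrow> complex) \<Rightarrow> 'g \<Rightarrow> 'g \<Rightarrow> complex" where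
  "cayley \<Gamma> a g h = (\<Sum>x\<in>carrier \<Gamma>. a x * of_bool (x \<otimes>\<^bsub>\<Gamma>\<^esub> h = g))"

definition roux_lift ::
    "('g, 'm) monoid_scheme \<Rightarrow> 'g ga_mat \<Rightarrow> nat \<times> 'g \<Rightarrow> nat \<times> 'g \<Rightarrow> complex" where
  "roux_lift \<Gamma> B = (\<lambda>(i, g) (j, h). cayley \<Gamma> (B i j) g h)"

definition roux_verts :: "('g, 'm) monoid_scheme \<Rightarrow> nat \<Rightarrow> (nat \<times> 'g) set" where
  "roux_verts \<Gamma> n = {1..n} \<times> carrier \<Gamma>"

definition roux_edges ::
    "('g, 'm) monoid_scheme \<Rightarrow> nat \<Rightarrow> 'g ga_mat \<Rightarrow> ((nat \<times> 'g) \<times> (nat \<times> 'g)) set" where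
  "roux_edges \<Gamma> n B =
     {(u, v). u \<in> roux_verts \<Gamma> n \<and> v \<in> roux_verts \<Gamma> n \<and> roux_lift \<Gamma> B u v = 1}"

definition roux_fibres :: "('g, 'm) monoid_scheme \<Rightarrow> nat \<Rightarrow> (nat \<times> 'g) set set" where
  "roux_fibres \<Gamma> n = (\<lambda>i. {i} \<times> carrier \<Gamma>) ` {1..n}"

end

theory Submission
  imports Defs
begin

text \<open>Conditions (R1)--(R3) say that \<open>B\<close> is given by gains \<open>b i j\<close> in \<open>\<Gamma>\<close> with \<open>b j i = (b i j)\<^sup>-\<^sup>1\<close>. The
  coefficient of \<open>x\<close> in the \<open>(i, j)\<close> entry of \<open>B\<^sup>2\<close> is the number of \<open>k\<close> with \<open>b i k b k j = x\<close>, which is also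
  a number of common neighbours in the roux graph, so that \<open>c g\<close> is the number of common neighbours of
  any \<open>(i, x)\<close> and \<open>(j, y)\<close> with \<open>i \<noteq> j\<close> and \<open>x y\<^sup>-\<^sup>1 b j i = g\<close>. This settles diameter and antipodality.
  Up to conjugation, the group of the cover is generated by the translations by \<open>b 1 i b i j b j 1\<close>.
  Conversely, an antipodal cover with \<open>n, r \<ge> 2\<close> has diameter 3, so non-adjacent vertices of distinct fibres
  have \<open>c\<close> common neighbours; if the group of the cover is abelian and regular, identifying it with
  each fibre turns the normalized blocks into gains.\<close>

section \<open>Distances in covers of complete graphs\<close>

text \<open>The parameter at \<one> behaves unlike the others. It counts common neighbours of
  adjacent vertices, so the condition on vertices at distance 2 says nothing about it; it is forced
  because the parameters sum to n - 2, and this is where n - c(r-1) - 2 comes from. (R4) costs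
  nothing once the equation for B^2 is known: the complex span of all gI and gB is the span of I and
  B over the group algebra, so a quadratic equation for B closes it under products. Diagonal gains
  are set to \<one> although the diagonal of the matrix is zero. The cancellation of
  \<open>b i j\<close> against \<open>b j i\<close>, and with it the formula for the normalized
  blocks, then needs no case distinction, at the price of excluding the end points from a path by
  hand. The cover group is defined through arbitrary labellings, which may permute the fibres and
  label each one in an unrelated way. Translations are therefore written with one chart at each end;
  under normalization every chart except that of the first fibre cancels.\<close>

lemma gdist_le_iff: "gdist E u v \<le> enat k \<longleftrightarrow> (\<exists>m\<le>k. (u, v) \<in> E ^^ m)"
proof
  let ?S = "enat ` {k. (u, v) \<in> E ^^ k}"
  assume le: "gdist E u v \<le> enat k"
  then have "?S \<noteq> {}" by (auto simp: gdist_def Inf_enat_def simp del: not_all)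
  \<comment> \<open>The infimum of a nonempty set of extended naturals is attained, so it is the
    length of a walk.\<close>
  then have "Inf ?S \<in> ?S" by (metis Inf_enat_def LeastI ex_in_conv)
  then show "\<exists>m\<le>k. (u, v) \<in> E ^^ m" using le by (auto simp: gdist_def)
next
  assume "\<exists>m\<le>k. (u, v) \<in> E ^^ m"
  then obtain m where m: "m \<le> k" "(u, v) \<in> E ^^ m" by blast
  then have "gdist E u v \<le> enat m" unfolding gdist_def by (auto intro: Inf_lower)
  with m show "gdist E u v \<le> enat k" by (meson enat_ord_simps(1) order_trans)
qed

lemma gdist_eq_0_iff: "gdist E u v = 0 \<longleftrightarrow> u = v"
  using gdist_le_iff[of E u v 0] by (simp flip: zero_enat_def)

lemma gdist_eq_1_iff: "gdist E u v = 1 \<longleftrightarrow> u \<noteq> v \<and> (u, v) \<in> E"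
proof -
  have "gdist E u v = 1 \<longleftrightarrow> gdist E u v \<le> enat 1 \<and> gdist E u v \<noteq> 0"
    by (cases "gdist E u v") (auto simp: one_enat_def zero_enat_def)
  then show ?thesis by (auto simp: gdist_le_iff gdist_eq_0_iff le_Suc_eq)
qed

lemma relpow_2_iff: "(u, v) \<in> E ^^ 2 \<longleftrightarrow> (\<exists>w. (u, w) \<in> E \<and> (w, v) \<in> E)"
  by (auto simp: numeral_2_eq_2)

lemma gdist_eq_2_iff:
  "gdist E u v = 2 \<longleftrightarrow> u \<noteq> v \<and> (u, v) \<notin> E \<and> (\<exists>w. (u, w) \<in> E \<and> (w, v) \<in> E)"
proof -
  have "gdist E u v = 2 \<longleftrightarrow> gdist E u v \<le> enat 2 \<and> \<not> gdist E u v \<le> enat 1"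
    by (cases "gdist E u v") (auto simp: numeral_eq_enat)
  also have "\<dots> \<longleftrightarrow> u \<noteq> v \<and> (u, v) \<notin> E \<and> (u, v) \<in> E ^^ 2"
  proof -
    have ex: "(\<exists>m\<le>1. Q m) \<longleftrightarrow> Q 0 \<or> Q 1" "(\<exists>m\<le>2. Q m) \<longleftrightarrow> Q 0 \<or> Q 1 \<or> Q 2" for Q :: "nat \<Rightarrow> bool"
      by (auto simp: le_Suc_eq numeral_2_eq_2)
    have "E ^^ 1 = E" "E ^^ 0 = Id" by auto
    then show ?thesis by (auto simp only: gdist_le_iff ex pair_in_Id_conv)
  qed
  finally show ?thesis by (simp add: relpow_2_iff)
qed

lemma complete_coverD:
  assumes "complete_cover n r V E \<F>"
  shows "finite V" "E \<subseteq> V \<times> V" "sym E" "irrefl E" "partition_on V \<F>" "card \<F> = n"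
    "\<And>F. F \<in> \<F> \<Longrightarrow> card F = r" "\<And>F u v. F \<in> \<F> \<Longrightarrow> u \<in> F \<Longrightarrow> v \<in> F \<Longrightarrow> (u, v) \<notin> E"
  using assms by (simp_all add: complete_cover_def simple_graph_def)

text \<open>Independence of \<open>F\<close> forces the partner of \<open>u\<close> in the union of
  the two fibres to lie in \<open>F'\<close>.\<close>

lemma complete_cover_nbr:
  assumes "complete_cover n r V E \<F>" "F \<in> \<F>" "F' \<in> \<F>" "F \<noteq> F'" "u \<in> F"
  shows "\<exists>!v. v \<in> F' \<and> (u, v) \<in> E"
proof -
  have "\<exists>!v. v \<in> F \<union> F' \<and> (u, v) \<in> E" using assms by (simp add: complete_cover_def)
  then show ?thesis using complete_coverD(8)[OF assms(1,2,5)] by auto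
qed

section \<open>Fibres, neighbours and degrees in a cover\<close>

locale complete_cover_graph =
  fixes n r :: nat and V :: "'v set" and E \<F>
  assumes cover: "complete_cover n r V E \<F>"
begin

lemmas finite_V = complete_coverD(1)[OF cover]
lemmas edges_V = complete_coverD(2)[OF cover]
lemmas sym_E = complete_coverD(3)[OF cover]
lemmas partition = complete_coverD(5)[OF cover]
lemmas card_fibres = complete_coverD(6)[OF cover]
lemmas card_fibre = complete_coverD(7)[OF cover]
lemmas independent = complete_coverD(8)[OF cover]
lemmas nbr = complete_cover_nbr[OF cover]

lemma edge_commute: "(u, v) \<in> E \<longleftrightarrow> (v, u) \<in> E"
  using sym_E by (auto simp: sym_def)

lemma fibre_ex: "u \<in> V \<Longrightarrow> \<exists>F\<in>\<F>. u \<in> F"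
  using partition by (auto simp: partition_on_def)

lemma fibre_subset: "F \<in> \<F> \<Longrightarrow> F \<subseteq> V"
  using partition by (auto simp: partition_on_def)

lemma fibre_unique: "F \<in> \<F> \<Longrightarrow> F' \<in> \<F> \<Longrightarrow> u \<in> F \<Longrightarrow> u \<in> F' \<Longrightarrow> F = F'"
  using partition by (auto simp: partition_on_def disjoint_def)

lemma finite_fibres: "finite \<F>"
  using finite_V partition by (auto simp: partition_on_def intro: finite_UnionD)

lemma finite_fibre: "F \<in> \<F> \<Longrightarrow> finite F"
  using finite_V fibre_subset finite_subset by blast

text \<open>An edge from \<open>u\<close> into the independent set \<open>F'\<close> places
  \<open>u\<close> in another fibre, and the matching between the two fibres leaves \<open>u\<close>
  a single neighbour there.\<close>

lemma nbr_unique: "F' \<in> \<F> \<Longrightarrow> v \<in> F' \<Longrightarrow> w \<in> F' \<Longrightarrow> (u, v) \<in> E \<Longrightarrow> (u, w) \<in> E \<Longrightarrow> v = w"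
  using nbr fibre_ex edges_V independent by (metis SigmaD1 subsetD)

definition same_fibre :: "'v \<Rightarrow> 'v \<Rightarrow> bool" where
  "same_fibre u v \<longleftrightarrow> (\<exists>F\<in>\<F>. u \<in> F \<and> v \<in> F)"

lemma same_fibre_sym: "same_fibre u v \<Longrightarrow> same_fibre v u"
  by (auto simp: same_fibre_def)

lemma same_fibre_trans: "same_fibre u v \<Longrightarrow> same_fibre v w \<Longrightarrow> same_fibre u w"
  unfolding same_fibre_def using fibre_unique by metis

lemma same_fibre_refl: "u \<in> V \<Longrightarrow> same_fibre u u"
  using fibre_ex by (auto simp: same_fibre_def)

lemma same_fibre_no_edge: "same_fibre u v \<Longrightarrow> (u, v) \<notin> E"
  using independent by (auto simp: same_fibre_def)

lemma same_fibre_nbr: "same_fibre v w \<Longrightarrow> (u, v) \<in> E \<Longrightarrow> (u, w) \<in> E \<Longrightarrow> v = w"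
  using nbr_unique by (auto simp: same_fibre_def)

lemma nbr_ex:
  assumes "u \<in> V" "v \<in> V" "\<not> same_fibre u v"
  shows "\<exists>w\<in>V. same_fibre v w \<and> (u, w) \<in> E"
proof -
  obtain F F' where F: "F \<in> \<F>" "u \<in> F" "F' \<in> \<F>" "v \<in> F'"
    using fibre_ex assms(1,2) by meson
  then have "F \<noteq> F'" using assms(3) by (auto simp: same_fibre_def)
  then obtain w where "w \<in> F'" "(u, w) \<in> E" using nbr F by blast
  then show ?thesis using F fibre_subset by (auto simp: same_fibre_def)
qed

text \<open>Sending a neighbour to its fibre is a bijection onto the fibres other than that of
  \<open>u\<close>.\<close>

lemma degree:
  assumes "u \<in> V"
  shows "card {w \<in> V. (u, w) \<in> E} = n - 1"
proof -
  obtain F where F: "F \<in> \<F>" "u \<in> F" using fibre_ex assms by meson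
  define f where "f w = (THE F'. F' \<in> \<F> \<and> w \<in> F')" for w
  have f: "f w = F'" if "F' \<in> \<F>" "w \<in> F'" for w F'
    unfolding f_def using that fibre_unique by (intro the_equality) blast+
  have "bij_betw f {w \<in> V. (u, w) \<in> E} (\<F> - {F})"
  proof (rule bij_betw_imageI)
    show "inj_on f {w \<in> V. (u, w) \<in> E}"
    proof (rule inj_onI)
      fix w w' assume w: "w \<in> {w \<in> V. (u, w) \<in> E}" "w' \<in> {w \<in> V. (u, w) \<in> E}" "f w = f w'"
      then obtain G G' where "G \<in> \<F>" "w \<in> G" "G' \<in> \<F>" "w' \<in> G'" using fibre_ex by blast
      then show "w = w'" using w f nbr_unique by auto
    qed
    show "f ` {w \<in> V. (u, w) \<in> E} = \<F> - {F}"
    proof (intro subset_antisym subsetI)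
      fix G assume "G \<in> f ` {w \<in> V. (u, w) \<in> E}"
      then obtain w where w: "w \<in> V" "(u, w) \<in> E" "G = f w" by blast
      then obtain G' where "G' \<in> \<F>" "w \<in> G'" using fibre_ex by blast
      then show "G \<in> \<F> - {F}" using w f independent F by auto
    next
      fix G assume G: "G \<in> \<F> - {F}"
      then obtain w where w: "w \<in> G" "(u, w) \<in> E" using nbr[of F G u] F by blast
      then have "f w = G" "w \<in> V" using f G fibre_subset by auto
      then show "G \<in> f ` {w \<in> V. (u, w) \<in> E}" using w by blast
    qed
  qed
  then have "card {w \<in> V. (u, w) \<in> E} = card (\<F> - {F})" by (rule bij_betw_same_card)
  then show ?thesis using F card_fibres finite_fibres by simp
qed

end

section \<open>Covers in which vertices of distinct fibres are at distance at most 2\<close>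

locale joined_cover_graph = complete_cover_graph +
  assumes n_ge_2: "n \<ge> 2" and r_ge_2: "r \<ge> 2"
    and join: "u \<in> V \<Longrightarrow> v \<in> V \<Longrightarrow> \<not> same_fibre u v \<Longrightarrow> (u, v) \<notin> E \<Longrightarrow> \<exists>w. (u, w) \<in> E \<and> (w, v) \<in> E"
begin

text \<open>A neighbour \<open>w\<close> of \<open>u\<close> in a second fibre is matched to
  \<open>u\<close>, hence not adjacent to \<open>v\<close>, so \<open>join\<close> continues it by
  two edges to \<open>v\<close>. A shorter walk is impossible: fibres are independent, and a common
  neighbour would have two neighbours in one fibre.\<close>

lemma fibremates_gdist:
  assumes "u \<in> V" "v \<in> V" "same_fibre u v" "u \<noteq> v"
  shows "gdist E u v = 3"
proof -
  obtain F where F: "F \<in> \<F>" "u \<in> F" "v \<in> F" using assms(3) by (auto simp: same_fibre_def)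
  have "\<not> \<F> \<subseteq> {F}" using card_fibres n_ge_2 card_mono[of "{F}" \<F>] by auto
  then obtain F' where F': "F' \<in> \<F>" "F \<noteq> F'" by blast
  obtain w where w: "w \<in> F'" "(u, w) \<in> E" using nbr[OF F(1) F' F(2)] by blast
  have "w \<in> V" using w F' fibre_subset by blast
  moreover have "\<not> same_fibre w v"
    unfolding same_fibre_def using w(1) F F' fibre_unique by metis
  moreover have "(w, v) \<notin> E"
    using nbr_unique[OF F(1-3), of w] assms(4) w(2) edge_commute[of w] by blast
  ultimately obtain x where "(w, x) \<in> E" "(x, v) \<in> E" using join assms(2) by blast
  then have "(u, v) \<in> E ^^ 3" using w(2) by (auto simp: numeral_3_eq_3)
  then have le: "gdist E u v \<le> enat 3" unfolding gdist_le_iff by blast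
  have "(u, v) \<notin> E" using same_fibre_no_edge assms(3) .
  moreover have "\<not> ((u, x) \<in> E \<and> (x, v) \<in> E)" for x
    using same_fibre_nbr[OF assms(3), of x] assms(4) edge_commute[of u x] by blast
  ultimately have "gdist E u v \<noteq> 0" "gdist E u v \<noteq> 1" "gdist E u v \<noteq> 2"
    using assms(4) by (auto simp: gdist_eq_0_iff gdist_eq_1_iff gdist_eq_2_iff)
  moreover obtain m where m: "gdist E u v = enat m" "m \<le> 3" using le by (cases "gdist E u v") auto
  ultimately have "m \<noteq> 0" "m \<noteq> 1" "m \<noteq> 2"
    by (simp_all add: numeral_eq_enat one_enat_def zero_enat_def)
  then have "m = 3" using m(2) by linarith
  then show ?thesis using m(1) by (simp add: numeral_eq_enat)
qed

lemma gdist_eq: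
  assumes "u \<in> V" "v \<in> V"
  shows "gdist E u v = (if u = v then 0 else if (u, v) \<in> E then 1 else if same_fibre u v then 3 else 2)"
proof -
  have "gdist E u v = 2" if "u \<noteq> v" "(u, v) \<notin> E" "\<not> same_fibre u v"
    unfolding gdist_eq_2_iff using that join[OF assms] by simp
  then show ?thesis using fibremates_gdist[OF assms] by (simp add: gdist_eq_0_iff gdist_eq_1_iff)
qed

lemma fibremates_ex: "\<exists>u\<in>V. \<exists>v\<in>V. u \<noteq> v \<and> same_fibre u v"
proof -
  have "\<F> \<noteq> {}" using card_fibres n_ge_2 by auto
  then obtain F where F: "F \<in> \<F>" by blast
  have "\<not> card F \<le> Suc 0" using card_fibre[OF F] r_ge_2 by simp
  then obtain u v where "u \<in> F" "v \<in> F" "u \<noteq> v"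
    using card_le_Suc0_iff_eq[OF finite_fibre[OF F]] by blast
  then show ?thesis using F fibre_subset by (auto simp: same_fibre_def)
qed

lemma diameter: "gdiameter V E = 3"
proof (rule antisym)
  show "gdiameter V E \<le> 3" unfolding gdiameter_def
    by (rule Sup_least) (auto simp: gdist_eq one_enat_def numeral_eq_enat)
  show "3 \<le> gdiameter V E"
  proof -
    obtain u v where uv: "u \<in> V" "v \<in> V" "gdist E u v = 3" using fibremates_ex fibremates_gdist by meson
    then show ?thesis unfolding gdiameter_def by (intro Sup_upper CollectI exI[of _ u] exI[of _ v]) simp
  qed
qed

lemma antipodal: "antipodal_cover n r V E \<F>"
proof -
  have "antipodal_with V E \<F>" unfolding antipodal_with_def connected_graph_def
  proof (intro conjI ballI impI)
    show "V \<noteq> {}" using fibremates_ex by (elim bexE) blast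
  next
    fix u v assume uv: "u \<in> V" "v \<in> V"
    then show "gdist E u v \<noteq> \<infinity>" by (simp add: gdist_eq one_enat_def zero_enat_def numeral_eq_enat)
    assume "u \<noteq> v"
    with uv show "gdist E u v = gdiameter V E \<longleftrightarrow> (\<exists>F\<in>\<F>. u \<in> F \<and> v \<in> F)"
      using same_fibre_no_edge by (auto simp: gdist_eq diameter one_enat_def numeral_eq_enat same_fibre_def)
  qed (fact partition)
  then show ?thesis using cover by (simp add: antipodal_cover_def)
qed

text \<open>The algebra spanned by the identity, the adjacency matrix, the fibre matrix and the all-ones
  matrix (the four values of the index below) contains every distance matrix.\<close>

definition basis_mat :: "nat \<Rightarrow> 'a \<Rightarrow> 'a \<Rightarrow> int" where
  "basis_mat s u v = of_bool (if s = 0 then u = v else if s = 1 then (u, v) \<in> E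
                              else if s = 2 then same_fibre u v else True)"

lemma basis_mat_sym: "basis_mat s u v = basis_mat s v u"
  using same_fibre_sym[of u v] same_fibre_sym[of v u] edge_commute[of u v]
  by (auto simp: basis_mat_def)

text \<open>With I, A, S, J for the four basis matrices, the distance matrices are I, A, J - A - S
  and S - I, because I is contained in S and A is disjoint from S. For any other \<open>d\<close>
  the matrix is zero.\<close>

lemma distance_mat_span:
  "\<exists>\<alpha>. \<forall>u\<in>V. \<forall>v\<in>V. (of_bool (gdist E u v = d) :: int) = (\<Sum>s<4. \<alpha> s * basis_mat s u v)"
proof -
  note facts = same_fibre_refl same_fibre_no_edge edge_commute
  let ?\<alpha> = "\<lambda>a b c e s::nat. if s = 0 then a else if s = 1 then b else if s = 2 then c else (e :: int)"
  consider "d = 0" | "d = 1" | "d = 2" | "d = 3" | "d \<notin> {0, 1, 2, 3}" by blast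
  then show ?thesis
  proof cases
    case 1 then show ?thesis using facts
      by (intro exI[of _ "?\<alpha> 1 0 0 0"]) (auto simp: gdist_eq_0_iff basis_mat_def eval_nat_numeral)
  next
    case 2 then show ?thesis using facts
      by (intro exI[of _ "?\<alpha> 0 1 0 0"]) (auto simp: gdist_eq_1_iff basis_mat_def eval_nat_numeral)
  next
    case 3 then show ?thesis using facts
      by (intro exI[of _ "?\<alpha> 0 (-1) (-1) 1"])
        (auto simp: gdist_eq basis_mat_def eval_nat_numeral numeral_eq_enat one_enat_def zero_enat_def)
  next
    case 4 then show ?thesis using facts
      by (intro exI[of _ "?\<alpha> (-1) 0 1 0"])
        (auto simp: gdist_eq basis_mat_def eval_nat_numeral numeral_eq_enat one_enat_def zero_enat_def)
  next
    case 5 then show ?thesis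
      by (intro exI[of _ "\<lambda>_. 0"]) (auto simp: gdist_eq)
  qed
qed

end

section \<open>Distance-regularity from two numbers of common neighbours\<close>

locale regular_joined_cover_graph = joined_cover_graph +
  fixes a c :: nat
  assumes common_edge: "u \<in> V \<Longrightarrow> v \<in> V \<Longrightarrow> (u, v) \<in> E \<Longrightarrow> card {w \<in> V. (u, w) \<in> E \<and> (v, w) \<in> E} = a"
    and common_nonedge: "u \<in> V \<Longrightarrow> v \<in> V \<Longrightarrow> \<not> same_fibre u v \<Longrightarrow> (u, v) \<notin> E \<Longrightarrow>
      card {w \<in> V. (u, w) \<in> E \<and> (v, w) \<in> E} = c"
begin

lemma sum_basis_mat_fibre:
  assumes "u \<in> V"
  shows "(\<Sum>w\<in>V. basis_mat 2 u w) = r"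
proof -
  obtain F where F: "F \<in> \<F>" "u \<in> F" using fibre_ex assms by blast
  have "same_fibre u w \<longleftrightarrow> w \<in> F" for w
    unfolding same_fibre_def using F fibre_unique by metis
  then have "{w \<in> V. same_fibre u w} = F" using fibre_subset[OF F(1)] by blast
  then show ?thesis using finite_V F card_fibre by (simp add: basis_mat_def Int_def)
qed

lemma sum_basis_mat_edge:
  assumes "u \<in> V" shows "(\<Sum>w\<in>V. basis_mat 1 u w) = int (n - 1)"
  using degree[OF assms] finite_V by (simp add: basis_mat_def Int_def)

text \<open>This is AS = J - S: \<open>u\<close> has one neighbour in each fibre but its
  own.\<close>

lemma sum_basis_mat_edge_fibre:
  assumes "u \<in> V" "v \<in> V"
  shows "(\<Sum>w\<in>V. basis_mat 1 u w * basis_mat 2 v w) = of_bool (\<not> same_fibre u v)"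
proof (cases "same_fibre u v")
  case True
  have "basis_mat 1 u w * basis_mat 2 v w = 0" for w
    using same_fibre_trans[OF True] same_fibre_no_edge by (auto simp: basis_mat_def)
  with True show ?thesis by (simp only: sum.neutral_const) simp
next
  case False
  then obtain x where x: "x \<in> V" "same_fibre v x" "(u, x) \<in> E" using nbr_ex assms by blast
  have "basis_mat 1 u w * basis_mat 2 v w = (if w = x then 1 else 0)" for w
    using x same_fibre_trans[OF same_fibre_sym[of v w] x(2)] same_fibre_nbr by (auto simp: basis_mat_def)
  with False x finite_V show ?thesis by simp
qed

text \<open>This is A^2 = (n-1)I + aA + c(J - A - S). Distinct fibremates contribute nothing, since
  a common neighbour would be matched to both.\<close>

lemma sum_basis_mat_common:
  assumes "u \<in> V" "v \<in> V"
  shows "(\<Sum>w\<in>V. basis_mat 1 u w * basis_mat 1 v w) =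
    (if u = v then int (n - 1) else if (u, v) \<in> E then a else if same_fibre u v then 0 else c)"
proof -
  have "(\<Sum>w\<in>V. basis_mat 1 u w * basis_mat 1 v w) = card {w \<in> V. (u, w) \<in> E \<and> (v, w) \<in> E}"
    using finite_V by (simp add: basis_mat_def Int_def flip: of_bool_conj)
  moreover have "card {w \<in> V. (u, w) \<in> E \<and> (v, w) \<in> E} = 0" if "same_fibre u v" "u \<noteq> v"
  proof -
    have "{w \<in> V. (u, w) \<in> E \<and> (v, w) \<in> E} = {}"
      using same_fibre_nbr[OF that(1)] that(2) edge_commute by blast
    then show ?thesis by (simp only: card.empty)
  qed
  ultimately show ?thesis
    using assms common_edge common_nonedge degree by (cases "u = v") auto
qed

lemma sum_basis_mat_fibre_fibre:
  assumes "u \<in> V" "v \<in> V"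
  shows "(\<Sum>w\<in>V. basis_mat 2 u w * basis_mat 2 v w) = (if same_fibre u v then int r else 0)"
proof -
  have "basis_mat 2 u w * basis_mat 2 v w = (if same_fibre u v then basis_mat 2 u w else 0)" for w
  proof -
    have "same_fibre u w \<and> same_fibre v w \<longleftrightarrow> same_fibre u v \<and> same_fibre u w"
      by (meson same_fibre_sym same_fibre_trans)
    then show ?thesis by (simp add: basis_mat_def flip: of_bool_conj)
  qed
  then show ?thesis using sum_basis_mat_fibre assms by simp
qed

text \<open>The basis matrices are symmetric, so the sum is an entry of a product. Besides products
  with I, the table consists of A^2, AS = J - S, AJ = (n-1)J, S^2 = rS, SJ = rJ and J^2 = |V|J; the
  products in the other order follow by exchanging \<open>u\<close> and \<open>v\<close>. Every
  entry is a function of the distance.\<close>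

lemma sum_basis_mat_product:
  assumes "s < 4" "t < 4"
  shows "\<exists>q. \<forall>u\<in>V. \<forall>v\<in>V. (\<Sum>w\<in>V. basis_mat s u w * basis_mat t v w) = q (gdist E u v)"
proof -
  define P where "P s t \<longleftrightarrow> (\<exists>q. \<forall>u\<in>V. \<forall>v\<in>V.
    (\<Sum>w\<in>V. basis_mat s u w * basis_mat t v w) = q (gdist E u v))" for s t
  have gd: "gdist E u v = gdist E v u" if "u \<in> V" "v \<in> V" for u v
    using that same_fibre_sym edge_commute by (auto simp: gdist_eq)
  have P_sym: "P t s" if "P s t" for s t
  proof -
    from that obtain q where q: "\<And>u v. u \<in> V \<Longrightarrow> v \<in> V \<Longrightarrow>
      (\<Sum>w\<in>V. basis_mat s u w * basis_mat t v w) = q (gdist E u v)"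
      by (auto simp: P_def)
    show ?thesis unfolding P_def
      by (rule exI[of _ q]) (use q gd in \<open>auto simp: mult.commute[of "basis_mat t _ _"]\<close>)
  qed
  have disj: "\<not> same_fibre u v" if "(u, v) \<in> E" for u v using that same_fibre_no_edge by blast
  note gs = gdist_eq numeral_eq_enat one_enat_def zero_enat_def
  have P0: "P 0 t" if "t < 4" for t unfolding P_def
  proof (intro exI ballI)
    fix u v assume uv: "u \<in> V" "v \<in> V"
    have "(\<Sum>w\<in>V. basis_mat 0 u w * basis_mat t v w) = (\<Sum>w\<in>V. if w = u then basis_mat t v w else 0)"
      by (rule sum.cong) (auto simp: basis_mat_def)
    also have "\<dots> = basis_mat t u v" using uv finite_V by (simp add: basis_mat_sym)
    also have "\<dots> = of_bool (if t = 0 then gdist E u v = 0 else if t = 1 then gdist E u v = 1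
      else if t = 2 then gdist E u v \<in> {0, 3} else True)"
      using uv disj same_fibre_refl by (auto simp: basis_mat_def gs)
    finally show "(\<Sum>w\<in>V. basis_mat 0 u w * basis_mat t v w) = \<dots>" .
  qed
  have P11: "P 1 1" unfolding P_def
    by (rule exI[of _ "\<lambda>d. if d = 0 then int (n - 1) else if d = 1 then a else if d = 3 then 0 else c"])
      (auto simp: sum_basis_mat_common[simplified One_nat_def] gs)
  have P12: "P 1 2" unfolding P_def
    by (rule exI[of _ "\<lambda>d. of_bool (d \<notin> {0, 3})"])
      (use disj same_fibre_refl in \<open>auto simp: sum_basis_mat_edge_fibre[simplified One_nat_def] gs\<close>)
  have P22: "P 2 2" unfolding P_def
    by (rule exI[of _ "\<lambda>d. if d \<in> {0, 3} then int r else 0"])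
      (use disj same_fibre_refl in \<open>auto simp: sum_basis_mat_fibre_fibre gs\<close>)
  have b3: "basis_mat 3 u w = 1" for u w by (simp add: basis_mat_def)
  have P13: "P 1 3" unfolding P_def
    by (rule exI[of _ "\<lambda>d. int (n - 1)"]) (simp add: b3 sum_basis_mat_edge[simplified One_nat_def])
  have P23: "P 2 3" unfolding P_def
    by (rule exI[of _ "\<lambda>d. int r"]) (simp add: b3 sum_basis_mat_fibre)
  have P33: "P 3 3" unfolding P_def
    by (rule exI[of _ "\<lambda>d. int (card V)"]) (simp add: b3)
  have "P s 0" using P_sym P0 assms(1) .
  then have "P s t" if "s \<in> {1, 2, 3}" "t \<in> {0, 1, 2, 3}"
    using that P11 P12 P13 P22 P23 P33 P_sym[OF P12] P_sym[OF P13] P_sym[OF P23] by blast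
  moreover have "s \<in> {0, 1, 2, 3}" "t \<in> {0, 1, 2, 3}" using assms by auto
  ultimately have "P s t" using P0[OF assms(2)] by blast
  then show ?thesis by (simp add: P_def)
qed

text \<open>The number to be determined is an entry of the product of two distance matrices.
  Expanding both in the basis reduces it to the multiplication table.\<close>

lemma distance_regular: "distance_regular V E"
proof -
  define Q where "Q s t q \<longleftrightarrow> (\<forall>u\<in>V. \<forall>v\<in>V.
    (\<Sum>w\<in>V. basis_mat s u w * basis_mat t v w) = q (gdist E u v))" for s t q
  define q where "q s t = (SOME q. Q s t q)" for s t
  have "Q s t (q s t)" if "s < 4" "t < 4" for s t
  proof -
    have "\<exists>q. Q s t q" using sum_basis_mat_product[OF that] by (simp only: Q_def)
    then show ?thesis unfolding q_def by (rule someI_ex)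
  qed
  then have q: "(\<Sum>w\<in>V. basis_mat s u w * basis_mat t v w) = q s t (gdist E u v)"
    if "s < 4" "t < 4" "u \<in> V" "v \<in> V" for s t u v
    using that by (simp add: Q_def)
  obtain \<alpha> where \<alpha>: "\<And>d u v. u \<in> V \<Longrightarrow> v \<in> V \<Longrightarrow>
    (of_bool (gdist E u v = d) :: int) = (\<Sum>s<4. \<alpha> d s * basis_mat s u v)"
  proof -
    have "\<forall>d. \<exists>\<alpha>. \<forall>u\<in>V. \<forall>v\<in>V. (of_bool (gdist E u v = d) :: int) = (\<Sum>s<4. \<alpha> s * basis_mat s u v)"
      by (intro allI distance_mat_span)
    then have "\<exists>\<alpha>. \<forall>d. \<forall>u\<in>V. \<forall>v\<in>V. (of_bool (gdist E u v = d) :: int) = (\<Sum>s<4. \<alpha> d s * basis_mat s u v)"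
      by (rule choice)
    then show ?thesis using that by blast
  qed
  \<comment> \<open>The expansion lives in the integers because some of the coefficients are
    negative.\<close>
  have count: "int (card {w \<in> V. gdist E u w = i \<and> gdist E v w = j}) =
    (\<Sum>s<4. \<Sum>t<4. \<alpha> i s * \<alpha> j t * q s t (gdist E u v))" if uv: "u \<in> V" "v \<in> V" for u v i j
  proof -
    have "int (card {w \<in> V. gdist E u w = i \<and> gdist E v w = j}) =
      (\<Sum>w\<in>V. of_bool (gdist E u w = i) * of_bool (gdist E v w = j))"
      using finite_V by (simp add: Int_def flip: of_bool_conj)
    also have "\<dots> = (\<Sum>w\<in>V. \<Sum>s<4. \<Sum>t<4. \<alpha> i s * \<alpha> j t * (basis_mat s u w * basis_mat t v w))"
      using uv by (intro sum.cong) (simp_all add: \<alpha> sum_product algebra_simps)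
    also have "\<dots> = (\<Sum>s<4. \<Sum>t<4. \<alpha> i s * \<alpha> j t * (\<Sum>w\<in>V. basis_mat s u w * basis_mat t v w))"
      unfolding sum_distrib_left by (subst sum.swap, rule sum.cong[OF refl], rule sum.swap)
    also have "\<dots> = (\<Sum>s<4. \<Sum>t<4. \<alpha> i s * \<alpha> j t * q s t (gdist E u v))"
      using uv by (intro sum.cong) (simp_all add: q)
    finally show ?thesis .
  qed
  then have "card {w \<in> V. gdist E u w = i \<and> gdist E v w = j} =
    nat (\<Sum>s<4. \<Sum>t<4. \<alpha> i s * \<alpha> j t * q s t (gdist E u v))" if "u \<in> V" "v \<in> V" for u v i j
    using arg_cong[OF count[OF that, of i j], of nat] by (simp only: nat_int)
  then show ?thesis unfolding distance_regular_def
    by (intro exI[of _ "\<lambda>i j d. nat (\<Sum>s<4. \<Sum>t<4. \<alpha> i s * \<alpha> j t * q s t d)"]) simp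
qed

lemma drackn: "drackn n r c V E \<F>"
  unfolding drackn_def
proof (intro conjI ballI impI antipodal distance_regular)
  fix u v assume uv: "u \<in> V" "v \<in> V" "gdist E u v = 2"
  then obtain w where w: "u \<noteq> v" "(u, v) \<notin> E" "(w, u) \<in> E" "(w, v) \<in> E"
    using edge_commute[of u] unfolding gdist_eq_2_iff by blast
  \<comment> \<open>The common neighbour \<open>w\<close> has at most one neighbour in each fibre,
    so distance 2 only occurs between distinct fibres.\<close>
  then have "\<not> same_fibre u v" using same_fibre_nbr[of u v w] by blast
  then show "card {w \<in> V. (u, w) \<in> E \<and> (v, w) \<in> E} = c"
    using common_nonedge[OF uv(1,2)] w(2) by blast
qed

end

section \<open>Gain matrices\<close>

lemma (in group) group_algebra_mult_ga_of:
  assumes "finite (carrier G)" "x \<in> carrier G"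
  shows "ga_of x \<otimes>\<^bsub>group_algebra G\<^esub> f = (\<lambda>g. if g \<in> carrier G then f (inv x \<otimes> g) else 0)"
proof -
  have "(\<Sum>h\<in>carrier G. ga_of x h * f (inv h \<otimes> g)) = f (inv x \<otimes> g)" for g
  proof -
    have "(\<Sum>h\<in>carrier G. ga_of x h * f (inv h \<otimes> g)) =
      (\<Sum>h\<in>carrier G. if h = x then f (inv h \<otimes> g) else 0)"
      by (rule sum.cong) (auto simp: ga_of_def)
    then show ?thesis using assms by simp
  qed
  then show ?thesis by (simp only: group_algebra_def monoid.simps)
qed

lemma (in group) ga_of_mult:
  assumes "finite (carrier G)" "x \<in> carrier G" "y \<in> carrier G"
  shows "ga_of x \<otimes>\<^bsub>group_algebra G\<^esub> ga_of y = ga_of (x \<otimes> y)"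
proof (rule ext)
  fix g
  have "g \<in> carrier G \<Longrightarrow> inv x \<otimes> g = y \<longleftrightarrow> g = x \<otimes> y"
    using assms inv_solve_left'[of y x g] by auto
  then show "(ga_of x \<otimes>\<^bsub>group_algebra G\<^esub> ga_of y) g = ga_of (x \<otimes> y) g"
    using assms by (subst group_algebra_mult_ga_of) (auto simp: ga_of_def)
qed

lemma ga_of_apply: "ga_of x g = of_bool (g = x)"
  by (simp add: ga_of_def)

lemma ga_of_eq_iff: "ga_of x = ga_of y \<longleftrightarrow> x = y"
  by (auto simp: ga_of_def fun_eq_iff)

lemma ga_of_closed: "x \<in> carrier \<Gamma> \<Longrightarrow> ga_of x \<in> carrier (group_algebra \<Gamma>)"
  by (auto simp: ga_of_def group_algebra_def)

lemma zero_group_algebra: "\<zero>\<^bsub>group_algebra \<Gamma>\<^esub> = (\<lambda>_. 0)"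
  by (simp add: group_algebra_def)

lemma add_group_algebra: "x \<oplus>\<^bsub>group_algebra \<Gamma>\<^esub> y = (\<lambda>g. x g + y g)"
  by (simp add: group_algebra_def)

lemma one_group_algebra: "\<one>\<^bsub>group_algebra \<Gamma>\<^esub> = ga_of \<one>\<^bsub>\<Gamma>\<^esub>"
  by (simp add: group_algebra_def ga_of_def)

lemma (in comm_group) inv_ga_of:
  assumes fin: "finite (carrier G)" and x: "x \<in> carrier G"
  shows "inv\<^bsub>group_algebra G\<^esub> (ga_of x) = ga_of (inv x)"
proof -
  interpret R: cring "group_algebra G" by (rule group_algebra_cring[OF comm_group_axioms fin])
  show ?thesis
    by (rule R.comm_inv_char) (use x in \<open>simp_all add: ga_of_closed ga_of_mult fin one_group_algebra\<close>)
qed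

text \<open>The matrix product is defined by pointwise sums of coefficients; this turns them into
  sums of the ring, so that ring arithmetic applies.\<close>

lemma (in comm_group) finsum_group_algebra:
  assumes fin: "finite (carrier G)" and "finite A" "f \<in> A \<rightarrow> carrier (group_algebra G)"
  shows "finsum (group_algebra G) f A = (\<lambda>g. \<Sum>k\<in>A. f k g)"
proof -
  interpret R: cring "group_algebra G" by (rule group_algebra_cring[OF comm_group_axioms fin])
  show ?thesis using assms(2,3)
    by (induction A rule: finite_induct) (simp_all add: zero_group_algebra add_group_algebra)
qed

lemma group_algebra_mult_zero:
  "(\<lambda>_. 0) \<otimes>\<^bsub>group_algebra \<Gamma>\<^esub> x = (\<lambda>_. 0)" "x \<otimes>\<^bsub>group_algebra \<Gamma>\<^esub> (\<lambda>_. 0) = (\<lambda>_. 0)"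
  by (auto simp: group_algebra_def fun_eq_iff)

lemma cayley_ga_of:
  assumes "finite (carrier \<Gamma>)" "x \<in> carrier \<Gamma>"
  shows "cayley \<Gamma> (ga_of x) g h = of_bool (x \<otimes>\<^bsub>\<Gamma>\<^esub> h = g)"
proof -
  have "cayley \<Gamma> (ga_of x) g h = (\<Sum>y\<in>carrier \<Gamma>. if y = x then of_bool (y \<otimes>\<^bsub>\<Gamma>\<^esub> h = g) else 0)"
    unfolding cayley_def by (rule sum.cong) (auto simp: ga_of_def)
  then show ?thesis using assms by simp
qed

text \<open>Here \<open>a\<close> is arbitrary: the lift of a matrix determines every coefficient of
  its entries, which allows (R1)--(R3) to be read off a graph.\<close>

lemma (in group) cayley_eq:
  assumes "finite (carrier G)" "g \<in> carrier G" "h \<in> carrier G"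
  shows "cayley G a g h = a (g \<otimes> inv h)"
proof -
  have "cayley G a g h = (\<Sum>x\<in>carrier G. if x = g \<otimes> inv h then a x else 0)"
    unfolding cayley_def
    by (rule sum.cong) (use assms inv_solve_right in \<open>auto simp: of_bool_def\<close>)
  then show ?thesis using assms by simp
qed

definition gain_mat :: "nat \<Rightarrow> (nat \<Rightarrow> nat \<Rightarrow> 'g) \<Rightarrow> 'g ga_mat" where
  "gain_mat n b = (\<lambda>i j. if i \<in> {1..n} \<and> j \<in> {1..n} \<and> i \<noteq> j then ga_of (b i j) else (\<lambda>_. 0))"

lemma gain_mat_off_diagonal: "i \<in> {1..n} \<Longrightarrow> j \<in> {1..n} \<Longrightarrow> i \<noteq> j \<Longrightarrow> gain_mat n b i j = ga_of (b i j)"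
  by (simp add: gain_mat_def)

lemma gain_mat_zero: "\<not> (i \<in> {1..n} \<and> j \<in> {1..n} \<and> i \<noteq> j) \<Longrightarrow> gain_mat n b i j = (\<lambda>_. 0)"
  unfolding gain_mat_def by (rule if_not_P)

section \<open>Gains, the roux graph and common neighbours\<close>

locale gain_matrix = comm_group \<Gamma> for \<Gamma> :: "('g, 'm) monoid_scheme" (structure) +
  fixes n :: nat and b :: "nat \<Rightarrow> nat \<Rightarrow> 'g"
  assumes finite_carrier: "finite (carrier \<Gamma>)"
    and gain_closed [simp]: "i \<in> {1..n} \<Longrightarrow> j \<in> {1..n} \<Longrightarrow> b i j \<in> carrier \<Gamma>"
    and gain_diag: "i \<in> {1..n} \<Longrightarrow> b i i = \<one>"
    and gain_inv: "i \<in> {1..n} \<Longrightarrow> j \<in> {1..n} \<Longrightarrow> b j i = inv (b i j)"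

text \<open>Off the diagonal the gain is unique because group elements embed injectively in the
  group algebra, and inverses in the group algebra of embedded elements are embedded
  inverses.\<close>

lemma (in comm_group) roux_conditions_imp_gain_matrix:
  assumes fin: "finite (carrier G)" and B: "B \<in> ga_mats G n"
    and R: "roux_R1 G n B" "roux_R2 G n B" "roux_R3 G n B"
  shows "\<exists>b. gain_matrix G n b \<and> B = gain_mat n b"
proof -
  define b where "b i j = (if i = j then \<one> else THE g. B i j = ga_of g)" for i j
  have b: "b i j \<in> carrier G \<and> B i j = ga_of (b i j)" if "i \<in> {1..n}" "j \<in> {1..n}" "i \<noteq> j" for i j
  proof -
    have "B i j \<in> ga_of ` carrier G" using R(2) that by (simp add: roux_R2_def)
    then obtain g where "g \<in> carrier G" "B i j = ga_of g" by blast
    then show ?thesis using that(3) by (simp add: b_def ga_of_eq_iff)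
  qed
  have "gain_matrix G n b"
  proof unfold_locales
    fix i j assume ij: "i \<in> {1..n}" "j \<in> {1..n}"
    show "b i j \<in> carrier G" using b[OF ij] by (cases "i = j") (simp_all add: b_def)
    show "b j i = inv (b i j)"
    proof (cases "i = j")
      case False
      then have "B j i = inv\<^bsub>group_algebra G\<^esub> (B i j)"
        using R(3)[unfolded roux_R3_def, rule_format, OF ij] by simp
      then have "ga_of (b j i) = inv\<^bsub>group_algebra G\<^esub> (ga_of (b i j))"
        using b[OF ij False] b[OF ij(2,1)] False by simp
      then show ?thesis using b[OF ij False] fin by (simp add: inv_ga_of ga_of_eq_iff)
    qed (simp add: b_def)
  qed (use fin in \<open>simp_all add: b_def\<close>)
  moreover have "B = gain_mat n b"
  proof (intro ext)
    fix i j g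
    have "B i j = (\<lambda>_. 0)" if "\<not> (i \<in> {1..n} \<and> j \<in> {1..n})"
      using B that by (simp add: ga_mats_def zero_group_algebra)
    moreover have "B i j = (\<lambda>_. 0)" if "i \<in> {1..n}" "i = j"
      using R(1) that by (simp add: roux_R1_def zero_group_algebra)
    ultimately have "B i j = gain_mat n b i j" if "\<not> (i \<in> {1..n} \<and> j \<in> {1..n} \<and> i \<noteq> j)"
      unfolding gain_mat_zero[OF that] using that by blast
    moreover have "B i j = gain_mat n b i j" if "i \<in> {1..n} \<and> j \<in> {1..n} \<and> i \<noteq> j"
      using b[of i j] gain_mat_off_diagonal[of i n j b] that by simp
    ultimately show "B i j g = gain_mat n b i j g" by metis
  qed
  ultimately show ?thesis by blast
qed

context gain_matrix
begin

abbreviation "B \<equiv> gain_mat n b"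
abbreviation "verts \<equiv> roux_verts \<Gamma> n"
abbreviation "edges \<equiv> roux_edges \<Gamma> n B"
abbreviation "fibres \<equiv> roux_fibres \<Gamma> n"

lemma roux_conditions:
  "B \<in> ga_mats \<Gamma> n" "roux_R1 \<Gamma> n B" "roux_R2 \<Gamma> n B" "roux_R3 \<Gamma> n B"
proof -
  have "(\<lambda>_. 0) \<in> carrier (group_algebra \<Gamma>)" by (simp add: group_algebra_def)
  then show "B \<in> ga_mats \<Gamma> n" by (auto simp: ga_mats_def gain_mat_def zero_group_algebra ga_of_closed)
  show "roux_R1 \<Gamma> n B" "roux_R2 \<Gamma> n B"
    by (simp_all add: roux_R1_def roux_R2_def gain_mat_zero gain_mat_off_diagonal zero_group_algebra)
  show "roux_R3 \<Gamma> n B" unfolding roux_R3_def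
  proof (intro ballI impI)
    fix i j assume "i \<in> {1..n}" "j \<in> {1..n}" "i \<noteq> j"
    then show "B j i = inv\<^bsub>group_algebra \<Gamma>\<^esub> (B i j)"
      by (simp add: gain_mat_off_diagonal inv_ga_of finite_carrier gain_inv[of i j])
  qed
qed

lemma gain_cancel:
  assumes "i \<in> {1..n}" "j \<in> {1..n}" "x \<in> carrier \<Gamma>"
  shows "b i j \<otimes> (b j i \<otimes> x) = x"
  using assms gain_inv[of i j] by (simp flip: m_assoc)

lemma roux_lift_gain:
  "roux_lift \<Gamma> B (i, g) (j, h) = of_bool (i \<in> {1..n} \<and> j \<in> {1..n} \<and> i \<noteq> j \<and> g = b i j \<otimes> h)"
proof (cases "i \<in> {1..n} \<and> j \<in> {1..n} \<and> i \<noteq> j")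
  case True
  then show ?thesis
    by (auto simp: roux_lift_def gain_mat_off_diagonal cayley_ga_of finite_carrier)
next
  case False
  then show ?thesis unfolding roux_lift_def case_prod_conv gain_mat_zero[OF False]
    by (simp only: cayley_def) simp
qed

lemma edge_iff:
  "((i, g), (j, h)) \<in> edges \<longleftrightarrow> i \<in> {1..n} \<and> j \<in> {1..n} \<and> i \<noteq> j \<and>
     g \<in> carrier \<Gamma> \<and> h \<in> carrier \<Gamma> \<and> g = b i j \<otimes> h"
  by (auto simp: roux_edges_def roux_lift_gain roux_verts_def)

lemma edges_sym: "(u, v) \<in> edges \<Longrightarrow> (v, u) \<in> edges"
  by (cases u; cases v) (auto simp: edge_iff gain_cancel)

lemma adjacency: "is_adjacency_matrix verts edges (roux_lift \<Gamma> B)"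
  by (auto simp: is_adjacency_matrix_def roux_lift_gain edge_iff roux_verts_def)

lemma cover: "complete_cover n (order \<Gamma>) verts edges fibres"
proof -
  have ne: "carrier \<Gamma> \<noteq> {}" using one_closed by blast
  have "simple_graph verts edges"
    unfolding simple_graph_def
    using finite_carrier edges_sym
    by (auto simp: roux_verts_def sym_def irrefl_def edge_iff)
  moreover have "partition_on verts fibres"
    using ne by (auto simp: partition_on_def roux_verts_def roux_fibres_def disjoint_def)
  moreover have "card fibres = n"
  proof -
    have "inj_on (\<lambda>i. {i} \<times> carrier \<Gamma>) {1..n}" using ne by (auto intro!: inj_onI)
    then show ?thesis unfolding roux_fibres_def by (simp add: card_image)
  qed
  moreover have "card F = order \<Gamma>" if "F \<in> fibres" for F
    using that by (auto simp: roux_fibres_def order_def card_cartesian_product_singleton)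
  moreover have "(u, v) \<notin> edges" if "F \<in> fibres" "u \<in> F" "v \<in> F" for F u v
    using that by (auto simp: roux_fibres_def edge_iff)
  moreover have "\<exists>!v. v \<in> F \<union> F' \<and> (u, v) \<in> edges"
    if F: "F \<in> fibres" "F' \<in> fibres" "F \<noteq> F'" and u: "u \<in> F \<union> F'" for F F' u
  proof -
    \<comment> \<open>By symmetry \<open>i\<close> may denote the fibre containing \<open>u\<close>
      and \<open>j\<close> the other one.\<close>
    obtain i j where ij: "i \<in> {1..n}" "j \<in> {1..n}" "i \<noteq> j" "F \<union> F' = {i, j} \<times> carrier \<Gamma>" "fst u = i"
    proof -
      obtain i j where ij: "i \<in> {1..n}" "j \<in> {1..n}" "F = {i} \<times> carrier \<Gamma>" "F' = {j} \<times> carrier \<Gamma>"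
        using F(1,2) unfolding roux_fibres_def by blast
      then have "i \<noteq> j" "F \<union> F' = {i, j} \<times> carrier \<Gamma>" "F \<union> F' = {j, i} \<times> carrier \<Gamma>"
        "fst u = i \<or> fst u = j"
        using F(3) u by auto
      then show ?thesis using that[of i j] that[of j i] ij by metis
    qed
    then obtain g where g: "g \<in> carrier \<Gamma>" "u = (i, g)" using u by (metis SigmaE fst_conv)
    show ?thesis unfolding ij(4) g(2)
    proof (rule ex1I[of _ "(j, b j i \<otimes> g)"])
      show "(j, b j i \<otimes> g) \<in> {i, j} \<times> carrier \<Gamma> \<and> ((i, g), j, b j i \<otimes> g) \<in> edges"
        using ij g by (simp add: edge_iff gain_cancel)
      fix v assume "v \<in> {i, j} \<times> carrier \<Gamma> \<and> ((i, g), v) \<in> edges"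
      then show "v = (j, b j i \<otimes> g)" using ij by (cases v) (auto simp: edge_iff gain_cancel)
    qed
  qed
  ultimately show ?thesis unfolding complete_cover_def by (intro conjI ballI impI)
qed

sublocale cover: complete_cover_graph n "order \<Gamma>" verts edges fibres
  by unfold_locales (rule cover)

lemma same_fibre_iff: "cover.same_fibre (i, g) (j, h) \<longleftrightarrow> i \<in> {1..n} \<and> i = j \<and> g \<in> carrier \<Gamma> \<and> h \<in> carrier \<Gamma>"
  unfolding cover.same_fibre_def by (auto simp: roux_fibres_def)

text \<open>The end points are removed because B vanishes on the diagonal whereas the gains there
  are \<one>.\<close>

definition paths :: "nat \<Rightarrow> nat \<Rightarrow> 'g \<Rightarrow> nat set" where
  "paths i j x = {k \<in> {1..n} - {i, j}. b i k \<otimes> b k j = x}"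

text \<open>In fibre \<open>k\<close> the only neighbour of \<open>(i, g)\<close> is
  \<open>(k, b k i \<otimes> g)\<close> and that of \<open>(j, h)\<close> is
  \<open>(k, b k j \<otimes> h)\<close>. They coincide exactly when the path through
  \<open>k\<close> has gain \<open>g \<otimes> inv h\<close>, so each such \<open>k\<close> accounts
  for one common neighbour.\<close>

lemma common_nbrs:
  assumes "(i, g) \<in> verts" "(j, h) \<in> verts"
  shows "card {w \<in> verts. ((i, g), w) \<in> edges \<and> ((j, h), w) \<in> edges} = card (paths i j (g \<otimes> inv h))"
proof -
  have ij: "i \<in> {1..n}" "j \<in> {1..n}" "g \<in> carrier \<Gamma>" "h \<in> carrier \<Gamma>"
    using assms by (auto simp: roux_verts_def)
  have eq: "b i k \<otimes> b k j = g \<otimes> inv h \<longleftrightarrow> b k i \<otimes> g = b k j \<otimes> h" if k: "k \<in> {1..n}" for k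
  proof -
    have "b i k \<otimes> b k j = g \<otimes> inv h \<longleftrightarrow> g = b i k \<otimes> b k j \<otimes> h"
      using ij k inv_solve_right[of "b i k \<otimes> b k j" g h] by simp
    also have "b i k \<otimes> b k j \<otimes> h = inv (b k i) \<otimes> (b k j \<otimes> h)"
      using ij k gain_inv[of k i] by (simp add: m_assoc)
    also have "g = \<dots> \<longleftrightarrow> b k i \<otimes> g = b k j \<otimes> h"
      using ij k inv_solve_left[of g "b k i" "b k j \<otimes> h"] by auto
    finally show ?thesis .
  qed
  have nbr: "((i, g), (k, m)) \<in> edges \<longleftrightarrow> k \<in> {1..n} \<and> k \<noteq> i \<and> m = b k i \<otimes> g"
    if "i \<in> {1..n}" "g \<in> carrier \<Gamma>" for i g k m
    using that by (auto simp: edge_iff gain_cancel)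
  have "bij_betw (\<lambda>k. (k, b k i \<otimes> g)) (paths i j (g \<otimes> inv h))
    {w \<in> verts. ((i, g), w) \<in> edges \<and> ((j, h), w) \<in> edges}"
    by (rule bij_betw_byWitness[where f' = fst])
      (use ij in \<open>auto simp: paths_def nbr roux_verts_def eq\<close>)
  then show ?thesis by (rule bij_betw_same_card[symmetric])
qed

lemma gain_mat_square:
  assumes "i \<in> {1..n}" "j \<in> {1..n}"
  shows "ga_mat_mult \<Gamma> n B B i j x = of_nat (card (paths i j x))"
proof -
  have "(B i k \<otimes>\<^bsub>group_algebra \<Gamma>\<^esub> B k j) x = (if k \<in> paths i j x then 1 else 0)" if k: "k \<in> {1..n}" for k
  proof (cases "k = i \<or> k = j")
    case True
    then have "B i k = (\<lambda>_. 0) \<or> B k j = (\<lambda>_. 0)" "k \<notin> paths i j x"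
      using gain_mat_zero[of i n k b] gain_mat_zero[of k n j b] by (auto simp: paths_def)
    then show ?thesis by (auto simp: group_algebra_mult_zero)
  next
    case False
    then show ?thesis using assms k finite_carrier
      by (auto simp: gain_mat_off_diagonal paths_def ga_of_mult ga_of_apply)
  qed
  then have "ga_mat_mult \<Gamma> n B B i j x = (\<Sum>k\<in>{1..n}. if k \<in> paths i j x then 1 else 0)"
    unfolding ga_mat_mult_def by (intro sum.cong) simp_all
  also have "\<dots> = of_nat (card ({1..n} \<inter> paths i j x))" by (simp flip: sum.inter_restrict)
  also have "{1..n} \<inter> paths i j x = paths i j x" by (auto simp: paths_def)
  finally show ?thesis .
qed

lemma gain_mat_square_outside:
  assumes "i \<notin> {1..n} \<or> j \<notin> {1..n}"
  shows "ga_mat_mult \<Gamma> n B B i j x = 0"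
proof -
  have "(B i k \<otimes>\<^bsub>group_algebra \<Gamma>\<^esub> B k j) x = 0" for k
  proof -
    have "B i k = (\<lambda>_. 0) \<or> B k j = (\<lambda>_. 0)"
      using assms gain_mat_zero[of i n k b] gain_mat_zero[of k n j b] by blast
    then show ?thesis by (elim disjE) (simp_all add: group_algebra_mult_zero)
  qed
  then show ?thesis by (simp add: ga_mat_mult_def)
qed

lemma card_paths_diag:
  assumes "i \<in> {1..n}"
  shows "card (paths i i x) = (if x = \<one> then n - 1 else 0)"
proof -
  have "b i k \<otimes> b k i = \<one>" if "k \<in> {1..n}" for k
    using gain_inv[OF assms that] gain_closed[OF assms that] by simp
  then have "paths i i x = (if x = \<one> then {1..n} - {i} else {})"
    by (auto simp: paths_def)
  then show ?thesis using assms by simp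
qed

lemma sum_scale_gain_mat:
  assumes "i \<in> {1..n}" "j \<in> {1..n}" "i \<noteq> j"
  shows "(\<Sum>g\<in>carrier \<Gamma>. c g * ga_mat_scale \<Gamma> g B i j x) = (if x \<in> carrier \<Gamma> then c (x \<otimes> b j i) else 0)"
proof -
  have "c g * ga_mat_scale \<Gamma> g B i j x = (if g = x \<otimes> b j i \<and> x \<in> carrier \<Gamma> then c g else 0)"
    if "g \<in> carrier \<Gamma>" for g
    using assms that inv_solve_right[of g x "b i j"]
    by (auto simp: ga_mat_scale_def gain_mat_off_diagonal ga_of_mult finite_carrier gain_inv[of i j] ga_of_apply)
  then have "(\<Sum>g\<in>carrier \<Gamma>. c g * ga_mat_scale \<Gamma> g B i j x) =
    (\<Sum>g\<in>carrier \<Gamma>. if g = x \<otimes> b j i \<and> x \<in> carrier \<Gamma> then c g else 0)" by (intro sum.cong) simp_all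
  then show ?thesis using assms finite_carrier by simp
qed

lemma scale_gain_mat_zero:
  assumes "\<not> (i \<in> {1..n} \<and> j \<in> {1..n} \<and> i \<noteq> j)"
  shows "ga_mat_scale \<Gamma> g B i j x = 0"
  unfolding ga_mat_scale_def gain_mat_zero[OF assms] group_algebra_mult_zero ..

text \<open>On the diagonal and outside the index range both sides of the equation agree for every
  \<open>c\<close>. At an off-diagonal entry the coefficient of \<open>x\<close> on the right is
  \<open>c (x \<otimes> b j i)\<close>, and replacing \<open>x\<close> by
  \<open>x \<otimes> b i j\<close> isolates \<open>c\<close>.\<close>

lemma roux_params_iff:
  "roux_params \<Gamma> n B c \<longleftrightarrow>
    (\<forall>i\<in>{1..n}. \<forall>j\<in>{1..n}. i \<noteq> j \<longrightarrow> (\<forall>x\<in>carrier \<Gamma>. c x = of_nat (card (paths i j (x \<otimes> b i j)))))"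
proof -
  let ?rhs = "\<lambda>i j x. (of_nat n - 1) * ga_mat_one \<Gamma> n i j x +
    (\<Sum>g\<in>carrier \<Gamma>. c g * ga_mat_scale \<Gamma> g B i j x)"
  have outside: "ga_mat_mult \<Gamma> n B B i j x = ?rhs i j x" if "\<not> (i \<in> {1..n} \<and> j \<in> {1..n} \<and> i \<noteq> j)" for i j x
  proof (cases "i \<in> {1..n} \<and> i = j")
    case True
    \<comment> \<open>Truncated subtraction is harmless since \<open>i\<close> witnesses that n is
      positive.\<close>
    then have "of_nat (n - 1) = (of_nat n - 1 :: complex)" by (auto simp: of_nat_diff)
    then show ?thesis using True that
      by (simp add: gain_mat_square card_paths_diag scale_gain_mat_zero ga_mat_one_def one_group_algebra ga_of_apply)
  next
    case False
    then show ?thesis using that gain_mat_square_outside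
      by (auto simp: scale_gain_mat_zero ga_mat_one_def zero_group_algebra)
  qed
  have inside: "(\<forall>x. ga_mat_mult \<Gamma> n B B i j x = ?rhs i j x) \<longleftrightarrow>
      (\<forall>x\<in>carrier \<Gamma>. c x = of_nat (card (paths i j (x \<otimes> b i j))))"
    if ij: "i \<in> {1..n}" "j \<in> {1..n}" "i \<noteq> j" for i j
  proof -
    have rhs: "?rhs i j x = (if x \<in> carrier \<Gamma> then c (x \<otimes> b j i) else 0)" for x
      using ij by (simp add: sum_scale_gain_mat ga_mat_one_def zero_group_algebra)
    have out: "card (paths i j x) = 0" if "x \<notin> carrier \<Gamma>" for x
      using that ij by (auto simp: paths_def)
    have c1: "x \<otimes> b i j \<otimes> b j i = x" "x \<otimes> b j i \<otimes> b i j = x" if "x \<in> carrier \<Gamma>" for x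
      using that ij gain_inv[of i j] by (simp_all add: m_assoc)
    have "(\<forall>x. ga_mat_mult \<Gamma> n B B i j x = ?rhs i j x) \<longleftrightarrow>
      (\<forall>x\<in>carrier \<Gamma>. of_nat (card (paths i j x)) = c (x \<otimes> b j i))"
      unfolding rhs using ij out by (auto simp: gain_mat_square)
    also have "\<dots> \<longleftrightarrow> (\<forall>x\<in>carrier \<Gamma>. c x = of_nat (card (paths i j (x \<otimes> b i j))))"
    proof (intro iffI ballI)
      fix x assume "\<forall>x\<in>carrier \<Gamma>. of_nat (card (paths i j x)) = c (x \<otimes> b j i)" "x \<in> carrier \<Gamma>"
      then show "c x = of_nat (card (paths i j (x \<otimes> b i j)))" using c1(1)[of x] ij by simp
    next
      fix x assume *: "\<forall>x\<in>carrier \<Gamma>. c x = of_nat (card (paths i j (x \<otimes> b i j)))" "x \<in> carrier \<Gamma>"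
      then have "x \<otimes> b j i \<in> carrier \<Gamma>" using ij by simp
      then show "of_nat (card (paths i j x)) = c (x \<otimes> b j i)" using * c1(2)[of x] by simp
    qed
    finally show ?thesis .
  qed
  have "roux_params \<Gamma> n B c \<longleftrightarrow> (\<forall>i j x. ga_mat_mult \<Gamma> n B B i j x = ?rhs i j x)"
    by (simp add: roux_params_def fun_eq_iff)
  also have "\<dots> \<longleftrightarrow> (\<forall>i\<in>{1..n}. \<forall>j\<in>{1..n}. i \<noteq> j \<longrightarrow> (\<forall>x. ga_mat_mult \<Gamma> n B B i j x = ?rhs i j x))"
    using outside by meson
  also have "\<dots> \<longleftrightarrow> (\<forall>i\<in>{1..n}. \<forall>j\<in>{1..n}. i \<noteq> j \<longrightarrow>
      (\<forall>x\<in>carrier \<Gamma>. c x = of_nat (card (paths i j (x \<otimes> b i j)))))"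
    by (intro ball_cong imp_cong refl inside)
  finally show ?thesis .
qed

end

section \<open>The span of a gain matrix\<close>

lemma (in cring) finsum_delta_left:
  assumes "finite I" "i \<in> I" "f \<in> I \<rightarrow> carrier R"
  shows "(\<Oplus>k\<in>I. (if i = k then \<one> else \<zero>) \<otimes> f k) = f i"
proof -
  have "(\<Oplus>k\<in>I. (if i = k then \<one> else \<zero>) \<otimes> f k) = (\<Oplus>k\<in>I. if i = k then f k else \<zero>)"
    by (rule finsum_cong') (use assms(3) in \<open>auto simp: Pi_def\<close>)
  then show ?thesis using finsum_singleton[OF assms(2,1,3)] by simp
qed

text \<open>The identity (aI + bB)(a'I + b'B) = (aa' + bb'm)I + (ab' + ba' + bb'c)B for B^2 = mI +
  cB over a commutative ring, at a single entry.\<close>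

lemma (in cring) finsum_linear_product:
  assumes I: "finite I" "i \<in> I" "j \<in> I"
    and B: "\<And>i j. B i j \<in> carrier R"
    and square: "(\<Oplus>k\<in>I. B i k \<otimes> B k j) = m \<otimes> (if i = j then \<one> else \<zero>) \<oplus> c \<otimes> B i j"
    and coeffs: "m \<in> carrier R" "c \<in> carrier R" "a \<in> carrier R" "b \<in> carrier R" "a' \<in> carrier R" "b' \<in> carrier R"
  shows "(\<Oplus>k\<in>I. (a \<otimes> (if i = k then \<one> else \<zero>) \<oplus> b \<otimes> B i k) \<otimes>
      (a' \<otimes> (if k = j then \<one> else \<zero>) \<oplus> b' \<otimes> B k j)) =
    (a \<otimes> a' \<oplus> b \<otimes> b' \<otimes> m) \<otimes> (if i = j then \<one> else \<zero>) \<oplus> (a \<otimes> b' \<oplus> b \<otimes> a' \<oplus> b \<otimes> b' \<otimes> c) \<otimes> B i j"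
proof -
  define d where "d i j = (if i = j then \<one> else \<zero>)" for i j :: 'c
  have d: "d i j \<in> carrier R" "d i j = d j i" for i j by (auto simp: d_def)
  have delta: "(\<Oplus>k\<in>I. d i k \<otimes> f k) = f i" if "i \<in> I" "f \<in> I \<rightarrow> carrier R" for i f
    using finsum_delta_left[OF I(1) that] by (simp add: d_def)
  \<comment> \<open>In the third term the Kronecker delta is transposed and moved to the front, so
    that \<open>delta\<close> can collapse that sum at \<open>j\<close>.\<close>
  have "(\<Oplus>k\<in>I. (a \<otimes> d i k \<oplus> b \<otimes> B i k) \<otimes> (a' \<otimes> d k j \<oplus> b' \<otimes> B k j)) =
    (\<Oplus>k\<in>I. a \<otimes> a' \<otimes> (d i k \<otimes> d k j) \<oplus> (a \<otimes> b' \<otimes> (d i k \<otimes> B k j) \<oplus>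
      (b \<otimes> a' \<otimes> (d j k \<otimes> B i k) \<oplus> b \<otimes> b' \<otimes> (B i k \<otimes> B k j))))"
  proof (rule finsum_cong'[OF refl])
    fix k assume "k \<in> I"
    have "d i k \<in> carrier R" "d k j \<in> carrier R" "B i k \<in> carrier R" "B k j \<in> carrier R" by (simp_all add: d B)
    then show "(a \<otimes> d i k \<oplus> b \<otimes> B i k) \<otimes> (a' \<otimes> d k j \<oplus> b' \<otimes> B k j) =
      a \<otimes> a' \<otimes> (d i k \<otimes> d k j) \<oplus> (a \<otimes> b' \<otimes> (d i k \<otimes> B k j) \<oplus>
      (b \<otimes> a' \<otimes> (d j k \<otimes> B i k) \<oplus> b \<otimes> b' \<otimes> (B i k \<otimes> B k j)))"
      unfolding d(2)[of j k] using coeffs by algebra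
  qed (use coeffs d(1) B in auto)
  also have "\<dots> = a \<otimes> a' \<otimes> (\<Oplus>k\<in>I. d i k \<otimes> d k j) \<oplus> (a \<otimes> b' \<otimes> (\<Oplus>k\<in>I. d i k \<otimes> B k j) \<oplus>
      (b \<otimes> a' \<otimes> (\<Oplus>k\<in>I. d j k \<otimes> B i k) \<oplus> b \<otimes> b' \<otimes> (\<Oplus>k\<in>I. B i k \<otimes> B k j)))"
    using coeffs d(1) B by (simp add: finsum_addf finsum_rdistr Pi_def I(1))
  also have "\<dots> = a \<otimes> a' \<otimes> d i j \<oplus> (a \<otimes> b' \<otimes> B i j \<oplus> (b \<otimes> a' \<otimes> B i j \<oplus> b \<otimes> b' \<otimes> (m \<otimes> d i j \<oplus> c \<otimes> B i j)))"
    using delta[OF I(2), of "\<lambda>k. d k j"] delta[OF I(2), of "\<lambda>k. B k j"] delta[OF I(3), of "\<lambda>k. B i k"]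
    by (simp add: square[folded d_def] d(1) B)
  also have "\<dots> = (a \<otimes> a' \<oplus> b \<otimes> b' \<otimes> m) \<otimes> d i j \<oplus> (a \<otimes> b' \<oplus> b \<otimes> a' \<oplus> b \<otimes> b' \<otimes> c) \<otimes> B i j"
  proof -
    have "d i j \<in> carrier R" "B i j \<in> carrier R" by (simp_all add: d B)
    then show ?thesis using coeffs by algebra
  qed
  finally show ?thesis unfolding d_def .
qed

text \<open>A complex combination of translates of \<open>y\<close> is the product of
  \<open>y\<close> with the group algebra element having these coefficients. They are cut off
  outside the carrier to make it an element.\<close>

lemma (in group) sum_ga_of_mult:
  assumes "finite (carrier G)"
  shows "(\<Sum>g\<in>carrier G. a g * (ga_of g \<otimes>\<^bsub>group_algebra G\<^esub> y) x) =
    ((\<lambda>g. if g \<in> carrier G then a g else 0) \<otimes>\<^bsub>group_algebra G\<^esub> y) x"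
proof -
  have "(\<Sum>g\<in>carrier G. a g * (ga_of g \<otimes>\<^bsub>group_algebra G\<^esub> y) x) =
    (\<Sum>g\<in>carrier G. if x \<in> carrier G then a g * y (inv g \<otimes> x) else 0)"
    using assms by (intro sum.cong) (auto simp: group_algebra_mult_ga_of)
  then show ?thesis by (auto simp: group_algebra_def)
qed

context gain_matrix
begin

lemma group_algebra_ring: "cring (group_algebra \<Gamma>)"
  by (rule group_algebra_cring[OF comm_group_axioms finite_carrier])

lemma gain_mat_closed: "B i j \<in> carrier (group_algebra \<Gamma>)"
  by (simp add: gain_mat_def ga_of_closed) (simp add: group_algebra_def)

definition span_elem :: "('g \<Rightarrow> complex) \<Rightarrow> ('g \<Rightarrow> complex) \<Rightarrow> 'g ga_mat" where
  "span_elem a a' = (\<lambda>i j. a \<otimes>\<^bsub>group_algebra \<Gamma>\<^esub> ga_mat_one \<Gamma> n i j \<oplus>\<^bsub>group_algebra \<Gamma>\<^esub>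
     a' \<otimes>\<^bsub>group_algebra \<Gamma>\<^esub> B i j)"

text \<open>Passing from complex coefficients to coefficients in the group algebra leaves only two
  generators, I and B. The truncation \<open>res\<close> is needed because the coefficient functions
  of the complex span are arbitrary off the carrier.\<close>

lemma roux_span_eq:
  "roux_span \<Gamma> n B = {span_elem a a' | a a'. a \<in> carrier (group_algebra \<Gamma>) \<and> a' \<in> carrier (group_algebra \<Gamma>)}"
proof -
  define res where "res a = (\<lambda>g. if g \<in> carrier \<Gamma> then a g else 0)" for a :: "'g \<Rightarrow> complex"
  have res: "res a \<in> carrier (group_algebra \<Gamma>)" for a
    by (simp add: res_def group_algebra_def)
  have res_id: "res a = a" if "a \<in> carrier (group_algebra \<Gamma>)" for a
    using that by (auto simp: res_def group_algebra_def)
  have elem: "(\<lambda>i j x. (\<Sum>g\<in>carrier \<Gamma>. a g * ga_mat_scale \<Gamma> g (ga_mat_one \<Gamma> n) i j x)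
             + (\<Sum>g\<in>carrier \<Gamma>. a' g * ga_mat_scale \<Gamma> g B i j x)) = span_elem (res a) (res a')" for a a'
    by (simp add: span_elem_def add_group_algebra ga_mat_scale_def sum_ga_of_mult finite_carrier flip: res_def)
  show ?thesis unfolding roux_span_def elem
  proof (intro subset_antisym subsetI)
    fix M assume "M \<in> {span_elem (res a) (res a') | a a'. True}"
    then show "M \<in> {span_elem a a' | a a'. a \<in> carrier (group_algebra \<Gamma>) \<and> a' \<in> carrier (group_algebra \<Gamma>)}"
      using res by blast
  next
    fix M assume "M \<in> {span_elem a a' | a a'. a \<in> carrier (group_algebra \<Gamma>) \<and> a' \<in> carrier (group_algebra \<Gamma>)}"
    then obtain a a' where "M = span_elem a a'" "a \<in> carrier (group_algebra \<Gamma>)" "a' \<in> carrier (group_algebra \<Gamma>)"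
      by blast
    then have "M = span_elem (res a) (res a')" by (simp only: res_id)
    then show "M \<in> {span_elem (res a) (res a') | a a'. True}" by blast
  qed
qed

text \<open>The parameter equation says that B^2 is a combination of I and B over the group algebra,
  so products of combinations reduce to combinations.\<close>

lemma span_elem_mult:
  assumes params: "roux_params \<Gamma> n B c"
    and a: "a \<in> carrier (group_algebra \<Gamma>)" "a' \<in> carrier (group_algebra \<Gamma>)"
      "d \<in> carrier (group_algebra \<Gamma>)" "d' \<in> carrier (group_algebra \<Gamma>)"
  shows "ga_mat_mult \<Gamma> n (span_elem a a') (span_elem d d') \<in> roux_span \<Gamma> n B"
proof -
  interpret R: cring "group_algebra \<Gamma>" by (rule group_algebra_ring)
  let ?R = "group_algebra \<Gamma>"
  have delta: "ga_mat_one \<Gamma> n i j = (if i = j then \<one>\<^bsub>?R\<^esub> else \<zero>\<^bsub>?R\<^esub>)" if "i \<in> {1..n}" for i j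
    using that by (simp add: ga_mat_one_def)
  have one_closed: "ga_mat_one \<Gamma> n i j \<in> carrier ?R" for i j by (simp add: ga_mat_one_def)
  have mult: "ga_mat_mult \<Gamma> n M N i j = finsum ?R (\<lambda>k. M i k \<otimes>\<^bsub>?R\<^esub> N k j) {1..n}"
    if "\<And>i j. M i j \<in> carrier ?R" "\<And>i j. N i j \<in> carrier ?R" for M N i j
    unfolding ga_mat_mult_def using that by (subst finsum_group_algebra) (auto simp: finite_carrier)
  \<comment> \<open>The scalar n - 1 and the parameters, as elements of the group algebra.\<close>
  define m where "m = (\<lambda>x. (of_nat n - 1) * \<one>\<^bsub>?R\<^esub> x)"
  define c' where "c' = (\<lambda>g. if g \<in> carrier \<Gamma> then c g else 0)"
  have m: "m \<in> carrier ?R" using R.one_closed by (auto simp: m_def group_algebra_def)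
  have c': "c' \<in> carrier ?R" by (simp add: c'_def group_algebra_def)
  have m_one: "m \<otimes>\<^bsub>?R\<^esub> ga_mat_one \<Gamma> n i j = (\<lambda>x. (of_nat n - 1) * ga_mat_one \<Gamma> n i j x)" for i j
    using m by (simp add: ga_mat_one_def) (simp add: m_def zero_group_algebra)
  have square: "finsum ?R (\<lambda>k. B i k \<otimes>\<^bsub>?R\<^esub> B k j) {1..n} =
      m \<otimes>\<^bsub>?R\<^esub> ga_mat_one \<Gamma> n i j \<oplus>\<^bsub>?R\<^esub> c' \<otimes>\<^bsub>?R\<^esub> B i j" for i j
  proof -
    have "ga_mat_mult \<Gamma> n B B i j =
      (\<lambda>x. (of_nat n - 1) * ga_mat_one \<Gamma> n i j x + (\<Sum>g\<in>carrier \<Gamma>. c g * ga_mat_scale \<Gamma> g B i j x))"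
      using params unfolding roux_params_def by (simp only:)
    also have "\<dots> = m \<otimes>\<^bsub>?R\<^esub> ga_mat_one \<Gamma> n i j \<oplus>\<^bsub>?R\<^esub> c' \<otimes>\<^bsub>?R\<^esub> B i j"
      by (simp add: add_group_algebra m_one ga_mat_scale_def sum_ga_of_mult finite_carrier flip: c'_def)
    finally show ?thesis by (simp only: mult[OF gain_mat_closed gain_mat_closed])
  qed
  have closed: "span_elem x y i j \<in> carrier ?R" if "x \<in> carrier ?R" "y \<in> carrier ?R" for x y i j
    using that one_closed gain_mat_closed by (simp add: span_elem_def)
  define e where "e = a \<otimes>\<^bsub>?R\<^esub> d \<oplus>\<^bsub>?R\<^esub> a' \<otimes>\<^bsub>?R\<^esub> d' \<otimes>\<^bsub>?R\<^esub> m"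
  define e' where "e' = a \<otimes>\<^bsub>?R\<^esub> d' \<oplus>\<^bsub>?R\<^esub> a' \<otimes>\<^bsub>?R\<^esub> d \<oplus>\<^bsub>?R\<^esub> a' \<otimes>\<^bsub>?R\<^esub> d' \<otimes>\<^bsub>?R\<^esub> c'"
  have "ga_mat_mult \<Gamma> n (span_elem a a') (span_elem d d') i j = span_elem e e' i j" for i j
  proof (cases "i \<in> {1..n} \<and> j \<in> {1..n}")
    case True
    have "ga_mat_mult \<Gamma> n (span_elem a a') (span_elem d d') i j =
      finsum ?R (\<lambda>k. span_elem a a' i k \<otimes>\<^bsub>?R\<^esub> span_elem d d' k j) {1..n}"
      by (rule mult) (use a closed in blast)+
    also have "\<dots> = finsum ?R (\<lambda>k. (a \<otimes>\<^bsub>?R\<^esub> (if i = k then \<one>\<^bsub>?R\<^esub> else \<zero>\<^bsub>?R\<^esub>) \<oplus>\<^bsub>?R\<^esub> a' \<otimes>\<^bsub>?R\<^esub> B i k) \<otimes>\<^bsub>?R\<^esub>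
      (d \<otimes>\<^bsub>?R\<^esub> (if k = j then \<one>\<^bsub>?R\<^esub> else \<zero>\<^bsub>?R\<^esub>) \<oplus>\<^bsub>?R\<^esub> d' \<otimes>\<^bsub>?R\<^esub> B k j)) {1..n}"
      by (rule R.finsum_cong') (use True a gain_mat_closed in \<open>auto simp: span_elem_def delta\<close>)
    also have "\<dots> = e \<otimes>\<^bsub>?R\<^esub> (if i = j then \<one>\<^bsub>?R\<^esub> else \<zero>\<^bsub>?R\<^esub>) \<oplus>\<^bsub>?R\<^esub> e' \<otimes>\<^bsub>?R\<^esub> B i j"
      unfolding e_def e'_def
      by (rule R.finsum_linear_product) (use True a m c' gain_mat_closed square[of i j] in \<open>simp_all add: delta\<close>)
    also have "\<dots> = span_elem e e' i j" using True by (simp add: span_elem_def delta)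
    finally show ?thesis .
  next
    case False
    have zero: "span_elem x y i j = (\<lambda>_. 0)" if "\<not> (i \<in> {1..n} \<and> j \<in> {1..n})" for x y i j
    proof -
      have "B i j = (\<lambda>_. 0)" by (rule gain_mat_zero) (use that in blast)
      moreover have "ga_mat_one \<Gamma> n i j = (\<lambda>_. 0)" using that by (auto simp: ga_mat_one_def zero_group_algebra)
      ultimately show ?thesis by (simp add: span_elem_def group_algebra_mult_zero add_group_algebra)
    qed
    have "span_elem a a' i k \<otimes>\<^bsub>?R\<^esub> span_elem d d' k j = (\<lambda>_. 0)" for k
    proof (cases "i \<in> {1..n}")
      case True
      then have "span_elem d d' k j = (\<lambda>_. 0)" using False by (intro zero) blast
      then show ?thesis by (simp add: group_algebra_mult_zero)
    next
      case False
      then have "span_elem a a' i k = (\<lambda>_. 0)" by (intro zero) blast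
      then show ?thesis by (simp add: group_algebra_mult_zero)
    qed
    then show ?thesis by (simp add: ga_mat_mult_def zero[OF False])
  qed
  then have "ga_mat_mult \<Gamma> n (span_elem a a') (span_elem d d') = span_elem e e'" by (intro ext) simp
  moreover have "e \<in> carrier ?R" "e' \<in> carrier ?R" using a m c' by (simp_all add: e_def e'_def)
  ultimately show ?thesis unfolding roux_span_eq by blast
qed

lemma roux_params_imp_roux:
  assumes "roux_params \<Gamma> n B c"
  shows "roux \<Gamma> n B"
proof -
  have "roux_R4 \<Gamma> n B" unfolding roux_R4_def
  proof (intro ballI)
    fix M N assume "M \<in> roux_span \<Gamma> n B" "N \<in> roux_span \<Gamma> n B"
    then obtain a a' d d' where "M = span_elem a a'" "N = span_elem d d'"
      "a \<in> carrier (group_algebra \<Gamma>)" "a' \<in> carrier (group_algebra \<Gamma>)"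
      "d \<in> carrier (group_algebra \<Gamma>)" "d' \<in> carrier (group_algebra \<Gamma>)"
      unfolding roux_span_eq by blast
    then show "ga_mat_mult \<Gamma> n M N \<in> roux_span \<Gamma> n B" by (simp only: span_elem_mult[OF assms])
  qed
  then show ?thesis using roux_conditions by (simp add: roux_def)
qed

end

section \<open>Roux graphs of diameter three\<close>

context gain_matrix
begin

text \<open>The paths counted have gain \<open>g \<otimes> inv h\<close>; dividing by the gain
  \<open>b i j\<close> of the direct step gives the index of the parameter.\<close>

lemma common_nbrs_params:
  assumes "roux_params \<Gamma> n B c" "(i, g) \<in> verts" "(j, h) \<in> verts" "i \<noteq> j"
  shows "of_nat (card {w \<in> verts. ((i, g), w) \<in> edges \<and> ((j, h), w) \<in> edges}) = c (g \<otimes> inv h \<otimes> b j i)"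
proof -
  have *: "i \<in> {1..n}" "j \<in> {1..n}" "g \<in> carrier \<Gamma>" "h \<in> carrier \<Gamma>"
    using assms(2,3) by (auto simp: roux_verts_def)
  then have "b j i \<otimes> b i j = \<one>" using gain_inv[of i j] by simp
  then have "g \<otimes> inv h \<otimes> b j i \<otimes> b i j = g \<otimes> inv h" using * by (simp add: m_assoc)
  moreover have "c (g \<otimes> inv h \<otimes> b j i) = of_nat (card (paths i j (g \<otimes> inv h \<otimes> b j i \<otimes> b i j)))"
    using assms(1) * assms(4) unfolding roux_params_iff by simp
  ultimately show ?thesis unfolding common_nbrs[OF assms(2,3)] by simp
qed

lemma same_fibre_verts_iff:
  "u \<in> verts \<Longrightarrow> v \<in> verts \<Longrightarrow> cover.same_fibre u v \<longleftrightarrow> fst u = fst v"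
  by (cases u; cases v) (auto simp: same_fibre_iff roux_verts_def)

text \<open>Together with the previous count this separates the parameters: the one at \<one>
  belongs to adjacent pairs, the others to non-adjacent pairs in distinct fibres.\<close>

lemma edge_iff_gain_one:
  assumes "(i, g) \<in> verts" "(j, h) \<in> verts" "i \<noteq> j"
  shows "((i, g), (j, h)) \<in> edges \<longleftrightarrow> g \<otimes> inv h \<otimes> b j i = \<one>"
proof -
  have *: "i \<in> {1..n}" "j \<in> {1..n}" "g \<in> carrier \<Gamma>" "h \<in> carrier \<Gamma>"
    using assms(1,2) by (auto simp: roux_verts_def)
  have "g \<otimes> inv h \<otimes> b j i = \<one> \<longleftrightarrow> g \<otimes> inv h = b i j"
    using * gain_inv[of i j] inv_solve_right'[of \<one> "g \<otimes> inv h" "b i j"] by auto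
  also have "\<dots> \<longleftrightarrow> g = b i j \<otimes> h" using * inv_solve_right'[of "b i j" g h] by auto
  finally show ?thesis using * assms(3) by (simp add: edge_iff)
qed

text \<open>Non-adjacent vertices of distinct fibres are counted by a parameter at a non-identity
  element, so if these do not vanish a common neighbour exists.\<close>

lemma joined:
  assumes "n \<ge> 2" "order \<Gamma> \<ge> 2" and params: "roux_params \<Gamma> n B c"
    and nz: "\<And>g. g \<in> carrier \<Gamma> \<Longrightarrow> g \<noteq> \<one> \<Longrightarrow> c g \<noteq> 0"
  shows "joined_cover_graph n (order \<Gamma>) verts edges fibres"
proof unfold_locales
  fix u v assume uv: "u \<in> verts" "v \<in> verts" "\<not> cover.same_fibre u v" "(u, v) \<notin> edges"
  obtain i g j h where ij: "u = (i, g)" "v = (j, h)" by (metis surj_pair)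
  have "i \<noteq> j" using uv ij by (simp add: same_fibre_verts_iff)
  have "i \<in> {1..n}" "j \<in> {1..n}" "g \<in> carrier \<Gamma>" "h \<in> carrier \<Gamma>"
    using uv(1,2) ij by (auto simp: roux_verts_def)
  then have "g \<otimes> inv h \<otimes> b j i \<in> carrier \<Gamma>" by simp
  moreover have "g \<otimes> inv h \<otimes> b j i \<noteq> \<one>" using uv ij \<open>i \<noteq> j\<close> edge_iff_gain_one by blast
  ultimately have "c (g \<otimes> inv h \<otimes> b j i) \<noteq> 0" by (rule nz)
  then have "of_nat (card {w \<in> verts. (u, w) \<in> edges \<and> (v, w) \<in> edges}) \<noteq> (0 :: complex)"
    unfolding ij common_nbrs_params[OF params uv(1,2)[unfolded ij] \<open>i \<noteq> j\<close>] .
  then have "card {w \<in> verts. (u, w) \<in> edges \<and> (v, w) \<in> edges} \<noteq> 0" unfolding of_nat_eq_0_iff .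
  then have "{w \<in> verts. (u, w) \<in> edges \<and> (v, w) \<in> edges} \<noteq> {}" by (rule contrapos_nn) (simp only: card.empty)
  then show "\<exists>w. (u, w) \<in> edges \<and> (w, v) \<in> edges" using edges_sym by blast
qed (use assms in auto)

text \<open>A walk of length 3 from \<open>(1, g)\<close> to \<open>(1, \<one>)\<close> starts with an edge to some \<open>x\<close>, and \<open>c g\<close> is the
  number of common neighbours of \<open>x\<close> and \<open>(1, \<one>)\<close>.\<close>

lemma diameter_3_imp_nonzero:
  assumes "n \<ge> 2" and params: "roux_params \<Gamma> n B c" and diam: "gdiameter verts edges = 3"
    and g: "g \<in> carrier \<Gamma>" "g \<noteq> \<one>"
  shows "c g \<noteq> 0"
proof -
  let ?u = "(1, g)" and ?v = "(1, \<one>)"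
  have uv: "?u \<in> verts" "?v \<in> verts" "?u \<noteq> ?v" using assms(1) g by (auto simp: roux_verts_def)
  then have "gdist edges ?u ?v \<le> gdiameter verts edges"
    unfolding gdiameter_def by (intro Sup_upper CollectI exI[of _ ?u] exI[of _ ?v]) simp
  then have "gdist edges ?u ?v \<le> enat 3" unfolding diam by (simp add: numeral_eq_enat)
  then obtain m where m: "m \<le> 3" "(?u, ?v) \<in> edges ^^ m" unfolding gdist_le_iff by blast
  have sf: "cover.same_fibre ?u ?v" using uv by (simp add: same_fibre_verts_iff)
  have "m \<noteq> 0"
  proof
    assume "m = 0"
    then show False using m(2) g(2) by simp
  qed
  moreover have "m \<noteq> 1" using m(2) cover.same_fibre_no_edge[OF sf] by auto
  moreover have "m \<noteq> 2"
  proof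
    assume "m = 2"
    with m(2) have "(?u, ?v) \<in> edges ^^ 2" by (simp only:)
    then obtain w where "(?u, w) \<in> edges" "(w, ?v) \<in> edges" unfolding relpow_2_iff by blast
    then show False using cover.same_fibre_nbr[OF sf, of w] uv(3) edges_sym by blast
  qed
  ultimately have "(?u, ?v) \<in> edges ^^ Suc 2" proof -
    assume "m \<noteq> 0" "m \<noteq> 1" "m \<noteq> 2"
    with m(1) have "m = Suc 2" by linarith
    with m(2) show ?thesis by (simp only:)
  qed
  then obtain x where x: "(?u, x) \<in> edges" "(x, ?v) \<in> edges ^^ 2" by (rule relpow_Suc_E2)
  then obtain y where y: "(x, y) \<in> edges" "(y, ?v) \<in> edges" unfolding relpow_2_iff by blast
  obtain k h where kh: "x = (k, h)" by (metis surj_pair)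
  have x': "x \<in> verts" "y \<in> verts" using y(1) cover.edges_V by auto
  have k: "k \<in> {1..n}" "k \<noteq> 1" "h = b k 1 \<otimes> g"
    using x(1) unfolding kh by (auto simp: edge_iff gain_cancel)
  have one: "1 \<in> {1..n}" using assms(1) by simp
  \<comment> \<open>Commutativity enters here: conjugating \<open>g\<close> by the gain
    \<open>b k 1\<close> gives \<open>g\<close> back.\<close>
  have "b k 1 \<otimes> g \<otimes> inv \<one> \<otimes> b 1 k = g"
    using k one g gain_inv[of k 1] gain_closed[of k 1] by (simp add: m_ac)
  then have c_eq: "c g = of_nat (card {w \<in> verts. (x, w) \<in> edges \<and> (?v, w) \<in> edges})"
    using common_nbrs_params[OF params, of k h 1 \<one>] x' uv(2) k unfolding kh by simp
  have "y \<in> {w \<in> verts. (x, w) \<in> edges \<and> (?v, w) \<in> edges}" using x' y edges_sym by blast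
  moreover have "finite {w \<in> verts. (x, w) \<in> edges \<and> (?v, w) \<in> edges}" using cover.finite_V by simp
  ultimately have "card {w \<in> verts. (x, w) \<in> edges \<and> (?v, w) \<in> edges} > 0"
    unfolding card_gt_0_iff by blast
  then show ?thesis unfolding c_eq of_nat_eq_0_iff by (rule gr_implies_not0)
qed

lemma roux_drackn:
  assumes "n \<ge> 2" "order \<Gamma> \<ge> 2" "c \<noteq> 0"
    and params: "roux_params \<Gamma> n B (drackn_params \<Gamma> n (order \<Gamma>) c)"
  shows "drackn n (order \<Gamma>) c verts edges fibres"
proof -
  let ?c = "drackn_params \<Gamma> n (order \<Gamma>) c"
  interpret joined_cover_graph n "order \<Gamma>" verts edges fibres
    by (rule joined[OF assms(1,2) params]) (use assms(3) in \<open>simp add: drackn_params_def\<close>)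
  \<comment> \<open>The parameter at \<one> is given by a complex formula; that it is a natural
    number is seen from any off-diagonal entry, here (1, 2).\<close>
  define a where "a = card (paths 1 2 (b 1 2))"
  have "?c \<one> = of_nat a"
    using params[unfolded roux_params_iff, rule_format, of 1 2 \<one>] assms(1) by (simp add: a_def)
  have common: "of_nat (card {w \<in> verts. (u, w) \<in> edges \<and> (v, w) \<in> edges}) =
      (of_nat (if (u, v) \<in> edges then a else c) :: complex)"
    if uv: "u \<in> verts" "v \<in> verts" "\<not> cover.same_fibre u v" for u v
  proof -
    obtain i g j h where ij: "u = (i, g)" "v = (j, h)" by (metis surj_pair)
    have ne: "i \<noteq> j" using uv ij by (simp add: same_fibre_verts_iff)
    have "of_nat (card {w \<in> verts. (u, w) \<in> edges \<and> (v, w) \<in> edges}) = ?c (g \<otimes> inv h \<otimes> b j i)"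
      using common_nbrs_params[OF params] uv(1,2) ne unfolding ij by blast
    also have "\<dots> = of_nat (if (u, v) \<in> edges then a else c)"
      using edge_iff_gain_one[of i g j h] uv(1,2) ne \<open>?c \<one> = of_nat a\<close> unfolding ij
      by (simp add: drackn_params_def)
    finally show ?thesis .
  qed
  interpret regular_joined_cover_graph n "order \<Gamma>" verts edges fibres a c
  proof unfold_locales
    fix u v assume uv: "u \<in> verts" "v \<in> verts"
    show "card {w \<in> verts. (u, w) \<in> edges \<and> (v, w) \<in> edges} = a" if "(u, v) \<in> edges"
    proof -
      have "\<not> cover.same_fibre u v" using that cover.same_fibre_no_edge by blast
      from common[OF uv this] show ?thesis using that by simp
    qed
    show "card {w \<in> verts. (u, w) \<in> edges \<and> (v, w) \<in> edges} = c"
      if "\<not> cover.same_fibre u v" "(u, v) \<notin> edges"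
      using common[OF uv that(1)] that(2) by simp
  qed
  show ?thesis by (rule drackn)
qed

end

section \<open>The permutation group of a roux graph\<close>

text \<open>Left translation by \<open>x\<close> in coordinates: \<open>h\<close> is the chart of
  the source fibre and \<open>f\<close> that of the target. There are two charts because the labels
  of different fibres are unrelated.\<close>

definition conj_perm ::
    "('g, 'm) monoid_scheme \<Rightarrow> nat \<Rightarrow> (nat \<Rightarrow> 'g) \<Rightarrow> (nat \<Rightarrow> 'g) \<Rightarrow> 'g \<Rightarrow> nat \<Rightarrow> nat" where
  "conj_perm G r f h x = (\<lambda>a. if a \<in> {1..r} then inv_into {1..r} f (x \<otimes>\<^bsub>G\<^esub> h a) else a)"

context group
begin

lemma conj_perm_apply:
  assumes "bij_betw f {1..r} (carrier G)" "bij_betw h {1..r} (carrier G)" "x \<in> carrier G" "a \<in> {1..r}"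
  shows "conj_perm G r f h x a \<in> {1..r}" "f (conj_perm G r f h x a) = x \<otimes> h a"
proof -
  have "x \<otimes> h a \<in> f ` {1..r}" using assms bij_betwE[OF assms(2)] by (simp add: bij_betw_imp_surj_on)
  then show "conj_perm G r f h x a \<in> {1..r}" "f (conj_perm G r f h x a) = x \<otimes> h a"
    using assms(4) unfolding conj_perm_def by (simp_all only: if_True inv_into_into f_inv_into_f)
qed

lemma conj_perm_eqI:
  assumes "bij_betw f {1..r} (carrier G)" "a \<in> {1..r}" "a' \<in> {1..r}" "f a' = x \<otimes> h a"
  shows "conj_perm G r f h x a = a'"
  using assms by (simp add: conj_perm_def bij_betw_def flip: assms(4))

lemma conj_perm_outside: "a \<notin> {1..r} \<Longrightarrow> conj_perm G r f h x a = a"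
  unfolding conj_perm_def by (rule if_not_P)

text \<open>The chart \<open>h\<close> in the middle cancels; this is what makes normalized blocks
  depend on one chart only.\<close>

lemma conj_perm_comp:
  assumes f: "bij_betw f {1..r} (carrier G)" and h: "bij_betw h {1..r} (carrier G)"
    and k: "bij_betw k {1..r} (carrier G)" and x: "x \<in> carrier G" "y \<in> carrier G"
  shows "conj_perm G r f h x \<circ> conj_perm G r h k y = conj_perm G r f k (x \<otimes> y)"
proof
  fix a
  show "(conj_perm G r f h x \<circ> conj_perm G r h k y) a = conj_perm G r f k (x \<otimes> y) a"
  proof (cases "a \<in> {1..r}")
    case True
    note 1 = conj_perm_apply[OF h k x(2) True]
    note 2 = conj_perm_apply[OF f h x(1) 1(1)]
    have "k a \<in> carrier G" using bij_betwE[OF k] True by blast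
    then have "f (conj_perm G r f h x (conj_perm G r h k y a)) = x \<otimes> y \<otimes> k a"
      using x by (simp only: 1 2 m_assoc)
    from conj_perm_eqI[where f = f and h = k, OF f True 2(1) this] show ?thesis by simp
  qed (simp only: conj_perm_outside o_apply id_apply not_False_eq_True)
qed

lemma conj_perm_one:
  assumes f: "bij_betw f {1..r} (carrier G)"
  shows "conj_perm G r f f \<one> = id"
proof
  fix a show "conj_perm G r f f \<one> a = id a"
  proof (cases "a \<in> {1..r}")
    case True
    then have "f a \<in> carrier G" using bij_betwE[OF f] by blast
    with conj_perm_eqI[where h = f and x = \<one>, OF f True True] show ?thesis by simp
  qed (simp only: conj_perm_outside o_apply id_apply not_False_eq_True)
qed

text \<open>Bijectivity is witnessed by translation by \<open>inv x\<close> with the charts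
  exchanged.\<close>

lemma conj_perm_closed:
  assumes f: "bij_betw f {1..r} (carrier G)" and h: "bij_betw h {1..r} (carrier G)" and x: "x \<in> carrier G"
  shows "conj_perm G r f h x \<in> carrier (sym_group r)"
proof -
  have "conj_perm G r f h x \<circ> conj_perm G r h f (inv x) = id"
    "conj_perm G r h f (inv x) \<circ> conj_perm G r f h x = id"
    using x by (simp_all add: conj_perm_comp[OF f h f] conj_perm_comp[OF h f h] conj_perm_one[OF f] conj_perm_one[OF h])
  then have "bij (conj_perm G r f h x)" by (metis o_bij)
  moreover note conj_perm_outside
  ultimately show ?thesis unfolding sym_group_carrier permutes_def bij_iff by blast
qed

lemma conj_perm_inv:
  assumes f: "bij_betw f {1..r} (carrier G)" and h: "bij_betw h {1..r} (carrier G)" and x: "x \<in> carrier G"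
  shows "inv\<^bsub>sym_group r\<^esub> (conj_perm G r f h x) = conj_perm G r h f (inv x)"
proof -
  interpret S: group "sym_group r" by (rule sym_group_is_group)
  show ?thesis
    by (rule S.inv_equality)
      (use x in \<open>simp_all add: conj_perm_closed[OF f h] conj_perm_closed[OF h f]
        sym_group_mult sym_group_one conj_perm_comp[OF h f h] conj_perm_one[OF h]\<close>)
qed

text \<open>With the same chart at both ends \<open>conj_perm\<close> is the left regular
  representation, a homomorphism.\<close>

lemma conj_perm_subgroup:
  assumes f: "bij_betw f {1..r} (carrier G)"
  shows "subgroup (conj_perm G r f f ` carrier G) (sym_group r)"
proof -
  interpret group_hom G "sym_group r" "conj_perm G r f f"
    by (rule group_hom.intro[OF is_group sym_group_is_group], rule group_hom_axioms.intro)
      (auto simp: hom_def conj_perm_closed[OF f f] sym_group_mult conj_perm_comp[OF f f f])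
  show ?thesis by (rule img_is_subgroup)
qed

lemma comm_group_generate:
  assumes "subgroup H G" "S \<subseteq> H" "\<And>x y. x \<in> H \<Longrightarrow> y \<in> H \<Longrightarrow> x \<otimes> y = y \<otimes> x"
  shows "comm_group (G\<lparr>carrier := generate G S\<rparr>)"
proof -
  have "S \<subseteq> carrier G" using assms(1,2) subgroup.subset by blast
  then have "group (G\<lparr>carrier := generate G S\<rparr>)" by (intro subgroup_imp_group generate_is_subgroup)
  moreover have "generate G S \<subseteq> H" by (rule generate_subgroup_incl[OF assms(2,1)])
  ultimately show ?thesis by (intro group.group_comm_groupI) (use assms(3) in auto)
qed

end

section \<open>The cover group of a roux graph\<close>

context gain_matrix
begin

text \<open>A labelling amounts to a permutation of the fibres together with an identification of
  each fibre with the group.\<close>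

lemma cover_labelling_gain:
  assumes l: "cover_labelling n (order \<Gamma>) fibres l"
  obtains \<pi> \<gamma> where "bij_betw \<pi> {1..n} {1..n}"
    "\<And>i. i \<in> {1..n} \<Longrightarrow> bij_betw (\<gamma> i) {1..order \<Gamma>} (carrier \<Gamma>)"
    "\<And>i a. i \<in> {1..n} \<Longrightarrow> a \<in> {1..order \<Gamma>} \<Longrightarrow> l i a = (\<pi> i, \<gamma> i a)"
proof -
  define \<pi> where "\<pi> i = fst (l i 1)" for i
  define \<gamma> where "\<gamma> i a = snd (l i a)" for i a
  let ?img = "\<lambda>i. l i ` {1..order \<Gamma>}"
  have bij: "bij_betw ?img {1..n} fibres" using l by (simp add: cover_labelling_def)
  have inj: "inj_on (l i) {1..order \<Gamma>}" if "i \<in> {1..n}" for i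
    using l that by (simp add: cover_labelling_def)
  \<comment> \<open>The label 1 must exist for \<open>\<pi>\<close> to read off the number of a
    fibre from \<open>l i 1\<close>.\<close>
  have r: "order \<Gamma> \<ge> 1"
    using finite_carrier one_closed unfolding order_def by (metis One_nat_def Suc_leI card_gt_0_iff empty_iff)
  have img: "\<pi> i \<in> {1..n}" "?img i = {\<pi> i} \<times> carrier \<Gamma>" if i: "i \<in> {1..n}" for i
  proof -
    have "?img i \<in> fibres" using bij_betwE[OF bij] i by blast
    then obtain p where p: "p \<in> {1..n}" "?img i = {p} \<times> carrier \<Gamma>" unfolding roux_fibres_def by blast
    have "l i 1 \<in> ?img i" using r by simp
    then have "\<pi> i = p" unfolding p(2) \<pi>_def by auto
    then show "\<pi> i \<in> {1..n}" "?img i = {\<pi> i} \<times> carrier \<Gamma>" using p by simp_all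
  qed
  have l_eq: "l i a = (\<pi> i, \<gamma> i a)" if "i \<in> {1..n}" "a \<in> {1..order \<Gamma>}" for i a
  proof -
    have "l i a \<in> {\<pi> i} \<times> carrier \<Gamma>" using that img(2)[OF that(1)] by blast
    then show ?thesis by (auto simp: \<gamma>_def)
  qed
  have "inj_on \<pi> {1..n}"
  proof (rule inj_onI)
    fix i j assume ij: "i \<in> {1..n}" "j \<in> {1..n}" "\<pi> i = \<pi> j"
    then have "?img i = ?img j" using img(2) by metis
    then show "i = j" using bij ij(1,2) unfolding bij_betw_def inj_on_def by blast
  qed
  moreover have "\<pi> ` {1..n} = {1..n}"
    by (rule endo_inj_surj) (use img(1) \<open>inj_on \<pi> {1..n}\<close> in auto)
  ultimately have "bij_betw \<pi> {1..n} {1..n}" by (simp add: bij_betw_def)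
  moreover have "bij_betw (\<gamma> i) {1..order \<Gamma>} (carrier \<Gamma>)" if i: "i \<in> {1..n}" for i
  proof (rule bij_betw_imageI)
    show "inj_on (\<gamma> i) {1..order \<Gamma>}"
    proof (rule inj_onI)
      fix a a' assume "a \<in> {1..order \<Gamma>}" "a' \<in> {1..order \<Gamma>}" "\<gamma> i a = \<gamma> i a'"
      moreover from this have "l i a = l i a'" by (simp only: l_eq[OF i])
      ultimately show "a = a'" using inj_onD[OF inj[OF i]] by blast
    qed
    have "\<gamma> i ` {1..order \<Gamma>} = snd ` ?img i" by (auto simp: \<gamma>_def image_image)
    then show "\<gamma> i ` {1..order \<Gamma>} = carrier \<Gamma>" unfolding img(2)[OF i] by simp
  qed
  ultimately show ?thesis using that l_eq by blast
qed

text \<open>The block (i, j) is translation by the gain between charts i and j, and the two diagonal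
  factors lead from the chart of the first fibre and back to it. The gain left over is that of the
  closed walk through the fibres 1, i, j. The chart is only available if a first fibre
  exists.\<close>

lemma normalized_perm_gain:
  assumes l: "cover_labelling n (order \<Gamma>) fibres l"
  obtains \<pi> \<gamma> where "bij_betw \<pi> {1..n} {1..n}" "n \<ge> 1 \<Longrightarrow> bij_betw \<gamma> {1..order \<Gamma>} (carrier \<Gamma>)"
    "\<And>i j. i \<in> {1..n} \<Longrightarrow> j \<in> {1..n} \<Longrightarrow> i \<noteq> j \<Longrightarrow> normalized_perm (order \<Gamma>) edges l i j =
      conj_perm \<Gamma> (order \<Gamma>) \<gamma> \<gamma> (b (\<pi> 1) (\<pi> i) \<otimes> b (\<pi> i) (\<pi> j) \<otimes> b (\<pi> j) (\<pi> 1))"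
proof -
  let ?r = "order \<Gamma>"
  obtain \<pi> \<gamma> where \<pi>: "bij_betw \<pi> {1..n} {1..n}"
    and \<gamma>: "\<And>i. i \<in> {1..n} \<Longrightarrow> bij_betw (\<gamma> i) {1..?r} (carrier \<Gamma>)"
    and l_eq: "\<And>i a. i \<in> {1..n} \<Longrightarrow> a \<in> {1..?r} \<Longrightarrow> l i a = (\<pi> i, \<gamma> i a)"
    using cover_labelling_gain[OF l] by blast
  have \<pi>_in: "\<pi> i \<in> {1..n}" if "i \<in> {1..n}" for i using bij_betwE[OF \<pi>] that by blast
  have \<gamma>_in: "\<gamma> i a \<in> carrier \<Gamma>" if "i \<in> {1..n}" "a \<in> {1..?r}" for i a using bij_betwE[OF \<gamma>] that by blast
  have block: "block_perm ?r edges l i j = conj_perm \<Gamma> ?r (\<gamma> i) (\<gamma> j) (b (\<pi> i) (\<pi> j))"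
    if ij: "i \<in> {1..n}" "j \<in> {1..n}" "i \<noteq> j" for i j
  proof
    fix a
    have ne: "\<pi> i \<noteq> \<pi> j" using \<pi> ij unfolding bij_betw_def inj_on_def by blast
    show "block_perm ?r edges l i j a = conj_perm \<Gamma> ?r (\<gamma> i) (\<gamma> j) (b (\<pi> i) (\<pi> j)) a"
    proof (cases "a \<in> {1..?r}")
      case True
      let ?p = "conj_perm \<Gamma> ?r (\<gamma> i) (\<gamma> j) (b (\<pi> i) (\<pi> j)) a"
      have "b (\<pi> i) (\<pi> j) \<in> carrier \<Gamma>" using \<pi>_in ij by (intro gain_closed)
      note p = conj_perm_apply[OF \<gamma>[OF ij(1)] \<gamma>[OF ij(2)] this True]
      have edge: "(l i a', l j a) \<in> edges \<longleftrightarrow> \<gamma> i a' = b (\<pi> i) (\<pi> j) \<otimes> \<gamma> j a" if "a' \<in> {1..?r}" for a'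
        using l_eq[OF ij(1) that] l_eq[OF ij(2) True] \<pi>_in[OF ij(1)] \<pi>_in[OF ij(2)]
          \<gamma>_in[OF ij(1) that] \<gamma>_in[OF ij(2) True] ne by (simp add: edge_iff)
      have "(THE a'. a' \<in> {1..?r} \<and> (l i a', l j a) \<in> edges) = ?p"
      proof (rule the_equality)
        show "?p \<in> {1..?r} \<and> (l i ?p, l j a) \<in> edges" using edge[OF p(1)] p by blast
        fix a' assume "a' \<in> {1..?r} \<and> (l i a', l j a) \<in> edges"
        then show "a' = ?p" using conj_perm_eqI[OF \<gamma>[OF ij(1)] True] edge by metis
      qed
      then show ?thesis unfolding block_perm_def using True by simp
    next
      case False
      then show ?thesis unfolding block_perm_def conj_perm_def by (simp only: if_False)
    qed
  qed
  \<comment> \<open>As \<open>b i i\<close> is \<one>, the identity block for \<open>j = 1\<close>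
    obeys the same formula as the others.\<close>
  have diag: "diag_perm ?r edges l j = conj_perm \<Gamma> ?r (\<gamma> 1) (\<gamma> j) (b (\<pi> 1) (\<pi> j))"
    if "j \<in> {1..n}" for j
  proof (cases "j = 1")
    case True
    then have "b (\<pi> 1) (\<pi> j) = \<one>" "bij_betw (\<gamma> 1) {1..?r} (carrier \<Gamma>)"
      using that \<pi>_in[OF that] gain_diag \<gamma> by auto
    then show ?thesis unfolding diag_perm_def using True by (simp add: sym_group_one conj_perm_one)
  next
    case False
    then show ?thesis unfolding diag_perm_def using block[of 1 j] that by simp
  qed
  have "normalized_perm ?r edges l i j =
      conj_perm \<Gamma> ?r (\<gamma> 1) (\<gamma> 1) (b (\<pi> 1) (\<pi> i) \<otimes> b (\<pi> i) (\<pi> j) \<otimes> b (\<pi> j) (\<pi> 1))"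
    if ij: "i \<in> {1..n}" "j \<in> {1..n}" "i \<noteq> j" for i j
  proof -
    have one: "1 \<in> {1..n}" using ij by simp
    note closed = gain_closed[OF \<pi>_in \<pi>_in]
    note \<gamma>s = \<gamma>[OF one] \<gamma>[OF ij(1)] \<gamma>[OF ij(2)]
    note cl = closed[OF one ij(1)] closed[OF ij(1,2)] closed[OF one ij(2)] closed[OF ij(2) one]
    have "b (\<pi> j) (\<pi> 1) = inv (b (\<pi> 1) (\<pi> j))" by (rule gain_inv[OF \<pi>_in[OF one] \<pi>_in[OF ij(2)]])
    then show ?thesis
      unfolding normalized_perm_def diag[OF ij(1)] diag[OF ij(2)] block[OF ij] sym_group_mult
      using cl by (simp only: conj_perm_inv[OF \<gamma>s(1,3)] conj_perm_comp[OF \<gamma>s] conj_perm_comp[OF \<gamma>s(1,3,1)]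
          m_closed inv_closed)
  qed
  then show ?thesis using that[of \<pi> "\<gamma> 1"] \<pi> \<gamma>[of 1] by simp
qed

text \<open>All generators lie in the image of the regular representation, which is commutative.
  Without fibres there are no generators and the group is trivial.\<close>

lemma abelian: "abelian_cover n (order \<Gamma>) verts edges fibres"
  unfolding abelian_cover_def
proof (intro conjI allI impI cover)
  fix l assume "cover_labelling n (order \<Gamma>) fibres l"
  from normalized_perm_gain[OF this] obtain \<pi> \<gamma> where \<pi>: "bij_betw \<pi> {1..n} {1..n}"
    and \<gamma>: "n \<ge> 1 \<Longrightarrow> bij_betw \<gamma> {1..order \<Gamma>} (carrier \<Gamma>)"
    and norm: "\<And>i j. i \<in> {1..n} \<Longrightarrow> j \<in> {1..n} \<Longrightarrow> i \<noteq> j \<Longrightarrow> normalized_perm (order \<Gamma>) edges l i j =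
      conj_perm \<Gamma> (order \<Gamma>) \<gamma> \<gamma> (b (\<pi> 1) (\<pi> i) \<otimes> b (\<pi> i) (\<pi> j) \<otimes> b (\<pi> j) (\<pi> 1))" by blast
  interpret S: group "sym_group (order \<Gamma>)" by (rule sym_group_is_group)
  let ?N = "{normalized_perm (order \<Gamma>) edges l i j | i j. i \<in> {1..n} \<and> j \<in> {1..n} \<and> i \<noteq> j}"
  show "comm_group (sym_group (order \<Gamma>) \<lparr>carrier := cover_group n (order \<Gamma>) edges l\<rparr>)"
  proof (cases "n \<ge> 1")
    case True
    note f = \<gamma>[OF True]
    have \<pi>_in: "\<pi> i \<in> {1..n}" if "i \<in> {1..n}" for i using bij_betwE[OF \<pi>] that by blast
    have "?N \<subseteq> conj_perm \<Gamma> (order \<Gamma>) \<gamma> \<gamma> ` carrier \<Gamma>"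
    proof
      fix p assume "p \<in> ?N"
      then obtain i j where "i \<in> {1..n}" "j \<in> {1..n}" "p = conj_perm \<Gamma> (order \<Gamma>) \<gamma> \<gamma>
        (b (\<pi> 1) (\<pi> i) \<otimes> b (\<pi> i) (\<pi> j) \<otimes> b (\<pi> j) (\<pi> 1))" using norm by blast
      moreover have "1 \<in> {1..n}" using True by simp
      ultimately show "p \<in> conj_perm \<Gamma> (order \<Gamma>) \<gamma> \<gamma> ` carrier \<Gamma>" using \<pi>_in by (simp only:) (intro imageI m_closed gain_closed \<pi>_in)
    qed
    then show ?thesis unfolding cover_group_def
      by (rule S.comm_group_generate[OF conj_perm_subgroup[OF f]])
        (auto simp: sym_group_mult conj_perm_comp[OF f f f] m_comm)
  next
    case False
    then have "?N \<subseteq> {\<one>\<^bsub>sym_group (order \<Gamma>)\<^esub>}" by auto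
    then show ?thesis unfolding cover_group_def
      by (rule S.comm_group_generate[OF S.triv_subgroup]) auto
  qed
qed

text \<open>As \<open>c g\<close> counts the representations \<open>g = b i k \<otimes> b k j \<otimes> b j i\<close>, every non-identity element is
  one of the generators.\<close>

lemma regular:
  assumes n: "n \<ge> 2" and params: "roux_params \<Gamma> n B c"
    and nz: "\<And>g. g \<in> carrier \<Gamma> \<Longrightarrow> g \<noteq> \<one> \<Longrightarrow> c g \<noteq> 0"
  shows "regular_cover n (order \<Gamma>) verts edges fibres"
  unfolding regular_cover_def
proof (intro conjI allI impI cover)
  fix l assume "cover_labelling n (order \<Gamma>) fibres l"
  from normalized_perm_gain[OF this] n obtain \<pi> \<gamma> where \<pi>: "bij_betw \<pi> {1..n} {1..n}"
    and f: "bij_betw \<gamma> {1..order \<Gamma>} (carrier \<Gamma>)"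
    and norm: "\<And>i j. i \<in> {1..n} \<Longrightarrow> j \<in> {1..n} \<Longrightarrow> i \<noteq> j \<Longrightarrow> normalized_perm (order \<Gamma>) edges l i j =
      conj_perm \<Gamma> (order \<Gamma>) \<gamma> \<gamma> (b (\<pi> 1) (\<pi> i) \<otimes> b (\<pi> i) (\<pi> j) \<otimes> b (\<pi> j) (\<pi> 1))"
    by (metis One_nat_def Suc_leD numeral_2_eq_2)
  interpret S: group "sym_group (order \<Gamma>)" by (rule sym_group_is_group)
  let ?N = "{normalized_perm (order \<Gamma>) edges l i j | i j. i \<in> {1..n} \<and> j \<in> {1..n} \<and> i \<noteq> j}"
  let ?\<rho> = "conj_perm \<Gamma> (order \<Gamma>) \<gamma> \<gamma>"
  have \<pi>_in: "\<pi> i \<in> {1..n}" if "i \<in> {1..n}" for i using bij_betwE[OF \<pi>] that by blast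
  have one: "1 \<in> {1..n}" "2 \<in> {1..n}" using n by auto
  have "cover_group n (order \<Gamma>) edges l = ?\<rho> ` carrier \<Gamma>"
  proof (intro subset_antisym subsetI)
    have "?N \<subseteq> ?\<rho> ` carrier \<Gamma>"
    proof
      fix p assume "p \<in> ?N"
      then obtain i j where "i \<in> {1..n}" "j \<in> {1..n}" "p = ?\<rho> (b (\<pi> 1) (\<pi> i) \<otimes> b (\<pi> i) (\<pi> j) \<otimes> b (\<pi> j) (\<pi> 1))"
        using norm by blast
      then show "p \<in> ?\<rho> ` carrier \<Gamma>" using one by (simp only:) (intro imageI m_closed gain_closed \<pi>_in)
    qed
    then have "cover_group n (order \<Gamma>) edges l \<subseteq> ?\<rho> ` carrier \<Gamma>" unfolding cover_group_def
      by (rule S.generate_subgroup_incl[OF _ conj_perm_subgroup[OF f]])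
    then show "p \<in> ?\<rho> ` carrier \<Gamma>" if "p \<in> cover_group n (order \<Gamma>) edges l" for p using that by blast
  next
    fix p assume "p \<in> ?\<rho> ` carrier \<Gamma>"
    then obtain g where g: "g \<in> carrier \<Gamma>" "p = ?\<rho> g" by blast
    show "p \<in> cover_group n (order \<Gamma>) edges l"
    proof (cases "g = \<one>")
      case True
      then have "p = \<one>\<^bsub>sym_group (order \<Gamma>)\<^esub>" using g f by (simp add: conj_perm_one sym_group_one)
      then show ?thesis unfolding cover_group_def using generate.one by blast
    next
      case False
      \<comment> \<open>The nonzero parameter at \<open>g\<close> supplies an index \<open>k\<close>
        with \<open>b i k \<otimes> b k j = g \<otimes> b i j\<close>. Closing this path by
        \<open>b j i\<close> exhibits \<open>g\<close> as the gain of the normalized block (k', 2),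
        where \<open>k'\<close> labels the fibre \<open>k\<close>.\<close>
      define i j where "i = \<pi> 1" and "j = \<pi> 2"
      have ij: "i \<in> {1..n}" "j \<in> {1..n}" using \<pi>_in one by (simp_all only: i_def j_def)
      have "i \<noteq> j"
      proof
        assume "i = j"
        then have "(1::nat) = 2" unfolding i_def j_def
          by (rule inj_onD[OF bij_betw_imp_inj_on[OF \<pi>] _ one])
        then show False by simp
      qed
      have "c g = of_nat (card (paths i j (g \<otimes> b i j)))"
        using params[unfolded roux_params_iff] ij \<open>i \<noteq> j\<close> g(1) by blast
      then have "paths i j (g \<otimes> b i j) \<noteq> {}" using nz[OF g(1) False] by auto
      then obtain k where k: "k \<in> {1..n}" "k \<noteq> i" "k \<noteq> j" "b i k \<otimes> b k j = g \<otimes> b i j"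
        unfolding paths_def by blast
      then obtain k' where k': "k' \<in> {1..n}" "k = \<pi> k'" using \<pi> unfolding bij_betw_def by blast
      have "g = b i k \<otimes> b k j \<otimes> b j i" using k(4) g(1) ij gain_inv[of i j] by (simp add: m_assoc)
      then have "p = ?\<rho> (b i k \<otimes> b k j \<otimes> b j i)" unfolding g(2) by (rule arg_cong)
      moreover have "k' \<noteq> 2" using k(3) k'(2) unfolding j_def by blast
      ultimately have "p = normalized_perm (order \<Gamma>) edges l k' 2"
        by (simp only: norm[OF k'(1) one(2)] i_def j_def k'(2) not_False_eq_True)
      then have "p \<in> ?N" using k'(1) one(2) \<open>k' \<noteq> 2\<close> by blast
      then show ?thesis unfolding cover_group_def by (rule generate.incl)
    qed
  qed
  moreover have "\<exists>!p. p \<in> ?\<rho> ` carrier \<Gamma> \<and> p a = a'" if a: "a \<in> {1..order \<Gamma>}" "a' \<in> {1..order \<Gamma>}" for a a'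
  proof -
    have \<gamma>_in: "\<gamma> a \<in> carrier \<Gamma>" "\<gamma> a' \<in> carrier \<Gamma>" using bij_betwE[OF f] a by blast+
    \<comment> \<open>A translation is determined by a single value, as usual for a regular
      action.\<close>
    have "x = \<gamma> a' \<otimes> inv (\<gamma> a)" if "x \<in> carrier \<Gamma>" "?\<rho> x a = a'" for x
      using conj_perm_apply(2)[OF f f that(1) a(1)] that \<gamma>_in inv_solve_right[of x "\<gamma> a'" "\<gamma> a"] by simp
    moreover have "?\<rho> (\<gamma> a' \<otimes> inv (\<gamma> a)) a = a'"
      by (rule conj_perm_eqI[OF f a]) (use \<gamma>_in in \<open>simp add: m_assoc\<close>)
    ultimately show ?thesis using \<gamma>_in by (intro ex1I[of _ "?\<rho> (\<gamma> a' \<otimes> inv (\<gamma> a))"]) auto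
  qed
  ultimately show "\<forall>a\<in>{1..order \<Gamma>}. \<forall>a'\<in>{1..order \<Gamma>}. \<exists>!p. p \<in> cover_group n (order \<Gamma>) edges l \<and> p a = a'"
    by simp
qed

end

section \<open>From covers to gain matrices\<close>

context complete_cover_graph
begin

text \<open>Let \<open>w\<close> be the fibremate of \<open>u\<close> adjacent to \<open>v\<close>.
  Its distance m from \<open>u\<close> is the diameter, and \<open>v\<close> is neither a fibremate
  of \<open>u\<close> nor adjacent to \<open>u\<close>, so 2 \<le> d(u, v) < m. It remains to bound
  m by 3, which a fibremate of \<open>u\<close> reached by a walk of length 3 achieves.\<close>

lemma antipodal_gdist_eq_2:
  assumes anti: "antipodal_with V E \<F>" and uv: "u \<in> V" "v \<in> V" "\<not> same_fibre u v" "(u, v) \<notin> E"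
  shows "gdist E u v = 2"
proof -
  have diam: "gdist E x y = gdiameter V E \<longleftrightarrow> same_fibre x y" if "x \<in> V" "y \<in> V" "x \<noteq> y" for x y
    using anti that unfolding antipodal_with_def same_fibre_def by blast
  have le_diam: "gdist E x y \<le> gdiameter V E" if "x \<in> V" "y \<in> V" for x y
    unfolding gdiameter_def using that by (intro Sup_upper CollectI exI[of _ x] exI[of _ y]) simp
  obtain w where w: "w \<in> V" "same_fibre u w" "(v, w) \<in> E"
    using nbr_ex[OF uv(2,1)] uv(3) same_fibre_sym by blast
  have "u \<noteq> w" using w(3) uv(4) edge_commute[of v w] by blast
  then have uw: "gdist E u w = gdiameter V E" using diam[OF uv(1) w(1)] w(2) by blast
  obtain m where m: "gdist E u w = enat m"
    using anti uv(1) w(1) unfolding antipodal_with_def connected_graph_def by (metis not_enat_eq)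
  have m_min: "m \<le> k" if "(u, w) \<in> E ^^ k" for k
  proof -
    have "gdist E u w \<le> enat k" unfolding gdist_le_iff using that by blast
    then show ?thesis by (simp add: m)
  qed
  have walk: "(u, w) \<in> E ^^ m"
  proof -
    have "gdist E u w \<le> enat m" by (simp add: m)
    then obtain k where "k \<le> m" "(u, w) \<in> E ^^ k" unfolding gdist_le_iff by blast
    then show ?thesis using m_min[of k] by simp
  qed
  have "u \<noteq> v" using uv same_fibre_refl by blast
  then have "gdist E u v \<noteq> enat m" using diam[OF uv(1,2)] uv(3) uw m by simp
  moreover have "gdist E u v \<le> enat m" using le_diam[OF uv(1,2)] uw m by simp
  ultimately obtain k where k: "gdist E u v = enat k" "k < m" by (cases "gdist E u v") auto
  have "gdist E u v \<noteq> 0" "gdist E u v \<noteq> 1"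
    using \<open>u \<noteq> v\<close> uv(4) by (simp_all add: gdist_eq_0_iff gdist_eq_1_iff)
  then have "k \<noteq> 0" "k \<noteq> 1" unfolding k by (simp_all add: zero_enat_def one_enat_def)
  then have m3: "m \<ge> 3" using k(2) by linarith
  have "m \<le> 3"
  proof -
    \<comment> \<open>Let \<open>x\<close> be the vertex after two steps of a shortest walk to
      \<open>w\<close>. It is too close to \<open>u\<close> to be a fibremate, so it has a neighbour
      \<open>y\<close> in the fibre of \<open>u\<close>. If \<open>y\<close> were \<open>u\<close>,
      then \<open>x\<close> would be adjacent to \<open>u\<close> and the walk could be shortened;
      hence d(u, y) = m, while \<open>y\<close> is three steps away.\<close>
    have "m = 2 + (m - 2)" using m3 by simp
    with walk have "(u, w) \<in> E ^^ (2 + (m - 2))" by (simp only:)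
    then obtain x where x: "(u, x) \<in> E ^^ 2" "(x, w) \<in> E ^^ (m - 2)" unfolding relpow_add by blast
    then obtain z where z: "(u, z) \<in> E" "(z, x) \<in> E" unfolding relpow_2_iff by blast
    then have "x \<in> V" using edges_V by blast
    have "x \<noteq> u"
    proof
      assume "x = u"
      then have "m \<le> m - 2" using x(2) m_min by blast
      then show False using m3 by linarith
    qed
    have nsf: "\<not> same_fibre u x"
    proof
      assume "same_fibre u x"
      then have "gdist E u x = enat m" using diam[OF uv(1) \<open>x \<in> V\<close>] \<open>x \<noteq> u\<close> uw m by simp
      moreover have "gdist E u x \<le> enat 2" unfolding gdist_le_iff using x(1) by blast
      ultimately show False using m3 by simp
    qed
    obtain y where y: "y \<in> V" "same_fibre u y" "(x, y) \<in> E"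
      using nbr_ex[OF \<open>x \<in> V\<close> uv(1)] nsf same_fibre_sym by blast
    have "y \<noteq> u"
    proof
      assume "y = u"
      then have "(u, x) \<in> E" using y(3) edge_commute[of x] by blast
      then have "(u, w) \<in> E ^^ Suc (m - 2)" using x(2) by (rule relpow_Suc_I2)
      then have "m \<le> Suc (m - 2)" by (rule m_min)
      then show False using m3 by linarith
    qed
    then have "gdist E u y = enat m" using diam[OF uv(1) y(1)] y(2) uw m by simp
    moreover have "(u, y) \<in> E ^^ Suc 2" using x(1) y(3) by (rule relpow_Suc_I)
    then have "gdist E u y \<le> enat (Suc 2)" unfolding gdist_le_iff by blast
    ultimately show ?thesis by simp
  qed
  then have "k = 2" using k(2) \<open>k \<noteq> 0\<close> \<open>k \<noteq> 1\<close> by linarith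
  then show ?thesis using k(1) by (simp add: numeral_eq_enat)
qed

text \<open>Regular and abelian covers are defined by a condition on all labellings; information is
  gained from it by instantiating one.\<close>

lemma cover_labelling_ex: "\<exists>l. cover_labelling n r \<F> l"
proof -
  obtain e where e: "bij_betw e {1..n} \<F>"
    using ex_bij_betw_nat_finite_1[OF finite_fibres] card_fibres by blast
  define f where "f F = (SOME f. bij_betw f {1..r} F)" for F :: "'v set"
  have f: "bij_betw (f F) {1..r} F" if "F \<in> \<F>" for F
  proof -
    have "\<exists>f. bij_betw f {1..r} F"
      using ex_bij_betw_nat_finite_1[OF finite_fibre[OF that]] card_fibre[OF that] by simp
    then show ?thesis unfolding f_def by (rule someI_ex)
  qed
  have e_in: "e i \<in> \<F>" if "i \<in> {1..n}" for i using bij_betwE[OF e] that by blast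
  have "f (e i) ` {1..r} = e i" if "i \<in> {1..n}" for i
    using f[OF e_in[OF that]] by (rule bij_betw_imp_surj_on)
  then have "bij_betw (\<lambda>i. f (e i) ` {1..r}) {1..n} \<F>"
    using e bij_betw_cong[of "{1..n}" e "\<lambda>i. f (e i) ` {1..r}"] by simp
  moreover have "inj_on (f (e i)) {1..r}" if "i \<in> {1..n}" for i
    using f[OF e_in[OF that]] by (rule bij_betw_imp_inj_on)
  ultimately show ?thesis unfolding cover_labelling_def by (intro exI[of _ "\<lambda>i. f (e i)"]) blast
qed

end

section \<open>Blocks of a labelled cover\<close>

locale labelled_cover = complete_cover_graph +
  fixes l :: "nat \<Rightarrow> nat \<Rightarrow> 'a"
  assumes labelling: "cover_labelling n r \<F> l"
begin

lemma label_fibre: "i \<in> {1..n} \<Longrightarrow> l i ` {1..r} \<in> \<F>"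
  using labelling bij_betwE unfolding cover_labelling_def by blast

lemma label_in: "i \<in> {1..n} \<Longrightarrow> a \<in> {1..r} \<Longrightarrow> l i a \<in> V"
  using label_fibre fibre_subset by blast

lemma label_inj: "i \<in> {1..n} \<Longrightarrow> a \<in> {1..r} \<Longrightarrow> a' \<in> {1..r} \<Longrightarrow> l i a = l i a' \<Longrightarrow> a = a'"
  using labelling unfolding cover_labelling_def inj_on_def by blast

lemma label_same_fibre:
  assumes "i \<in> {1..n}" "j \<in> {1..n}" "a \<in> {1..r}" "a' \<in> {1..r}"
  shows "same_fibre (l i a) (l j a') \<longleftrightarrow> i = j"
proof
  assume "i = j"
  then show "same_fibre (l i a) (l j a')" using label_fibre[OF assms(1)] assms unfolding same_fibre_def by blast
next
  assume "same_fibre (l i a) (l j a')"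
  then obtain F where F: "F \<in> \<F>" "l i a \<in> F" "l j a' \<in> F" unfolding same_fibre_def by blast
  have "l i ` {1..r} = F" by (rule fibre_unique[OF label_fibre[OF assms(1)] F(1) _ F(2)]) (use assms in blast)
  moreover have "l j ` {1..r} = F" by (rule fibre_unique[OF label_fibre[OF assms(2)] F(1) _ F(3)]) (use assms in blast)
  moreover have "inj_on (\<lambda>i. l i ` {1..r}) {1..n}"
    using labelling unfolding cover_labelling_def bij_betw_def by blast
  ultimately show "i = j" using assms(1,2) unfolding inj_on_def by blast
qed

lemma label_surj:
  assumes "v \<in> V"
  obtains i a where "i \<in> {1..n}" "a \<in> {1..r}" "v = l i a"
proof -
  obtain F where F: "F \<in> \<F>" "v \<in> F" using fibre_ex assms by blast
  have "(\<lambda>i. l i ` {1..r}) ` {1..n} = \<F>"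
    using labelling unfolding cover_labelling_def bij_betw_def by blast
  then obtain i where "i \<in> {1..n}" "F = l i ` {1..r}" using F(1) by blast
  then show ?thesis using F(2) that by blast
qed

abbreviation "block \<equiv> block_perm r E l"

lemma block_iff:
  assumes "i \<in> {1..n}" "j \<in> {1..n}" "i \<noteq> j" "a \<in> {1..r}"
  shows "block i j a \<in> {1..r}"
    and "a' \<in> {1..r} \<Longrightarrow> (l i a', l j a) \<in> E \<longleftrightarrow> a' = block i j a"
proof -
  have nsf: "\<not> same_fibre (l j a) (l i 1)" if "1 \<in> {1..r}" using label_same_fibre that assms by metis
  have r: "1 \<in> {1..r}" using assms(4) by simp
  obtain v where v: "v \<in> V" "same_fibre (l i 1) v" "(l j a, v) \<in> E"
    using nbr_ex[OF label_in label_in nsf] assms r by blast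
  obtain i' a1 where a1: "i' \<in> {1..n}" "a1 \<in> {1..r}" "v = l i' a1" using label_surj[OF v(1)] .
  then have "i' = i" using v(2) label_same_fibre[OF assms(1) a1(1) r a1(2)] by simp
  then have e: "(l i a1, l j a) \<in> E" using v(3) a1(3) edge_commute[of "l j a"] by simp
  have uniq: "a' = a1" if "a' \<in> {1..r}" "(l i a', l j a) \<in> E" for a'
  proof (rule label_inj[OF assms(1) that(1) a1(2)])
    show "l i a' = l i a1"
      by (rule nbr_unique[OF label_fibre[OF assms(1)], where u = "l j a"])
        (use that a1(2) e edge_commute[of "l j a"] in auto)
  qed
  have "(THE a'. a' \<in> {1..r} \<and> (l i a', l j a) \<in> E) = a1"
  proof (rule the_equality)
    show "a1 \<in> {1..r} \<and> (l i a1, l j a) \<in> E" using a1(2) e by (rule conjI)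
    show "a' = a1" if "a' \<in> {1..r} \<and> (l i a', l j a) \<in> E" for a' using that by (intro uniq) simp_all
  qed
  then have block: "block i j a = a1" using assms(4) by (simp add: block_perm_def)
  show "block i j a \<in> {1..r}" unfolding block by (rule a1(2))
  show "(l i a', l j a) \<in> E \<longleftrightarrow> a' = block i j a" if "a' \<in> {1..r}"
    unfolding block using uniq[OF that] e by metis
qed

lemma block_inverse:
  assumes "i \<in> {1..n}" "j \<in> {1..n}" "i \<noteq> j"
  shows "block j i \<circ> block i j = id"
proof
  fix a
  show "(block j i \<circ> block i j) a = id a"
  proof (cases "a \<in> {1..r}")
    case True
    note b = block_iff[OF assms True]
    have "(l i (block i j a), l j a) \<in> E" using b by blast
    then have "(l j a, l i (block i j a)) \<in> E" using edge_commute by blast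
    then have "a = block j i (block i j a)" using block_iff(2)[OF assms(2,1) _ b(1) True] assms(3) by blast
    then show ?thesis by simp
  qed (simp only: block_perm_def if_False o_apply id_apply)
qed

lemma block_closed:
  assumes "i \<in> {1..n}" "j \<in> {1..n}" "i \<noteq> j"
  shows "block i j \<in> carrier (sym_group r)"
proof -
  have "bij (block i j)" using block_inverse[OF assms] block_inverse[OF assms(2,1)] assms(3) by (metis o_bij)
  moreover have "block i j a = a" if "a \<notin> {1..r}" for a
    unfolding block_perm_def using that by (rule if_not_P)
  ultimately show ?thesis unfolding sym_group_carrier permutes_def bij_iff by blast
qed

lemma block_inv:
  assumes "i \<in> {1..n}" "j \<in> {1..n}" "i \<noteq> j"
  shows "block j i = inv\<^bsub>sym_group r\<^esub> (block i j)"
proof -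
  interpret S: group "sym_group r" by (rule sym_group_is_group)
  show ?thesis
    by (rule S.inv_equality[symmetric])
      (use block_inverse[OF assms] block_closed assms in \<open>simp_all add: sym_group_mult sym_group_one\<close>)
qed

abbreviation "diag \<equiv> diag_perm r E l"
abbreviation "normalized \<equiv> normalized_perm r E l"

lemma diag_closed:
  assumes "j \<in> {1..n}"
  shows "diag j \<in> carrier (sym_group r)"
proof -
  interpret S: group "sym_group r" by (rule sym_group_is_group)
  show ?thesis using assms block_closed[of 1 j] by (simp add: diag_perm_def)
qed

lemma normalized_closed:
  assumes "i \<in> {1..n}" "j \<in> {1..n}" "i \<noteq> j"
  shows "normalized i j \<in> carrier (sym_group r)"
proof -
  interpret S: group "sym_group r" by (rule sym_group_is_group)
  show ?thesis unfolding normalized_perm_def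
    by (intro S.m_closed S.inv_closed diag_closed block_closed assms)
qed

lemma normalized_inv:
  assumes "i \<in> {1..n}" "j \<in> {1..n}" "i \<noteq> j"
  shows "normalized j i = inv\<^bsub>sym_group r\<^esub> (normalized i j)"
proof -
  interpret S: group "sym_group r" by (rule sym_group_is_group)
  show ?thesis unfolding normalized_perm_def block_inv[OF assms]
    using diag_closed[OF assms(1)] diag_closed[OF assms(2)] block_closed[OF assms]
    by (simp add: S.inv_mult_group S.m_assoc del: sym_group_inv_equality)
qed

text \<open>Relabelling each fibre \<open>i\<close> by \<open>diag i\<close> replaces the blocks of
  A by those of DAD^(-1).\<close>

lemma normalized_edge_iff:
  assumes "i \<in> {1..n}" "j \<in> {1..n}" "i \<noteq> j" "a \<in> {1..r}" "a' \<in> {1..r}"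
  shows "(l i a, l j a') \<in> E \<longleftrightarrow> diag i a = normalized i j (diag j a')"
proof -
  interpret S: group "sym_group r" by (rule sym_group_is_group)
  have "inv\<^bsub>sym_group r\<^esub> (diag j) \<circ> diag j = id"
    using S.l_inv[OF diag_closed[OF assms(2)]] by (simp add: sym_group_mult sym_group_one)
  then have "(inv\<^bsub>sym_group r\<^esub> (diag j)) (diag j a') = a'" by (rule pointfree_idE)
  then have "normalized i j (diag j a') = diag i (block i j a')"
    unfolding normalized_perm_def sym_group_mult o_apply by (simp only:)
  moreover have "inj (diag i)" using diag_closed[OF assms(1)] unfolding sym_group_carrier by (rule permutes_inj)
  ultimately show ?thesis using block_iff(2)[OF assms(1-3,5,4)] by (simp add: inj_eq)
qed

end

section \<open>The sum of the parameters\<close>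

context gain_matrix
begin

text \<open>Each index other than \<open>i\<close> and \<open>j\<close> is an intermediate vertex
  for exactly one gain, and multiplication by \<open>b i j\<close> permutes the gains.\<close>

lemma sum_card_paths:
  assumes "i \<in> {1..n}" "j \<in> {1..n}" "i \<noteq> j"
  shows "(\<Sum>x\<in>carrier \<Gamma>. card (paths i j (x \<otimes> b i j))) = n - 2"
proof -
  have b: "b i j \<in> carrier \<Gamma>" using assms by simp
  have "(\<Sum>x\<in>carrier \<Gamma>. card (paths i j (x \<otimes> b i j))) = (\<Sum>y\<in>carrier \<Gamma>. card (paths i j y))"
    by (rule sum.reindex_bij_witness[where i = "\<lambda>y. y \<otimes> inv (b i j)" and j = "\<lambda>x. x \<otimes> b i j"])
      (use b in \<open>simp_all add: m_assoc\<close>)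
  also have "\<dots> = card (\<Union>y\<in>carrier \<Gamma>. paths i j y)"
    by (rule card_UN_disjoint[symmetric]) (use finite_carrier in \<open>auto simp: paths_def\<close>)
  also have "(\<Union>y\<in>carrier \<Gamma>. paths i j y) = {1..n} - {i, j}"
    using assms by (auto simp: paths_def)
  also have "card ({1..n} - {i, j}) = n - 2" using assms by (simp add: card_Diff_subset)
  finally show ?thesis .
qed

text \<open>The r - 1 non-identity elements use up c(r-1) of the n - 2 intermediate indices; the
  rest belongs to \<one>.\<close>

lemma drackn_paramsI:
  assumes count: "\<And>i j x. i \<in> {1..n} \<Longrightarrow> j \<in> {1..n} \<Longrightarrow> i \<noteq> j \<Longrightarrow> x \<in> carrier \<Gamma> \<Longrightarrow> x \<noteq> \<one> \<Longrightarrow>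
    card (paths i j (x \<otimes> b i j)) = c"
  shows "roux_params \<Gamma> n B (drackn_params \<Gamma> n (order \<Gamma>) c)"
  unfolding roux_params_iff
proof (intro ballI impI)
  fix i j x assume ij: "i \<in> {1..n}" "j \<in> {1..n}" "i \<noteq> j" and x: "x \<in> carrier \<Gamma>"
  show "drackn_params \<Gamma> n (order \<Gamma>) c x = of_nat (card (paths i j (x \<otimes> b i j)))"
  proof (cases "x = \<one>")
    case True
    let ?f = "\<lambda>x. card (paths i j (x \<otimes> b i j))"
    have n: "n \<ge> 2" using ij by auto
    have r: "order \<Gamma> \<ge> 1" using finite_carrier one_closed unfolding order_def
      by (metis One_nat_def Suc_leI card_gt_0_iff empty_iff)
    have "n - 2 = ?f \<one> + (\<Sum>x\<in>carrier \<Gamma> - {\<one>}. ?f x)"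
      using sum_card_paths[OF ij] sum.remove[OF finite_carrier one_closed, of ?f] by simp
    also have "(\<Sum>x\<in>carrier \<Gamma> - {\<one>}. ?f x) = (\<Sum>x\<in>carrier \<Gamma> - {\<one>}. c)"
      by (rule sum.cong[OF refl]) (use count[OF ij] in blast)
    also have "\<dots> = (order \<Gamma> - 1) * c" using finite_carrier by (simp add: order_def)
    finally have "n - 2 = ?f \<one> + (order \<Gamma> - 1) * c" .
    then have "(of_nat (n - 2) :: complex) = of_nat (?f \<one>) + of_nat (order \<Gamma> - 1) * of_nat c"
      by (metis of_nat_add of_nat_mult)
    then show ?thesis using True n r by (simp add: drackn_params_def of_nat_diff algebra_simps)
  qed (use count[OF ij x] in \<open>simp add: drackn_params_def\<close>)
qed

end

text \<open>Vertices of a roux graph have coordinates, so the isomorphism is easier to write from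
  the roux graph to the given cover.\<close>

lemma cover_iso_inverse:
  assumes \<psi>: "bij_betw \<psi> V' V" and edges: "\<And>u v. u \<in> V' \<Longrightarrow> v \<in> V' \<Longrightarrow> (\<psi> u, \<psi> v) \<in> E \<longleftrightarrow> (u, v) \<in> E'"
    and fibres: "(`) \<psi> ` \<F>' = \<F>" "\<And>F. F \<in> \<F>' \<Longrightarrow> F \<subseteq> V'"
  shows "cover_iso V E \<F> V' E' \<F>'"
proof -
  let ?\<phi> = "inv_into V' \<psi>"
  have inj: "inj_on \<psi> V'" using \<psi> by (rule bij_betw_imp_inj_on)
  have \<phi>: "?\<phi> u \<in> V'" "\<psi> (?\<phi> u) = u" if "u \<in> V" for u
    using that \<psi> by (auto simp: bij_betw_def inv_into_into f_inv_into_f)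
  have "(u, v) \<in> E \<longleftrightarrow> (?\<phi> u, ?\<phi> v) \<in> E'" if "u \<in> V" "v \<in> V" for u v
    using edges[OF \<phi>(1)[OF that(1)] \<phi>(1)[OF that(2)]] \<phi>(2) that by simp
  moreover have "(\<lambda>F. ?\<phi> ` F) ` \<F> = \<F>'"
  proof -
    have "?\<phi> ` \<psi> ` F = F" if "F \<in> \<F>'" for F
      using inv_into_image_cancel[OF inj fibres(2)[OF that]] .
    then have "(\<lambda>F. ?\<phi> ` \<psi> ` F) ` \<F>' = \<F>'" by simp
    then show ?thesis unfolding fibres(1)[symmetric] image_image .
  qed
  ultimately show ?thesis unfolding cover_iso_def using bij_betw_inv_into[OF \<psi>]
    by (intro exI[of _ ?\<phi>]) blast
qed

section \<open>The roux of a regular abelian cover\<close>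

locale regular_abelian_cover = labelled_cover +
  assumes regular: "regular_cover n r V E \<F>" and abelian: "abelian_cover n r V E \<F>"
    and V_nonempty: "V \<noteq> {}"
begin

text \<open>The cover group itself serves as the group of the roux, so that the normalized blocks
  are gains as they stand.\<close>

definition \<Gamma> :: "(nat \<Rightarrow> nat) monoid" where
  "\<Gamma> = sym_group r \<lparr>carrier := cover_group n r E l\<rparr>"

definition gain :: "nat \<Rightarrow> nat \<Rightarrow> nat \<Rightarrow> nat" where
  "gain i j = (if i = j then id else normalized i j)"

lemma carrier_\<Gamma>: "carrier \<Gamma> = cover_group n r E l"
  by (simp add: \<Gamma>_def)

lemma mult_\<Gamma>: "p \<otimes>\<^bsub>\<Gamma>\<^esub> q = p \<circ> q"
  by (simp add: \<Gamma>_def sym_group_mult)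

lemma one_\<Gamma>: "\<one>\<^bsub>\<Gamma>\<^esub> = id"
  by (simp add: \<Gamma>_def sym_group_one)

lemma subgroup_\<Gamma>: "subgroup (cover_group n r E l) (sym_group r)"
proof -
  interpret S: group "sym_group r" by (rule sym_group_is_group)
  show ?thesis unfolding cover_group_def
    by (rule S.generate_is_subgroup) (use normalized_closed in blast)
qed

lemma comm_group_\<Gamma>: "comm_group \<Gamma>"
  using abelian labelling unfolding abelian_cover_def \<Gamma>_def by blast

lemma carrier_permutes: "p \<in> carrier \<Gamma> \<Longrightarrow> p permutes {1..r}"
  using subgroup.subset[OF subgroup_\<Gamma>] unfolding carrier_\<Gamma> by (auto simp: sym_group_carrier)

lemma finite_\<Gamma>: "finite (carrier \<Gamma>)"
proof (rule finite_subset)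
  show "carrier \<Gamma> \<subseteq> {p. p permutes {1..r}}" using carrier_permutes by blast
  show "finite {p. p permutes {1..r}}" by (rule finite_permutations) simp
qed

lemma one_in: "1 \<in> {1..r}"
proof -
  obtain v where "v \<in> V" using V_nonempty by blast
  from label_surj[OF this] obtain i a where "i \<in> {1..n}" "a \<in> {1..r}" "v = l i a" .
  then show ?thesis by simp
qed

text \<open>Regularity at the base point 1: evaluation there identifies the group with the set of
  labels.\<close>

lemma ex1_perm: "a \<in> {1..r} \<Longrightarrow> \<exists>!p. p \<in> carrier \<Gamma> \<and> p 1 = a"
  using regular labelling one_in unfolding regular_cover_def carrier_\<Gamma> by blast

lemma perm_eq:
  assumes "p \<in> carrier \<Gamma>" "q \<in> carrier \<Gamma>" "p 1 = q 1"
  shows "p = q"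
proof -
  have "p 1 \<in> {1..r}" using permutes_in_image[OF carrier_permutes[OF assms(1)]] one_in by blast
  from ex1_perm[OF this] assms show ?thesis by auto
qed

lemma order_\<Gamma>: "order \<Gamma> = r"
proof -
  have "bij_betw (\<lambda>p. p 1) (carrier \<Gamma>) {1..r}"
  proof (rule bij_betw_imageI)
    show "inj_on (\<lambda>p. p 1) (carrier \<Gamma>)" using perm_eq by (intro inj_onI)
    show "(\<lambda>p. p 1) ` carrier \<Gamma> = {1..r}"
    proof (intro subset_antisym subsetI)
      fix a assume "a \<in> (\<lambda>p. p 1) ` carrier \<Gamma>"
      then obtain p where "p \<in> carrier \<Gamma>" "a = p 1" by blast
      then show "a \<in> {1..r}" using permutes_in_image[OF carrier_permutes] one_in by blast
    next
      fix a assume "a \<in> {1..r}"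
      from ex1_implies_ex[OF ex1_perm[OF this]] show "a \<in> (\<lambda>p. p 1) ` carrier \<Gamma>" by blast
    qed
  qed
  from bij_betw_same_card[OF this] show ?thesis by (simp add: order_def)
qed

lemma normalized_in: "i \<in> {1..n} \<Longrightarrow> j \<in> {1..n} \<Longrightarrow> i \<noteq> j \<Longrightarrow> normalized i j \<in> carrier \<Gamma>"
  unfolding carrier_\<Gamma> cover_group_def by (rule generate.incl) blast

lemma gain_matrix: "gain_matrix \<Gamma> n gain"
proof -
  interpret S: group "sym_group r" by (rule sym_group_is_group)
  interpret comm_group \<Gamma> by (rule comm_group_\<Gamma>)
  show ?thesis
  proof unfold_locales
    show "finite (carrier \<Gamma>)" by (rule finite_\<Gamma>)
    fix i j assume ij: "i \<in> {1..n}" "j \<in> {1..n}"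
    show "gain i j \<in> carrier \<Gamma>"
    proof (cases "i = j")
      case True
      then show ?thesis using one_closed by (simp add: gain_def one_\<Gamma>)
    qed (use normalized_in ij in \<open>simp add: gain_def\<close>)
    show "gain j i = inv\<^bsub>\<Gamma>\<^esub> (gain i j)"
    proof (cases "i = j")
      case True
      then show ?thesis using inv_one by (simp add: gain_def one_\<Gamma>)
    next
      case False
      have "inv\<^bsub>\<Gamma>\<^esub> (normalized i j) = inv\<^bsub>sym_group r\<^esub> (normalized i j)" unfolding \<Gamma>_def
        by (rule S.m_inv_consistent[OF subgroup_\<Gamma>]) (use normalized_in[OF ij False] in \<open>simp add: carrier_\<Gamma>\<close>)
      then show ?thesis unfolding gain_def using False normalized_inv[OF ij False] by (simp only: if_False) simp
    qed
  qed (simp add: gain_def one_\<Gamma>)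
qed

sublocale gain: gain_matrix \<Gamma> n gain
  by (rule gain_matrix)

text \<open>The label \<open>p 1\<close> refers to the normalized labelling; undoing
  \<open>diag i\<close> returns to the labels of \<open>l\<close>.\<close>

definition vertex :: "nat \<times> (nat \<Rightarrow> nat) \<Rightarrow> 'a" where
  "vertex = (\<lambda>(i, p). l i (inv_into UNIV (diag i) (p 1)))"

lemma diag_permutes: "i \<in> {1..n} \<Longrightarrow> diag i permutes {1..r}"
  using diag_closed unfolding sym_group_carrier .

lemma vertex_label:
  assumes "i \<in> {1..n}" "p \<in> carrier \<Gamma>"
  obtains a where "a \<in> {1..r}" "diag i a = p 1" "vertex (i, p) = l i a"
proof
  let ?a = "inv_into UNIV (diag i) (p 1)"
  note d = diag_permutes[OF assms(1)]
  have "p 1 \<in> {1..r}" using permutes_in_image[OF carrier_permutes[OF assms(2)]] one_in by blast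
  then show "?a \<in> {1..r}" using permutes_in_image[OF permutes_inv[OF d]] by blast
  show "diag i ?a = p 1" by (rule permutes_inverses(1)[OF d])
  show "vertex (i, p) = l i ?a" by (simp add: vertex_def)
qed

lemma vertex_of_label:
  assumes "i \<in> {1..n}" "a \<in> {1..r}"
  obtains p where "p \<in> carrier \<Gamma>" "vertex (i, p) = l i a"
proof -
  note d = diag_permutes[OF assms(1)]
  have "diag i a \<in> {1..r}" using permutes_in_image[OF d] assms(2) by blast
  then obtain p where p: "p \<in> carrier \<Gamma>" "p 1 = diag i a" using ex1_perm by blast
  then have "vertex (i, p) = l i a" by (simp add: vertex_def permutes_inverses(2)[OF d])
  with p(1) show ?thesis using that by blast
qed

lemma vertex_same_fibre:
  assumes "i \<in> {1..n}" "p \<in> carrier \<Gamma>" "j \<in> {1..n}" "q \<in> carrier \<Gamma>"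
  shows "same_fibre (vertex (i, p)) (vertex (j, q)) \<longleftrightarrow> i = j"
proof -
  obtain a where a: "a \<in> {1..r}" "vertex (i, p) = l i a" using vertex_label[OF assms(1,2)] .
  obtain a' where a': "a' \<in> {1..r}" "vertex (j, q) = l j a'" using vertex_label[OF assms(3,4)] .
  show ?thesis unfolding a(2) a'(2) by (rule label_same_fibre[OF assms(1,3) a(1) a'(1)])
qed

lemma vertex_in:
  assumes "i \<in> {1..n}" "p \<in> carrier \<Gamma>"
  shows "vertex (i, p) \<in> V"
proof -
  obtain a where a: "a \<in> {1..r}" "vertex (i, p) = l i a" using vertex_label[OF assms] .
  show ?thesis unfolding a(2) by (rule label_in[OF assms(1) a(1)])
qed

text \<open>In normalized labels adjacency compares \<open>p\<close> with
  \<open>normalized i j \<otimes> q\<close> at the base point only; regularity upgrades this to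
  equality of permutations, which is adjacency in the roux graph.\<close>

lemma vertex_edge_iff:
  assumes "i \<in> {1..n}" "p \<in> carrier \<Gamma>" "j \<in> {1..n}" "q \<in> carrier \<Gamma>"
  shows "(vertex (i, p), vertex (j, q)) \<in> E \<longleftrightarrow> ((i, p), (j, q)) \<in> gain.edges"
proof (cases "i = j")
  case True
  then have "same_fibre (vertex (i, p)) (vertex (j, q))" using vertex_same_fibre assms by blast
  then show ?thesis using same_fibre_no_edge True by (simp add: gain.edge_iff)
next
  case False
  obtain a where a: "a \<in> {1..r}" "diag i a = p 1" "vertex (i, p) = l i a"
    using vertex_label[OF assms(1,2)] .
  obtain a' where a': "a' \<in> {1..r}" "diag j a' = q 1" "vertex (j, q) = l j a'"
    using vertex_label[OF assms(3,4)] .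
  have m: "normalized i j \<otimes>\<^bsub>\<Gamma>\<^esub> q \<in> carrier \<Gamma>"
    using normalized_in[OF assms(1,3) False] assms(4) by (rule gain.m_closed)
  have "(vertex (i, p), vertex (j, q)) \<in> E \<longleftrightarrow> p 1 = normalized i j (q 1)"
    unfolding a(3) a'(3) normalized_edge_iff[OF assms(1,3) False a(1) a'(1)] a(2) a'(2) ..
  also have "\<dots> \<longleftrightarrow> p = normalized i j \<otimes>\<^bsub>\<Gamma>\<^esub> q"
    using perm_eq[OF assms(2) m] by (auto simp: mult_\<Gamma>)
  also have "\<dots> \<longleftrightarrow> ((i, p), (j, q)) \<in> gain.edges"
    using assms False by (simp add: gain.edge_iff gain_def)
  finally show ?thesis .
qed

lemma vertex_bij: "bij_betw vertex gain.verts V"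
proof (rule bij_betw_imageI)
  show "inj_on vertex gain.verts"
  proof (rule inj_onI)
    fix u v assume uv: "u \<in> gain.verts" "v \<in> gain.verts" "vertex u = vertex v"
    obtain i p j q where ij: "u = (i, p)" "v = (j, q)" by (metis surj_pair)
    have *: "i \<in> {1..n}" "p \<in> carrier \<Gamma>" "j \<in> {1..n}" "q \<in> carrier \<Gamma>"
      using uv(1,2) unfolding ij roux_verts_def by blast+
    have "same_fibre (vertex (i, p)) (vertex (j, q))"
      using uv(3) same_fibre_refl[OF vertex_in[OF *(1,2)]] unfolding ij by simp
    then have "i = j" using vertex_same_fibre[OF *] by blast
    obtain a where a: "a \<in> {1..r}" "diag i a = p 1" "vertex (i, p) = l i a"
      using vertex_label[OF *(1,2)] .
    obtain a' where a': "a' \<in> {1..r}" "diag j a' = q 1" "vertex (j, q) = l j a'"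
      using vertex_label[OF *(3,4)] .
    have "l i a = l i a'" using uv(3)[unfolded ij a(3) a'(3)] \<open>i = j\<close> by simp
    then have "a = a'" by (rule label_inj[OF *(1) a(1) a'(1)])
    then have "p 1 = q 1" using a(2) a'(2) \<open>i = j\<close> by simp
    then show "u = v" using perm_eq[OF *(2,4)] \<open>i = j\<close> ij by simp
  qed
  show "vertex ` gain.verts = V"
  proof (intro subset_antisym subsetI)
    fix v assume "v \<in> vertex ` gain.verts"
    then show "v \<in> V" using vertex_in unfolding roux_verts_def by blast
  next
    fix v assume "v \<in> V"
    from label_surj[OF this] obtain i a where ia: "i \<in> {1..n}" "a \<in> {1..r}" "v = l i a" .
    from vertex_of_label[OF ia(1,2)] obtain p where "p \<in> carrier \<Gamma>" "vertex (i, p) = l i a" .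
    then show "v \<in> vertex ` gain.verts" using ia unfolding roux_verts_def by (intro image_eqI[of _ _ "(i, p)"]) auto
  qed
qed

lemma vertex_fibres: "(`) vertex ` gain.fibres = \<F>"
proof -
  have "vertex ` ({i} \<times> carrier \<Gamma>) = l i ` {1..r}" if i: "i \<in> {1..n}" for i
  proof (intro subset_antisym subsetI)
    fix v assume "v \<in> vertex ` ({i} \<times> carrier \<Gamma>)"
    then obtain p where p: "p \<in> carrier \<Gamma>" "v = vertex (i, p)" by blast
    from vertex_label[OF i p(1)] obtain a where "a \<in> {1..r}" "vertex (i, p) = l i a" .
    then show "v \<in> l i ` {1..r}" using p(2) by simp
  next
    fix v assume "v \<in> l i ` {1..r}"
    then obtain a where a: "a \<in> {1..r}" "v = l i a" by blast
    from vertex_of_label[OF i a(1)] obtain p where "p \<in> carrier \<Gamma>" "vertex (i, p) = l i a" .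
    then show "v \<in> vertex ` ({i} \<times> carrier \<Gamma>)" using a(2) by (intro image_eqI[of _ _ "(i, p)"]) auto
  qed
  then have "(`) vertex ` gain.fibres = (\<lambda>i. l i ` {1..r}) ` {1..n}"
    unfolding roux_fibres_def image_image by (intro image_cong refl)
  also have "\<dots> = \<F>" using labelling unfolding cover_labelling_def bij_betw_def by blast
  finally show ?thesis .
qed

lemma cover_iso_roux: "cover_iso V E \<F> gain.verts gain.edges gain.fibres"
proof (rule cover_iso_inverse[OF vertex_bij _ vertex_fibres])
  fix u v assume "u \<in> gain.verts" "v \<in> gain.verts"
  then show "(vertex u, vertex v) \<in> E \<longleftrightarrow> (u, v) \<in> gain.edges"
    unfolding roux_verts_def by (elim SigmaE) (simp only: vertex_edge_iff)
qed (auto simp: roux_fibres_def roux_verts_def)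

lemma common_nbrs_vertex:
  assumes "u \<in> gain.verts" "v \<in> gain.verts"
  shows "card {w \<in> gain.verts. (u, w) \<in> gain.edges \<and> (v, w) \<in> gain.edges} =
    card {w \<in> V. (vertex u, w) \<in> E \<and> (vertex v, w) \<in> E}"
proof -
  have edge: "(vertex u, vertex w) \<in> E \<longleftrightarrow> (u, w) \<in> gain.edges" if "u \<in> gain.verts" "w \<in> gain.verts" for u w
    using that unfolding roux_verts_def by (elim SigmaE) (simp only: vertex_edge_iff)
  have img: "vertex ` {w \<in> gain.verts. (u, w) \<in> gain.edges \<and> (v, w) \<in> gain.edges} =
    {w \<in> V. (vertex u, w) \<in> E \<and> (vertex v, w) \<in> E}"
  proof (intro subset_antisym subsetI)
    fix w assume "w \<in> vertex ` {w \<in> gain.verts. (u, w) \<in> gain.edges \<and> (v, w) \<in> gain.edges}"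
    then obtain x where "x \<in> gain.verts" "w = vertex x" "(u, x) \<in> gain.edges" "(v, x) \<in> gain.edges" by blast
    then show "w \<in> {w \<in> V. (vertex u, w) \<in> E \<and> (vertex v, w) \<in> E}"
      using edge assms bij_betwE[OF vertex_bij] by simp
  next
    fix w assume w: "w \<in> {w \<in> V. (vertex u, w) \<in> E \<and> (vertex v, w) \<in> E}"
    then obtain x where "x \<in> gain.verts" "w = vertex x"
      using bij_betw_imp_surj_on[OF vertex_bij] by blast
    then show "w \<in> vertex ` {w \<in> gain.verts. (u, w) \<in> gain.edges \<and> (v, w) \<in> gain.edges}"
      using w edge assms by simp
  qed
  have "inj_on vertex {w \<in> gain.verts. (u, w) \<in> gain.edges \<and> (v, w) \<in> gain.edges}"
    by (rule inj_on_subset[OF bij_betw_imp_inj_on[OF vertex_bij]]) blast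
  from card_image[OF this] show ?thesis unfolding img by (rule sym)
qed

lemma drackn_gain_params:
  assumes "drackn n r c V E \<F>"
  shows "roux_params \<Gamma> n gain.B (drackn_params \<Gamma> n r c)"
proof -
  have anti: "antipodal_with V E \<F>" using assms by (simp add: drackn_def antipodal_cover_def)
  have "roux_params \<Gamma> n gain.B (drackn_params \<Gamma> n (order \<Gamma>) c)"
  proof (rule gain.drackn_paramsI)
    fix i j x assume ij: "i \<in> {1..n}" "j \<in> {1..n}" "i \<noteq> j" and x: "x \<in> carrier \<Gamma>" "x \<noteq> \<one>\<^bsub>\<Gamma>\<^esub>"
    \<comment> \<open>The vertices \<open>(i, ?g)\<close> and \<open>(j, \<one>)\<close> are chosen
      so that the index of their parameter is \<open>x\<close>. As \<open>x\<close> is not \<one>,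
      they are non-adjacent and hence at distance 2.\<close>
    let ?g = "x \<otimes>\<^bsub>\<Gamma>\<^esub> gain i j"
    have g: "?g \<in> carrier \<Gamma>" using x ij by simp
    have uv: "(i, ?g) \<in> gain.verts" "(j, \<one>\<^bsub>\<Gamma>\<^esub>) \<in> gain.verts"
      using ij g by (simp_all add: roux_verts_def)
    have "?g \<otimes>\<^bsub>\<Gamma>\<^esub> inv\<^bsub>\<Gamma>\<^esub> \<one>\<^bsub>\<Gamma>\<^esub> \<otimes>\<^bsub>\<Gamma>\<^esub> gain j i = x"
      using x ij gain.gain_inv[of i j] by (simp add: gain.m_assoc)
    then have "((i, ?g), (j, \<one>\<^bsub>\<Gamma>\<^esub>)) \<notin> gain.edges"
      using gain.edge_iff_gain_one[OF uv ij(3)] x(2) by simp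
    then have "(vertex (i, ?g), vertex (j, \<one>\<^bsub>\<Gamma>\<^esub>)) \<notin> E"
      using vertex_edge_iff[OF ij(1) g ij(2) gain.one_closed] by blast
    moreover have "\<not> same_fibre (vertex (i, ?g)) (vertex (j, \<one>\<^bsub>\<Gamma>\<^esub>))"
      using vertex_same_fibre[OF ij(1) g ij(2) gain.one_closed] ij(3) by blast
    ultimately have "gdist E (vertex (i, ?g)) (vertex (j, \<one>\<^bsub>\<Gamma>\<^esub>)) = 2"
      by (intro antipodal_gdist_eq_2[OF anti] vertex_in ij g gain.one_closed)
    then have "card {w \<in> V. (vertex (i, ?g), w) \<in> E \<and> (vertex (j, \<one>\<^bsub>\<Gamma>\<^esub>), w) \<in> E} = c"
      using assms vertex_in[OF ij(1) g] vertex_in[OF ij(2) gain.one_closed] unfolding drackn_def by blast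
    then show "card (gain.paths i j ?g) = c"
      using gain.common_nbrs[OF uv] common_nbrs_vertex[OF uv] g by simp
  qed
  then show ?thesis unfolding order_\<Gamma> .
qed

end

lemma regular_abelian_drackn_roux:
  fixes V :: "'v set"
  assumes drackn: "drackn n r c V E \<F>" and reg: "regular_cover n r V E \<F>" and ab: "abelian_cover n r V E \<F>"
  shows "\<exists>(\<Gamma> :: (nat \<Rightarrow> nat) monoid) B.
    comm_group \<Gamma> \<and> finite (carrier \<Gamma>) \<and> roux \<Gamma> n B \<and> roux_params \<Gamma> n B (drackn_params \<Gamma> n r c) \<and>
    cover_iso V E \<F> (roux_verts \<Gamma> n) (roux_edges \<Gamma> n B) (roux_fibres \<Gamma> n)"
proof -
  interpret complete_cover_graph n r V E \<F>
    by unfold_locales (use reg in \<open>simp add: regular_cover_def\<close>)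
  obtain l where "cover_labelling n r \<F> l" using cover_labelling_ex by blast
  moreover have "V \<noteq> {}"
    using drackn by (simp add: drackn_def antipodal_cover_def antipodal_with_def connected_graph_def)
  ultimately interpret regular_abelian_cover n r V E \<F> l by unfold_locales (use reg ab in blast)+
  show ?thesis
    using comm_group_\<Gamma> finite_\<Gamma> gain.roux_params_imp_roux[OF drackn_gain_params[OF drackn]]
      drackn_gain_params[OF drackn] cover_iso_roux by (intro exI[of _ \<Gamma>] exI[of _ gain.B] conjI)
qed

section \<open>Matrices whose lift is a cover\<close>

text \<open>The lift at (i, x) and (j, \<one>) is the coefficient of x in \<open>B i j\<close>.
  Independence of fibres kills the diagonal, and the matching between two fibres leaves exactly one
  coefficient equal to 1; symmetry of the edges yields (R3).\<close>

lemma (in comm_group) cover_imp_roux_conditions: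
  assumes fin: "finite (carrier G)" and B: "B \<in> ga_mats G n"
    and adj: "is_adjacency_matrix (roux_verts G n) E (roux_lift G B)"
    and cov: "complete_cover n (order G) (roux_verts G n) E (roux_fibres G n)"
  shows "roux_R1 G n B \<and> roux_R2 G n B \<and> roux_R3 G n B"
proof -
  interpret complete_cover_graph n "order G" "roux_verts G n" E "roux_fibres G n"
    by unfold_locales (rule cov)
  have fib: "{i} \<times> carrier G \<in> roux_fibres G n" if "i \<in> {1..n}" for i
    using that by (auto simp: roux_fibres_def)
  have entry: "B i j (g \<otimes> inv h) = of_bool (((i, g), (j, h)) \<in> E)"
    if "i \<in> {1..n}" "j \<in> {1..n}" "g \<in> carrier G" "h \<in> carrier G" for i j g h
  proof -
    have "roux_lift G B (i, g) (j, h) = of_bool (((i, g), (j, h)) \<in> E)"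
      using adj that unfolding is_adjacency_matrix_def by (simp add: roux_verts_def)
    then show ?thesis using cayley_eq[OF fin that(3,4)] by (simp add: roux_lift_def)
  qed
  have outside: "B i j g = 0" if "i \<in> {1..n}" "j \<in> {1..n}" "g \<notin> carrier G" for i j g
  proof -
    have "B i j \<in> carrier (group_algebra G)" using B that(1,2) by (simp add: ga_mats_def)
    then show ?thesis using that(3) by (simp add: group_algebra_def)
  qed
  have R1: "B i i = (\<lambda>_. 0)" if i: "i \<in> {1..n}" for i
  proof
    fix g
    show "B i i g = 0"
    proof (cases "g \<in> carrier G")
      case True
      then have "((i, g), (i, \<one>)) \<notin> E" by (intro independent[OF fib[OF i]]) auto
      then show ?thesis using entry[OF i i True one_closed] True by simp
    qed (rule outside[OF i i])
  qed
  have R2: "\<exists>x\<in>carrier G. B i j = ga_of x \<and> ((i, x), (j, \<one>)) \<in> E"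
    if ij: "i \<in> {1..n}" "j \<in> {1..n}" "i \<noteq> j" for i j
  proof -
    have "{j} \<times> carrier G \<noteq> {i} \<times> carrier G" using ij(3) one_closed by blast
    then have ex1: "\<exists>!v. v \<in> {i} \<times> carrier G \<and> ((j, \<one>), v) \<in> E"
      by (rule nbr[OF fib[OF ij(2)] fib[OF ij(1)]]) simp
    then obtain x where x: "x \<in> carrier G" "((j, \<one>), (i, x)) \<in> E" by blast
    have "B i j g = ga_of x g" for g
    proof (cases "g \<in> carrier G")
      case True
      have "((i, g), (j, \<one>)) \<in> E \<longleftrightarrow> g = x"
      proof
        assume "((i, g), (j, \<one>)) \<in> E"
        then have "(j, \<one>) \<in> roux_verts G n" "((j, \<one>), (i, g)) \<in> E" using edges_V edge_commute by blast+
        then have "(i, g) = (i, x)" using nbr_unique[OF fib[OF ij(1)] _ _ _ x(2)] True x(1) by blast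
        then show "g = x" by simp
      qed (use x edge_commute in blast)
      then show ?thesis using entry[OF ij(1,2) True one_closed] True by (simp add: ga_of_apply)
    next
      case False
      then show ?thesis using outside[OF ij(1,2)] x(1) by (auto simp: ga_of_apply)
    qed
    then show ?thesis using x edge_commute by blast
  qed
  have "B j i = inv\<^bsub>group_algebra G\<^esub> (B i j)" if ij: "i \<in> {1..n}" "j \<in> {1..n}" "i \<noteq> j" for i j
  proof -
    obtain x where x: "x \<in> carrier G" "B i j = ga_of x" "((i, x), (j, \<one>)) \<in> E" using R2[OF ij] by blast
    obtain y where y: "y \<in> carrier G" "B j i = ga_of y" using R2[OF ij(2,1)] ij(3) by blast
    have "((j, \<one>), (i, x)) \<in> E" using x(3) edge_commute by blast
    \<comment> \<open>The same edge read backwards: the lift at (j, \<one>) and (i, x) is the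
      coefficient of \<open>inv x\<close>.\<close>
    then have "B j i (inv x) = 1" using entry[OF ij(2,1) one_closed x(1)] x(1) by simp
    then have "y = inv x" unfolding y(2) by (simp add: ga_of_apply)
    then show ?thesis unfolding x(2) y(2) inv_ga_of[OF fin x(1)] by simp
  qed
  then show ?thesis using R1 R2 unfolding roux_R1_def roux_R2_def roux_R3_def zero_group_algebra by blast
qed

lemma roux_imp_gain_matrix:
  assumes "comm_group \<Gamma>" "finite (carrier \<Gamma>)" "roux \<Gamma> n B"
  obtains b where "gain_matrix \<Gamma> n b" "B = gain_mat n b"
  using comm_group.roux_conditions_imp_gain_matrix[OF assms(1,2)] assms(3) that
  unfolding roux_def by blast

lemma roux_conditions_iff_abelian_cover:
  fixes \<Gamma> :: "('g, 'm) monoid_scheme"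
  assumes \<Gamma>: "comm_group \<Gamma>" "finite (carrier \<Gamma>)" and B: "B \<in> ga_mats \<Gamma> n"
  shows "roux_R1 \<Gamma> n B \<and> roux_R2 \<Gamma> n B \<and> roux_R3 \<Gamma> n B \<longleftrightarrow>
    (\<exists>E. is_adjacency_matrix (roux_verts \<Gamma> n) E (roux_lift \<Gamma> B) \<and>
      abelian_cover n (order \<Gamma>) (roux_verts \<Gamma> n) E (roux_fibres \<Gamma> n))"
proof
  assume "roux_R1 \<Gamma> n B \<and> roux_R2 \<Gamma> n B \<and> roux_R3 \<Gamma> n B"
  then obtain b where b: "gain_matrix \<Gamma> n b" "B = gain_mat n b"
    using comm_group.roux_conditions_imp_gain_matrix[OF \<Gamma> B] by blast
  interpret gain_matrix \<Gamma> n b by (rule b(1))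
  show "\<exists>E. is_adjacency_matrix (roux_verts \<Gamma> n) E (roux_lift \<Gamma> B) \<and>
      abelian_cover n (order \<Gamma>) (roux_verts \<Gamma> n) E (roux_fibres \<Gamma> n)"
    unfolding b(2) using adjacency abelian by blast
next
  assume "\<exists>E. is_adjacency_matrix (roux_verts \<Gamma> n) E (roux_lift \<Gamma> B) \<and>
      abelian_cover n (order \<Gamma>) (roux_verts \<Gamma> n) E (roux_fibres \<Gamma> n)"
  then show "roux_R1 \<Gamma> n B \<and> roux_R2 \<Gamma> n B \<and> roux_R3 \<Gamma> n B"
    using comm_group.cover_imp_roux_conditions[OF \<Gamma> B] unfolding abelian_cover_def by blast
qed

text \<open>Nonvanishing of the parameters is the hub: diameter 3 implies it, and it yields the
  diameter, antipodality and regularity together.\<close>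

lemma roux_diameter_3:
  fixes \<Gamma> :: "('g, 'm) monoid_scheme"
  assumes \<Gamma>: "comm_group \<Gamma>" "finite (carrier \<Gamma>)" and size: "order \<Gamma> \<ge> 2" "n \<ge> 2"
    and B: "roux \<Gamma> n B" and params: "roux_params \<Gamma> n B c"
  shows "gdiameter (roux_verts \<Gamma> n) (roux_edges \<Gamma> n B) = 3 \<longleftrightarrow> (\<forall>g\<in>carrier \<Gamma> - {\<one>\<^bsub>\<Gamma>\<^esub>}. c g \<noteq> 0)"
    and "gdiameter (roux_verts \<Gamma> n) (roux_edges \<Gamma> n B) = 3 \<Longrightarrow>
      regular_cover n (order \<Gamma>) (roux_verts \<Gamma> n) (roux_edges \<Gamma> n B) (roux_fibres \<Gamma> n) \<and>
      antipodal_cover n (order \<Gamma>) (roux_verts \<Gamma> n) (roux_edges \<Gamma> n B) (roux_fibres \<Gamma> n)"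
proof -
  obtain b where b: "gain_matrix \<Gamma> n b" "B = gain_mat n b" using roux_imp_gain_matrix[OF \<Gamma> B] .
  interpret gain_matrix \<Gamma> n b by (rule b(1))
  note params' = params[unfolded b(2)]
  have 1: "\<forall>g\<in>carrier \<Gamma> - {\<one>\<^bsub>\<Gamma>\<^esub>}. c g \<noteq> 0" if "gdiameter verts edges = 3"
    using diameter_3_imp_nonzero[OF size(2) params' that] by blast
  have 2: "gdiameter verts edges = 3 \<and> regular_cover n (order \<Gamma>) verts edges fibres \<and>
    antipodal_cover n (order \<Gamma>) verts edges fibres" if nz: "\<forall>g\<in>carrier \<Gamma> - {\<one>\<^bsub>\<Gamma>\<^esub>}. c g \<noteq> 0"
  proof -
    have nz': "c g \<noteq> 0" if "g \<in> carrier \<Gamma>" "g \<noteq> \<one>\<^bsub>\<Gamma>\<^esub>" for g using nz that by blast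
    interpret joined_cover_graph n "order \<Gamma>" verts edges fibres by (rule joined[OF size(2,1) params' nz'])
    show ?thesis using diameter antipodal regular[OF size(2) params' nz'] by blast
  qed
  show "gdiameter (roux_verts \<Gamma> n) (roux_edges \<Gamma> n B) = 3 \<longleftrightarrow> (\<forall>g\<in>carrier \<Gamma> - {\<one>\<^bsub>\<Gamma>\<^esub>}. c g \<noteq> 0)"
    unfolding b(2) using 1 2 by blast
  show "regular_cover n (order \<Gamma>) (roux_verts \<Gamma> n) (roux_edges \<Gamma> n B) (roux_fibres \<Gamma> n) \<and>
      antipodal_cover n (order \<Gamma>) (roux_verts \<Gamma> n) (roux_edges \<Gamma> n B) (roux_fibres \<Gamma> n)"
    if "gdiameter (roux_verts \<Gamma> n) (roux_edges \<Gamma> n B) = 3"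
    using 2[OF 1[OF that[unfolded b(2)]]] unfolding b(2) by blast
qed

lemma roux_drackn_params:
  fixes \<Gamma> :: "('g, 'm) monoid_scheme" and c :: nat
  assumes \<Gamma>: "comm_group \<Gamma>" "finite (carrier \<Gamma>)" and size: "order \<Gamma> \<ge> 2" "n \<ge> 2"
    and B: "roux \<Gamma> n B" and params: "roux_params \<Gamma> n B (drackn_params \<Gamma> n (order \<Gamma>) c)" and c: "c \<noteq> 0"
  shows "drackn n (order \<Gamma>) c (roux_verts \<Gamma> n) (roux_edges \<Gamma> n B) (roux_fibres \<Gamma> n)"
    and "regular_cover n (order \<Gamma>) (roux_verts \<Gamma> n) (roux_edges \<Gamma> n B) (roux_fibres \<Gamma> n)"
    and "abelian_cover n (order \<Gamma>) (roux_verts \<Gamma> n) (roux_edges \<Gamma> n B) (roux_fibres \<Gamma> n)"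
proof -
  obtain b where b: "gain_matrix \<Gamma> n b" "B = gain_mat n b" using roux_imp_gain_matrix[OF \<Gamma> B] .
  interpret gain_matrix \<Gamma> n b by (rule b(1))
  note params' = params[unfolded b(2)]
  have "drackn_params \<Gamma> n (order \<Gamma>) c g \<noteq> 0" if "g \<noteq> \<one>\<^bsub>\<Gamma>\<^esub>" for g
    using c that by (simp add: drackn_params_def)
  then show "regular_cover n (order \<Gamma>) (roux_verts \<Gamma> n) (roux_edges \<Gamma> n B) (roux_fibres \<Gamma> n)"
    unfolding b(2) by (intro regular[OF size(2) params'])
  show "drackn n (order \<Gamma>) c (roux_verts \<Gamma> n) (roux_edges \<Gamma> n B) (roux_fibres \<Gamma> n)"
    unfolding b(2) by (rule roux_drackn[OF size(2,1) c params'])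
  show "abelian_cover n (order \<Gamma>) (roux_verts \<Gamma> n) (roux_edges \<Gamma> n B) (roux_fibres \<Gamma> n)"
    unfolding b(2) by (rule abelian)
qed

text \<open>The bounds in (c) and (d) exclude degenerate sizes: over the trivial group the roux
  graph is complete, and for n \<le> 1 the equation leaves the parameters undetermined. The group in
  (a) consists of permutations of naturals because it is the cover group.\<close>

theorem theorem4p2:
  shows "(\<forall>n r c (V :: 'v set) E \<F>.
            drackn n r c V E \<F> \<and> regular_cover n r V E \<F> \<and> abelian_cover n r V E \<F> \<longrightarrow>
            (\<exists>(\<Gamma> :: (nat \<Rightarrow> nat) monoid) B.
               comm_group \<Gamma> \<and> finite (carrier \<Gamma>) \<and> roux \<Gamma> n B \<and>
               roux_params \<Gamma> n B (drackn_params \<Gamma> n r c) \<and>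
               cover_iso V E \<F> (roux_verts \<Gamma> n) (roux_edges \<Gamma> n B) (roux_fibres \<Gamma> n)))
       \<and> (\<forall>(\<Gamma> :: ('g, 'm) monoid_scheme) n B.
            comm_group \<Gamma> \<and> finite (carrier \<Gamma>) \<and> B \<in> ga_mats \<Gamma> n \<longrightarrow>
            (roux_R1 \<Gamma> n B \<and> roux_R2 \<Gamma> n B \<and> roux_R3 \<Gamma> n B \<longleftrightarrow>
             (\<exists>E. is_adjacency_matrix (roux_verts \<Gamma> n) E (roux_lift \<Gamma> B) \<and>
                  abelian_cover n (order \<Gamma>) (roux_verts \<Gamma> n) E (roux_fibres \<Gamma> n))))
       \<and> (\<forall>(\<Gamma> :: ('g, 'm) monoid_scheme) n B c.
            comm_group \<Gamma> \<and> finite (carrier \<Gamma>) \<and> order \<Gamma> \<ge> 2 \<and> n \<ge> 2 \<and>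
            roux \<Gamma> n B \<and> roux_params \<Gamma> n B c \<longrightarrow>
            (gdiameter (roux_verts \<Gamma> n) (roux_edges \<Gamma> n B) = 3 \<longleftrightarrow>
               (\<forall>g\<in>carrier \<Gamma> - {\<one>\<^bsub>\<Gamma>\<^esub>}. c g \<noteq> 0)) \<and>
            (gdiameter (roux_verts \<Gamma> n) (roux_edges \<Gamma> n B) = 3 \<longrightarrow>
               regular_cover n (order \<Gamma>) (roux_verts \<Gamma> n) (roux_edges \<Gamma> n B) (roux_fibres \<Gamma> n) \<and>
               antipodal_cover n (order \<Gamma>) (roux_verts \<Gamma> n) (roux_edges \<Gamma> n B) (roux_fibres \<Gamma> n)))
       \<and> (\<forall>(\<Gamma> :: ('g, 'm) monoid_scheme) n B (c :: nat).
            comm_group \<Gamma> \<and> finite (carrier \<Gamma>) \<and> order \<Gamma> \<ge> 2 \<and> n \<ge> 2 \<and>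
            roux \<Gamma> n B \<and> roux_params \<Gamma> n B (drackn_params \<Gamma> n (order \<Gamma>) c) \<and> c \<noteq> 0 \<longrightarrow>
            drackn n (order \<Gamma>) c (roux_verts \<Gamma> n) (roux_edges \<Gamma> n B) (roux_fibres \<Gamma> n) \<and>
            regular_cover n (order \<Gamma>) (roux_verts \<Gamma> n) (roux_edges \<Gamma> n B) (roux_fibres \<Gamma> n) \<and>
            abelian_cover n (order \<Gamma>) (roux_verts \<Gamma> n) (roux_edges \<Gamma> n B) (roux_fibres \<Gamma> n))"
  by (intro conjI allI impI; elim conjE)
    (simp_all only: regular_abelian_drackn_roux roux_conditions_iff_abelian_cover roux_diameter_3 roux_drackn_params simp_thms)

end
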